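(* (1) Let $a\in\mathbb R\setminus\{0\}$, $b\in\mathbb R\setminus[-1,0]$ and consider the unperturbed ($\epsilon=0$) reversible zero-Hopf system $$x'=-x^2-a(y^2+z^2)+F(x,y,z),\quad y'=bxy-z+G(x,y,z),\quad z'=bxz+y+H(x,y,z),$$ with $F,G,H$ real-analytic near $0$, each $\mathcal O(|(x,y,z)|^3)$, and $F(-x,-z,-y)=F(x,y,z)$, $G(-x,-z,-y)=H(x,y,z)$. Then there exists a change of coordinates (of blowup-type) that brings this system into the normal form $(\mathrm{NF})$ below, with $n=1$. (2) Let $b\in\mathbb R\setminus\{0\}$, $c,\beta,\gamma\in\mathbb R$ and consider the unperturbed ($\epsilon=0$) reversible resonant Hopf-Hopf system $$\dot x=-(1+\Omega)y+z+F,\quad\dot y=(1+\Omega)x+w+G,\quad\dot z=-(1+\Omega)w+\Gamma x+H,\quad\dot w=(1+\Omega)z+\Gamma y+J,$$ with $\Gamma=-b\rho^2+cL$, $\Omega=\beta\rho^2+\gamma L$, $\rho^2:=x^2+y^2$, $L:=wx-yz$, and $F,G,H,J$ real-analytic functions of $(x,y,z,w)$ near $0$, each $\mathcal O(|(x,y,z,w)|^5)$, the system being reversible with respect to $\mathcal S:(x,y,z,w)\mapsto(x,-y,-z,w)$. Then there exists a change of coordinates (of blowup-type) that brings this system into the normal form $(\mathrm{NF})$ below, with $n=2$. Normal form: $$(\mathrm{NF})\qquad \dot x=x^2\bigl(1+xF_0+x^2F_1(x,\mathbf y,\theta)\bigr),\quad\dot{\mathbf y}=x\bigl(-\mathbf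 A\mathbf y+x\,\mathbf G_1(x,\mathbf y,\theta)\bigr),\quad\dot\theta=1,$$ where $F_0\in\mathbb C$, $\mathbf A=\operatorname{diag}(\lambda^1,\dots,\lambda^n)$ is real with all $\lambda^j>0$, and $F_1:B_\kappa\times B_\kappa^n\times\mathbb T_\zeta\to\mathbb C$, $\mathbf G_1:B_\kappa\times B_\kappa^n\times\mathbb T_\zeta\to\mathbb C^n$ are analytic for some $\kappa,\zeta>0$.
   Context: $B_\kappa^n\subset\mathbb C^n$ is the open ball of radius $\kappa$ centered at $0$, $B_\kappa:=B_\kappa^1$; $\mathbb T_\zeta:=\{\theta\in\mathbb C/(2\pi\mathbb Z):|\operatorname{Im}\theta|<\zeta\}$. The systems are considered in complexified phase space ($\mathbb C^3$, resp. $\mathbb C^4$, near the origin). A system with vector field $X$ is reversible with respect to a linear involution $\mathcal S$ if $X\circ\mathcal S=-\mathcal S X$. "A change of coordinates of blowup-type brings the system with vector field $X$ on a neighborhood of $0\in\mathbb C^{n+2}$ into the form $(\mathrm{NF})$" means: there is an analytic map $\Psi:B_\kappa\times B_\kappa^n\times\mathbb T_\zeta\to\mathbb C^{n+2}$, $(x,\mathbf y,\theta)\mapsto\Psi(x,\mathbf y,\theta)$ (with values in the domain of $X$), which maps $\{x=0\}$ to the origin and is a local biholomorphism at every point with $x\ne0$, such that the pullback of $X$ by $\Psi$ on $\{x\neq0\}$ equals a nowhere vanishing analytic function on $B_\kappa\times B_\kappa^n\times\mathbb T_\zeta$ times the vector field $(\mathrm{NF})$ (i.e. equality holds after division of the right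 hand side by a nonzero quantity). *)

theory Defs
  imports "HOL-Analysis.Analysis" "HOL-Library.Landau_Symbols"
begin

section \<open>Complex scalar multiplication on products of complex coordinate spaces\<close>

class complex_vector = real_vector +
  fixes scaleC :: "complex \<Rightarrow> 'a \<Rightarrow> 'a"  (infixr \<open>*\<^sub>C\<close> 75)
  assumes scaleC_add_right: "c *\<^sub>C (u + v) = c *\<^sub>C u + c *\<^sub>C v"
    and scaleC_add_left: "(c + d) *\<^sub>C v = c *\<^sub>C v + d *\<^sub>C v"
    and scaleC_scaleC: "c *\<^sub>C d *\<^sub>C v = (c * d) *\<^sub>C v"
    and scaleC_one: "1 *\<^sub>C v = v"
    and scaleR_scaleC: "r *\<^sub>R v = complex_of_real r *\<^sub>C v"

instantiation complex :: complex_vector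
begin
definition scaleC_complex_def: "c *\<^sub>C (z :: complex) = c * z"
instance
  by standard (simp_all add: scaleC_complex_def algebra_simps scaleR_conv_of_real)
end

instantiation prod :: (complex_vector, complex_vector) complex_vector
begin
definition scaleC_prod_def: "c *\<^sub>C p = (c *\<^sub>C fst p, c *\<^sub>C snd p)"
instance
  by standard
    (simp_all add: scaleC_prod_def scaleC_add_right scaleC_add_left scaleC_scaleC scaleC_one
       scaleR_scaleC prod_eq_iff)
end

instantiation vec :: (complex_vector, finite) complex_vector
begin
definition scaleC_vec_def: "c *\<^sub>C v = (\<chi> i. c *\<^sub>C (v $ i))"
instance
  by standard
    (simp_all add: scaleC_vec_def scaleC_add_right scaleC_add_left scaleC_scaleC scaleC_one
       scaleR_scaleC vec_eq_iff)
end


section \<open>Analyticity\<close>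

text \<open>
  As for \<^const>\<open>analytic_on\<close> in one variable, a map between open subsets of complex vector spaces
  is called analytic if it is complex differentiable, i.e. its Frechet derivative exists and is
  complex linear. The definition is only meant for open sets.
\<close>
definition analytic_map_on ::
  "('a::{complex_vector,real_normed_vector} \<Rightarrow> 'b::{complex_vector,real_normed_vector}) \<Rightarrow> 'a set \<Rightarrow> bool"
  (infixl \<open>analytic'_map'_on\<close> 50)
  where "f analytic_map_on S \<longleftrightarrow>
    (\<forall>p\<in>S. \<exists>D. (f has_derivative D) (at p) \<and> (\<forall>c h. D (c *\<^sub>C h) = c *\<^sub>C D h))"

definition local_biholomorphism_at ::
  "('a::{complex_vector,real_normed_vector} \<Rightarrow> 'b::{complex_vector,real_normed_vector}) \<Rightarrow> 'a \<Rightarrow> bool"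
  where "local_biholomorphism_at f p \<longleftrightarrow>
    (\<exists>U. open U \<and> p \<in> U \<and> open (f ` U) \<and> inj_on f U \<and>
         f analytic_map_on U \<and> inv_into U f analytic_map_on (f ` U))"

text \<open>
  A real-analytic function near the origin of $R^n$, regarded as a function on the complexified
  space: near 0 it is the sum of a power series with real coefficients.
\<close>
definition real_analytic_near_0 :: "(complex ^ 'n \<Rightarrow> complex) \<Rightarrow> bool"
  where "real_analytic_near_0 f \<longleftrightarrow>
    (\<exists>r>0. \<exists>c :: ('n \<Rightarrow> nat) \<Rightarrow> real. \<forall>v. norm v < r \<longrightarrow>
       ((\<lambda>\<alpha>. complex_of_real (c \<alpha>) * (\<Prod>i\<in>UNIV. (v $ i) ^ \<alpha> i)) has_sum f v) UNIV)"

definition vanishes_to_order :: "nat \<Rightarrow> (complex ^ 'n \<Rightarrow> complex) \<Rightarrow> bool"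
  where "vanishes_to_order k f \<longleftrightarrow> (\<lambda>v. norm (f v)) \<in> O[nhds 0](\<lambda>v. norm v ^ k)"


section \<open>Normal form and changes of coordinates of blowup-type\<close>

definition BBT :: "real \<Rightarrow> real \<Rightarrow> (complex \<times> (complex ^ 'n) \<times> complex) set"
  where "BBT \<kappa> \<zeta> = ball 0 \<kappa> \<times> ball 0 \<kappa> \<times> {\<theta>. \<bar>Im \<theta>\<bar> < \<zeta>}"

text \<open>
  The angle lives in C modulo 2 pi. Functions on the quotient are rendered as functions on the
  strip that are periodic in the angle.
\<close>
definition analytic_on_BBT ::
  "real \<Rightarrow> real \<Rightarrow> (complex \<times> (complex ^ 'n) \<times> complex \<Rightarrow> 'b::{complex_vector,real_normed_vector}) \<Rightarrow> bool"
  where "analytic_on_BBT \<kappa> \<zeta> f \<longleftrightarrow>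
    f analytic_map_on (BBT \<kappa> \<zeta>) \<and>
    (\<forall>(x, y, \<theta>) \<in> BBT \<kappa> \<zeta>. f (x, y, \<theta> + 2 * complex_of_real pi) = f (x, y, \<theta>))"

definition diag_matrix :: "real ^ 'n \<Rightarrow> complex ^ 'n ^ 'n"
  where "diag_matrix l = (\<chi> i j. if i = j then complex_of_real (l $ i) else 0)"

definition NF ::
  "complex \<Rightarrow> real ^ 'n \<Rightarrow> (complex \<times> (complex ^ 'n) \<times> complex \<Rightarrow> complex) \<Rightarrow>
   (complex \<times> (complex ^ 'n) \<times> complex \<Rightarrow> complex ^ 'n) \<Rightarrow>
   complex \<times> (complex ^ 'n) \<times> complex \<Rightarrow> complex \<times> (complex ^ 'n) \<times> complex"
  where "NF F0 l F1 G1 = (\<lambda>(x, y, \<theta>).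
    (x\<^sup>2 * (1 + x * F0 + x\<^sup>2 * F1 (x, y, \<theta>)),
     x *s (- (diag_matrix l *v y) + x *s G1 (x, y, \<theta>)),
     1))"

text \<open>Only meaningful at points where the derivative of \<open>\<Psi>\<close> is invertible.\<close>
definition pullback_field ::
  "('a::real_normed_vector \<Rightarrow> 'b::real_normed_vector) \<Rightarrow> ('b \<Rightarrow> 'b) \<Rightarrow> 'a \<Rightarrow> 'a"
  where "pullback_field \<Psi> X p = inv (frechet_derivative \<Psi> (at p)) (X (\<Psi> p))"

text \<open>
  \<open>W\<close> is the domain of the vector field \<open>X\<close>; the type argument fixes the dimension $n$ of the
  variable $y$. \<open>\<Psi>\<close> can be a local biholomorphism only if \<open>'m\<close> has $n + 2$ elements.
\<close>
definition blowup_to_NF ::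
  "'n::finite itself \<Rightarrow> (complex ^ 'm) set \<Rightarrow> (complex ^ 'm \<Rightarrow> complex ^ 'm) \<Rightarrow> bool"
  where "blowup_to_NF (_ :: 'n itself) W X \<longleftrightarrow>
    (\<exists>\<kappa>>0. \<exists>\<zeta>>0. \<exists>(\<Psi> :: complex \<times> (complex ^ 'n) \<times> complex \<Rightarrow> complex ^ 'm) g F0 l F1 G1.
       (\<forall>j. l $ j > 0) \<and>
       analytic_on_BBT \<kappa> \<zeta> F1 \<and> analytic_on_BBT \<kappa> \<zeta> G1 \<and>
       analytic_on_BBT \<kappa> \<zeta> \<Psi> \<and> \<Psi> ` BBT \<kappa> \<zeta> \<subseteq> W \<and>
       (\<forall>(x, y, \<theta>) \<in> BBT \<kappa> \<zeta>. x = 0 \<longrightarrow> \<Psi> (x, y, \<theta>) = 0) \<and>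
       (\<forall>(x, y, \<theta>) \<in> BBT \<kappa> \<zeta>. x \<noteq> 0 \<longrightarrow> local_biholomorphism_at \<Psi> (x, y, \<theta>)) \<and>
       analytic_on_BBT \<kappa> \<zeta> g \<and> (\<forall>p \<in> BBT \<kappa> \<zeta>. g p \<noteq> 0) \<and>
       (\<forall>(x, y, \<theta>) \<in> BBT \<kappa> \<zeta>. x \<noteq> 0 \<longrightarrow>
          pullback_field \<Psi> X (x, y, \<theta>) = g (x, y, \<theta>) *\<^sub>C NF F0 l F1 G1 (x, y, \<theta>)))"


section \<open>The two systems\<close>

definition reversible_near_0 ::
  "(complex ^ 'm \<Rightarrow> complex ^ 'm) \<Rightarrow> (complex ^ 'm \<Rightarrow> complex ^ 'm) \<Rightarrow> bool"
  where "reversible_near_0 S X \<longleftrightarrow> (\<forall>\<^sub>F v in nhds 0. X (S v) = - S (X v))"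

definition zero_hopf ::
  "real \<Rightarrow> real \<Rightarrow> (complex ^ 3 \<Rightarrow> complex) \<Rightarrow> (complex ^ 3 \<Rightarrow> complex) \<Rightarrow> (complex ^ 3 \<Rightarrow> complex) \<Rightarrow>
   complex ^ 3 \<Rightarrow> complex ^ 3"
  where "zero_hopf a b F G H v =
    (let x = v $ 1; y = v $ 2; z = v $ 3
     in vector [- x\<^sup>2 - of_real a * (y\<^sup>2 + z\<^sup>2) + F v,
                of_real b * x * y - z + G v,
                of_real b * x * z + y + H v])"

definition hopf_hopf ::
  "real \<Rightarrow> real \<Rightarrow> real \<Rightarrow> real \<Rightarrow> (complex ^ 4 \<Rightarrow> complex) \<Rightarrow> (complex ^ 4 \<Rightarrow> complex) \<Rightarrow>
   (complex ^ 4 \<Rightarrow> complex) \<Rightarrow> (complex ^ 4 \<Rightarrow> complex) \<Rightarrow> complex ^ 4 \<Rightarrow> complex ^ 4"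
  where "hopf_hopf b c \<beta> \<gamma> F G H J v =
    (let x = v $ 1; y = v $ 2; z = v $ 3; w = v $ 4;
         \<rho>2 = x\<^sup>2 + y\<^sup>2; L = w * x - y * z;
         \<Gamma> = - of_real b * \<rho>2 + of_real c * L;
         \<Omega> = of_real \<beta> * \<rho>2 + of_real \<gamma> * L
     in vector [- (1 + \<Omega>) * y + z + F v,
                (1 + \<Omega>) * x + w + G v,
                - (1 + \<Omega>) * w + \<Gamma> * x + H v,
                (1 + \<Omega>) * z + \<Gamma> * y + J v])"

end

theory Submission
  imports Defs "HOL-Complex_Analysis.Cauchy_Integral_Formula"
begin

text \<open>
  Near the origin both systems are governed by terms that are homogeneous for a suitable
  scaling. In polar coordinates adapted to the scaling the radius \<open>r\<close> can be divided out, and the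
  remaining shape variables have an equilibrium on the blown-up origin \<open>r = 0\<close>. This equilibrium may be
  complex, which is why the phase space is complexified. Along it \<open>r\<close> grows
  like \<open>r' = const * r ^ 2\<close>; measured by the normalized radius \<open>s\<close> with \<open>s' = s ^ 2\<close>, the
  rates of the linearization at the equilibrium are real: \<open>- 2 * (1 + b) / b\<close> for the zero-Hopf
  system, which is negative because \<open>b\<close> lies outside of \<open>{-1..0}\<close>, and \<open>- 4\<close>, \<open>- 3\<close> for the Hopf-Hopf system.

  The normal form demands more: at order \<open>x ^ 3\<close> the first component must be constant, and the
  second component must be linear in \<open>y\<close> at order \<open>x\<close>. Most of this is achieved by writing the deviation
  from the equilibrium as \<open>s * z\<close>. This raises the rates by 1, so
  they keep their sign, and every quadratic term in \<open>z\<close> gains a factor \<open>s\<close>. What is left is a linear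
  dependence on \<open>z\<close> and on the angle at order \<open>s ^ 3\<close>, and a forcing of \<open>z\<close> that depends on the angle. The polynomial
  substitution \<open>s = X * (1 + X * cdot k y + X ^ 2 * K1 \<theta>)\<close>, \<open>z = y + X * K2 \<theta>\<close> removes
  them (\<open>blowup_to_NF_of_averaged_form\<close>): \<open>k\<close> solves a linear equation whose coefficients are the
  rates, and \<open>K1\<close>, \<open>K2\<close> are periodic primitives (\<open>periodic_primitive_minus_mean\<close>). The
  mean value of the forcing has no periodic primitive and is absorbed by a shift of \<open>z\<close>.

  The analytic part consists in dividing by \<open>s\<close>. An analytic function that is \<open>O(s ^ k)\<close> for fixed
  values of the other variables has an analytic cofactor (\<open>analytic_map_on_divide_order\<close>), by Cauchy's formula with
  parameters. This is applied to the higher order terms of the systems (\<open>analytic_scaling_quotient\<close>).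
\<close>

section \<open>Analytic maps between complex vector spaces\<close>

lemma analytic_map_on_subset: "f analytic_map_on S \<Longrightarrow> T \<subseteq> S \<Longrightarrow> f analytic_map_on T"
  by (auto simp: analytic_map_on_def)

lemma analytic_map_onI:
  assumes "\<And>p. p \<in> S \<Longrightarrow> (f has_derivative D p) (at p)"
    and "\<And>p c h. p \<in> S \<Longrightarrow> D p (c *\<^sub>C h) = c *\<^sub>C D p h"
  shows "f analytic_map_on S"
  using assms unfolding analytic_map_on_def by blast

lemma analytic_map_onE:
  assumes "f analytic_map_on S"
  obtains D where "\<And>p. p \<in> S \<Longrightarrow> (f has_derivative D p) (at p)"
    and "\<And>p c h. p \<in> S \<Longrightarrow> D p (c *\<^sub>C h) = c *\<^sub>C D p h"
  using assms unfolding analytic_map_on_def by metis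

lemma analytic_map_on_has_derivative_scaleC:
  assumes "f analytic_map_on S" "p \<in> S" "(f has_derivative D) (at p)"
  shows "D (c *\<^sub>C h) = c *\<^sub>C D h"
  using assms has_derivative_unique unfolding analytic_map_on_def by metis

lemma analytic_map_on_frechet_derivative:
  assumes "f analytic_map_on S" "p \<in> S"
  shows "(f has_derivative frechet_derivative f (at p)) (at p)"
    and "frechet_derivative f (at p) (c *\<^sub>C h) = c *\<^sub>C frechet_derivative f (at p) h"
proof -
  show *: "(f has_derivative frechet_derivative f (at p)) (at p)"
    using assms unfolding analytic_map_on_def
    by (metis differentiable_def frechet_derivative_works)
  show "frechet_derivative f (at p) (c *\<^sub>C h) = c *\<^sub>C frechet_derivative f (at p) h"
    by (rule analytic_map_on_has_derivative_scaleC[OF assms *])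
qed

lemma analytic_map_on_continuous: "f analytic_map_on S \<Longrightarrow> continuous_on S f"
  unfolding analytic_map_on_def
  by (meson continuous_at_imp_continuous_on has_derivative_continuous)

lemma analytic_map_on_isCont: "f analytic_map_on S \<Longrightarrow> p \<in> S \<Longrightarrow> isCont f p"
  unfolding analytic_map_on_def using has_derivative_continuous by blast

lemma analytic_map_on_cong:
  assumes "f analytic_map_on S" "open S" "\<And>p. p \<in> S \<Longrightarrow> f p = g p"
  shows "g analytic_map_on S"
  using assms has_derivative_transform_within_open unfolding analytic_map_on_def by metis

named_theorems analytic_map_intros

lemma analytic_map_on_const [analytic_map_intros]: "(\<lambda>p. c) analytic_map_on S"
proof -
  have "d *\<^sub>C (0::'b) = 0" for d
    using scaleC_add_right[of d "0::'b" 0] by simp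
  then show ?thesis by (intro analytic_map_onI[where D="\<lambda>_ _. 0"]) auto
qed

lemma analytic_map_on_id [analytic_map_intros]: "(\<lambda>p. p) analytic_map_on S"
  by (intro analytic_map_onI[where D="\<lambda>_ h. h"]) auto

lemma analytic_map_on_compose:
  assumes "g analytic_map_on T" "f analytic_map_on S" "f ` S \<subseteq> T"
  shows "(\<lambda>p. g (f p)) analytic_map_on S"
proof -
  obtain F where F: "\<And>p. p \<in> S \<Longrightarrow> (f has_derivative F p) (at p)"
      "\<And>p c h. p \<in> S \<Longrightarrow> F p (c *\<^sub>C h) = c *\<^sub>C F p h"
    using assms(2) by (rule analytic_map_onE) (rule that; assumption)
  obtain G where G: "\<And>p. p \<in> T \<Longrightarrow> (g has_derivative G p) (at p)"
      "\<And>p c h. p \<in> T \<Longrightarrow> G p (c *\<^sub>C h) = c *\<^sub>C G p h"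
    using assms(1) by (rule analytic_map_onE) (rule that; assumption)
  show ?thesis
    using assms(3) F G by (intro analytic_map_onI[where D="\<lambda>p h. G (f p) (F p h)"])
      (auto simp: image_subset_iff intro: has_derivative_compose)
qed

lemma analytic_map_on_bounded_linear:
  assumes "bounded_linear L" "\<And>c h. L (c *\<^sub>C h) = c *\<^sub>C L h" "f analytic_map_on S"
  shows "(\<lambda>p. L (f p)) analytic_map_on S"
proof (rule analytic_map_on_compose[where T=UNIV and g=L])
  show "L analytic_map_on UNIV"
    using assms(1,2) by (intro analytic_map_onI[where D="\<lambda>_. L"] bounded_linear_imp_has_derivative)
qed (use assms(3) in auto)

lemma analytic_map_on_fst [analytic_map_intros]:
  "f analytic_map_on S \<Longrightarrow> (\<lambda>p. fst (f p)) analytic_map_on S"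
  by (rule analytic_map_on_bounded_linear[where L=fst])
    (auto simp: bounded_linear_fst scaleC_prod_def)

lemma analytic_map_on_snd [analytic_map_intros]:
  "f analytic_map_on S \<Longrightarrow> (\<lambda>p. snd (f p)) analytic_map_on S"
  by (rule analytic_map_on_bounded_linear[where L=snd])
    (auto simp: bounded_linear_snd scaleC_prod_def)

lemma analytic_map_on_nth [analytic_map_intros]:
  fixes f :: "_ \<Rightarrow> ('b::{complex_vector,real_normed_vector}) ^ 'n::finite"
  shows "f analytic_map_on S \<Longrightarrow> (\<lambda>p. f p $ i) analytic_map_on S"
  by (rule analytic_map_on_bounded_linear[where L="\<lambda>v. v $ i"])
    (auto simp: bounded_linear_vec_nth scaleC_vec_def)

lemma analytic_map_on_Pair [analytic_map_intros]:
  assumes "f analytic_map_on S" "g analytic_map_on S"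
  shows "(\<lambda>p. (f p, g p)) analytic_map_on S"
proof -
  obtain F where F: "\<And>p. p \<in> S \<Longrightarrow> (f has_derivative F p) (at p)"
      "\<And>p c h. p \<in> S \<Longrightarrow> F p (c *\<^sub>C h) = c *\<^sub>C F p h"
    using assms(1) by (rule analytic_map_onE) (rule that; assumption)
  obtain G where G: "\<And>p. p \<in> S \<Longrightarrow> (g has_derivative G p) (at p)"
      "\<And>p c h. p \<in> S \<Longrightarrow> G p (c *\<^sub>C h) = c *\<^sub>C G p h"
    using assms(2) by (rule analytic_map_onE) (rule that; assumption)
  show ?thesis using F G
    by (intro analytic_map_onI[where D="\<lambda>p h. (F p h, G p h)"])
      (auto simp: scaleC_prod_def intro: has_derivative_Pair)
qed

lemma has_derivative_vec:
  fixes f :: "'a::real_normed_vector \<Rightarrow> 'n::finite \<Rightarrow> complex"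
  assumes "\<And>i. ((\<lambda>p. f p i) has_derivative (\<lambda>h. D h i)) F"
  shows "((\<lambda>p. \<chi> i. f p i) has_derivative (\<lambda>h. \<chi> i. D h i)) F"
proof -
  have bl: "bounded_linear (axis i :: complex \<Rightarrow> complex ^ 'n)" for i
    by (intro linear_conv_bounded_linear[THEN iffD1] linearI) (auto simp: axis_def vec_eq_iff)
  have sum_eq: "(\<chi> i. v i) = (\<Sum>i\<in>UNIV. axis i (v i))" for v :: "'n \<Rightarrow> complex"
    by (simp add: vec_eq_iff axis_def if_distrib cong: if_cong)
  show ?thesis
    unfolding sum_eq
    by (intro has_derivative_sum bounded_linear.has_derivative[OF bl] assms)
qed

lemma analytic_map_on_vec [analytic_map_intros]:
  fixes f :: "'a::{complex_vector,real_normed_vector} \<Rightarrow> 'n::finite \<Rightarrow> complex"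
  assumes "\<And>i. (\<lambda>p. f p i) analytic_map_on S"
  shows "(\<lambda>p. \<chi> i. f p i) analytic_map_on S"
proof -
  from assms obtain D where D: "\<And>i p. p \<in> S \<Longrightarrow> ((\<lambda>p. f p i) has_derivative D i p) (at p)"
      "\<And>i p c h. p \<in> S \<Longrightarrow> D i p (c *\<^sub>C h) = c *\<^sub>C D i p h"
    unfolding analytic_map_on_def by metis
  show ?thesis using D
    by (intro analytic_map_onI[where D="\<lambda>p h. \<chi> i. D i p h"] has_derivative_vec)
      (auto simp: scaleC_vec_def)
qed

lemma analytic_map_on_componentwise:
  fixes f :: "'a::{complex_vector,real_normed_vector} \<Rightarrow> complex ^ 'n::finite"
  assumes "\<And>i. (\<lambda>p. f p $ i) analytic_map_on S"
  shows "f analytic_map_on S"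
  using analytic_map_on_vec[of "\<lambda>p i. f p $ i", OF assms] by simp

lemma analytic_map_on_add [analytic_map_intros]:
  assumes "f analytic_map_on S" "g analytic_map_on S"
  shows "(\<lambda>p. f p + g p) analytic_map_on S"
  by (rule analytic_map_on_bounded_linear[where L="\<lambda>p. fst p + snd p" and f="\<lambda>p. (f p, g p)", simplified])
    (auto simp: scaleC_prod_def scaleC_add_right bounded_linear_add bounded_linear_fst bounded_linear_snd
          intro!: analytic_map_on_Pair assms)

lemma scaleC_minus_right: "c *\<^sub>C (- v) = - (c *\<^sub>C v)"
proof -
  have "c *\<^sub>C (- v) = (c * complex_of_real (-1)) *\<^sub>C v"
    unfolding scaleC_scaleC[symmetric] scaleR_scaleC[symmetric] by simp
  also have "\<dots> = complex_of_real (-1) *\<^sub>C (c *\<^sub>C v)"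
    by (simp add: scaleC_scaleC)
  finally show ?thesis by (simp add: scaleR_scaleC[symmetric] del: of_real_minus)
qed

lemma analytic_map_on_minus [analytic_map_intros]:
  assumes "f analytic_map_on S"
  shows "(\<lambda>p. - f p) analytic_map_on S"
  by (rule analytic_map_on_bounded_linear[where L="\<lambda>v. - v"])
    (auto simp: scaleC_minus_right bounded_linear_minus[OF bounded_linear_ident] assms)

lemma analytic_map_on_diff [analytic_map_intros]:
  assumes "f analytic_map_on S" "g analytic_map_on S"
  shows "(\<lambda>p. f p - g p) analytic_map_on S"
  using analytic_map_on_add[OF assms(1) analytic_map_on_minus[OF assms(2)]] by simp

lemma analytic_map_on_sum [analytic_map_intros]:
  "(\<And>i. i \<in> I \<Longrightarrow> f i analytic_map_on S) \<Longrightarrow> (\<lambda>p. \<Sum>i\<in>I. f i p) analytic_map_on S"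
  by (induction I rule: infinite_finite_induct) (auto intro: analytic_map_intros)

lemma analytic_map_on_mult [analytic_map_intros]:
  fixes f g :: "'a::{complex_vector,real_normed_vector} \<Rightarrow> complex"
  assumes "f analytic_map_on S" "g analytic_map_on S"
  shows "(\<lambda>p. f p * g p) analytic_map_on S"
proof -
  obtain F where F: "\<And>p. p \<in> S \<Longrightarrow> (f has_derivative F p) (at p)"
      "\<And>p c h. p \<in> S \<Longrightarrow> F p (c *\<^sub>C h) = c *\<^sub>C F p h"
    using assms(1) by (rule analytic_map_onE) (rule that; assumption)
  obtain G where G: "\<And>p. p \<in> S \<Longrightarrow> (g has_derivative G p) (at p)"
      "\<And>p c h. p \<in> S \<Longrightarrow> G p (c *\<^sub>C h) = c *\<^sub>C G p h"
    using assms(2) by (rule analytic_map_onE) (rule that; assumption)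
  show ?thesis
  proof (rule analytic_map_onI[where D="\<lambda>p h. f p * G p h + F p h * g p"])
    show "((\<lambda>p. f p * g p) has_derivative (\<lambda>h. f p * G p h + F p h * g p)) (at p)" if "p \<in> S" for p
      using that F(1) G(1) by (intro has_derivative_mult)
  qed (use F(2) G(2) in \<open>simp add: scaleC_complex_def algebra_simps\<close>)
qed

lemma analytic_map_on_prod [analytic_map_intros]:
  fixes f :: "_ \<Rightarrow> _ \<Rightarrow> complex"
  shows "(\<And>i. i \<in> I \<Longrightarrow> f i analytic_map_on S) \<Longrightarrow> (\<lambda>p. \<Prod>i\<in>I. f i p) analytic_map_on S"
  by (induction I rule: infinite_finite_induct) (auto intro: analytic_map_intros)

lemma analytic_map_on_power [analytic_map_intros]:
  fixes f :: "_ \<Rightarrow> complex"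
  shows "f analytic_map_on S \<Longrightarrow> (\<lambda>p. f p ^ n) analytic_map_on S"
  by (induction n) (auto intro: analytic_map_intros)

lemma holomorphic_imp_analytic_map_on:
  assumes "f holomorphic_on S" "open S"
  shows "f analytic_map_on S"
proof (rule analytic_map_onI[where D="\<lambda>p h. deriv f p * h"])
  show "(f has_derivative (\<lambda>h. deriv f p * h)) (at p)" if "p \<in> S" for p
    using holomorphic_derivI[OF assms that] by (simp add: has_field_derivative_def)
qed (auto simp: scaleC_complex_def)

lemma analytic_map_on_holomorphic_compose:
  assumes "g holomorphic_on T" "open T" "f analytic_map_on S" "f ` S \<subseteq> T"
  shows "(\<lambda>p. g (f p)) analytic_map_on S"
  using analytic_map_on_compose[OF holomorphic_imp_analytic_map_on] assms by blast

lemma analytic_map_on_sin [analytic_map_intros]: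
  "f analytic_map_on S \<Longrightarrow> (\<lambda>p. sin (f p) :: complex) analytic_map_on S"
  by (rule analytic_map_on_holomorphic_compose[where T=UNIV]) (auto intro: holomorphic_intros)

lemma analytic_map_on_cos [analytic_map_intros]:
  "f analytic_map_on S \<Longrightarrow> (\<lambda>p. cos (f p) :: complex) analytic_map_on S"
  by (rule analytic_map_on_holomorphic_compose[where T=UNIV]) (auto intro: holomorphic_intros)

lemma analytic_map_on_divide [analytic_map_intros]:
  fixes f g :: "_ \<Rightarrow> complex"
  assumes "f analytic_map_on S" "g analytic_map_on S" "\<And>p. p \<in> S \<Longrightarrow> g p \<noteq> 0"
  shows "(\<lambda>p. f p / g p) analytic_map_on S"
proof -
  have "(\<lambda>p. inverse (g p)) analytic_map_on S"
    using assms by (intro analytic_map_on_holomorphic_compose[where T="-{0}" and g=inverse and f=g])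
      (auto intro!: holomorphic_intros)
  from analytic_map_on_mult[OF assms(1) this] show ?thesis by (simp add: divide_inverse)
qed

lemma analytic_map_on_scaleC [analytic_map_intros]:
  fixes f :: "_ \<Rightarrow> complex ^ 'n::finite" and g :: "_ \<Rightarrow> complex"
  shows "g analytic_map_on S \<Longrightarrow> f analytic_map_on S \<Longrightarrow> (\<lambda>p. g p *\<^sub>C f p) analytic_map_on S"
  unfolding scaleC_vec_def scaleC_complex_def
  by (intro analytic_map_intros)

lemma norm_scaleC_vec: "norm (c *\<^sub>C v) = cmod c * norm (v :: complex ^ 'n::finite)"
proof -
  have "norm (c *\<^sub>C v) = L2_set (\<lambda>i. cmod c * cmod (v $ i)) UNIV"
    by (simp add: norm_vec_def scaleC_vec_def scaleC_complex_def norm_mult)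
  then show ?thesis by (simp add: L2_set_right_distrib norm_vec_def)
qed

lemma scaleC_zero_left [simp]: "0 *\<^sub>C v = 0"
  using scaleR_scaleC[of 0 v] by simp

lemma scaleC_zero_right [simp]: "c *\<^sub>C 0 = 0"
  using scaleC_add_right[of c 0 0] by simp

lemma scaleC_eq_Re_Im: "c *\<^sub>C v = Re c *\<^sub>R v + Im c *\<^sub>R (\<i> *\<^sub>C v)"
proof -
  have "c *\<^sub>C v = (complex_of_real (Re c) + complex_of_real (Im c) * \<i>) *\<^sub>C v"
    using complex_eq[of c] by (simp add: mult.commute)
  then show ?thesis by (simp add: scaleR_scaleC scaleC_scaleC scaleC_add_left)
qed

lemma bounded_linear_scaleC_left: "bounded_linear (\<lambda>t. t *\<^sub>C (h :: 'a::{complex_vector,real_normed_vector}))"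
  by (subst scaleC_eq_Re_Im)
    (intro bounded_linear_add bounded_linear_compose[OF bounded_linear_scaleR_left]
      bounded_linear_Re bounded_linear_Im)

lemmas has_derivative_scaleC_left = bounded_linear.has_derivative[OF bounded_linear_scaleC_left]

text \<open>
  On a complex line an analytic function of several variables is a holomorphic function of one.
\<close>
lemma analytic_map_on_line_deriv:
  fixes f :: "'a::{complex_vector,real_normed_vector} \<Rightarrow> complex"
  assumes "f analytic_map_on S" "p + t *\<^sub>C h \<in> S" "(f has_derivative D) (at (p + t *\<^sub>C h))"
  shows "((\<lambda>t. f (p + t *\<^sub>C h)) has_field_derivative D h) (at t)"
proof -
  have "((\<lambda>t. f (p + t *\<^sub>C h)) has_derivative (\<lambda>t. D (t *\<^sub>C h))) (at t)"
    using assms(3)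
    by (auto intro!: derivative_eq_intros has_derivative_scaleC_left has_derivative_compose[where g=f])
  moreover have "D (u *\<^sub>C h) = D h * u" for u
    using analytic_map_on_has_derivative_scaleC[OF assms] by (simp add: scaleC_complex_def)
  ultimately show ?thesis by (simp add: has_field_derivative_def)
qed

lemma analytic_map_on_imp_holomorphic:
  fixes f :: "complex \<Rightarrow> complex"
  assumes "f analytic_map_on S" "open S"
  shows "f holomorphic_on S"
proof -
  have "\<exists>f'. (f has_field_derivative f') (at x)" if x: "x \<in> S" for x
  proof -
    obtain D where D: "(f has_derivative D) (at x)"
      using assms(1) x unfolding analytic_map_on_def by blast
    have line: "0 + t *\<^sub>C 1 = t" for t :: complex
      by (simp add: scaleC_complex_def)
    show ?thesis
      using analytic_map_on_line_deriv[OF assms(1), of 0 x 1 D, unfolded line, OF x D] by blast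
  qed
  then show ?thesis using assms(2) by (simp add: holomorphic_on_open)
qed

lemma analytic_map_on_local:
  "(\<And>p. p \<in> S \<Longrightarrow> \<exists>U. p \<in> U \<and> f analytic_map_on U) \<Longrightarrow> f analytic_map_on S"
  unfolding analytic_map_on_def by blast

section \<open>Cauchy's formula with parameters\<close>

text \<open>
  The derivative in direction \<open>h\<close> is the derivative of a function on a complex line, so Cauchy's
  formula writes it as an integral of values of \<open>u\<close>, which depends continuously on all parameters.
\<close>
lemma continuous_on_directional_derivative:
  fixes u :: "'a::{complex_vector,real_normed_vector} \<Rightarrow> 't::metric_space \<Rightarrow> complex"
  assumes U: "open U" and cont: "continuous_on (U \<times> T) (\<lambda>(x, t). u x t)"
    and ana: "\<And>t. t \<in> T \<Longrightarrow> (\<lambda>x. u x t) analytic_map_on U"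
    and D: "\<And>x t. x \<in> U \<Longrightarrow> t \<in> T \<Longrightarrow> ((\<lambda>x. u x t) has_derivative D x t) (at x)"
  shows "continuous_on (U \<times> T) (\<lambda>(x, t). D x t h)"
proof -
  have "continuous (at (x0, t0) within U \<times> T) (\<lambda>(x, t). D x t h)" if x0: "x0 \<in> U" and t0: "t0 \<in> T" for x0 t0
  proof -
    have sc: "continuous_on UNIV (\<lambda>t. t *\<^sub>C h)"
      using bounded_linear_scaleC_left linear_continuous_on by blast
    have "open ((\<lambda>(x, w). x + w *\<^sub>C h) -` U)"
      by (rule open_vimage[OF U])
        (auto simp: case_prod_beta intro!: continuous_intros continuous_on_compose2[OF sc])
    moreover have "(x0, 0) \<in> (\<lambda>(x, w). x + w *\<^sub>C h) -` U" using x0 by simp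
    ultimately obtain A B where AB: "open A" "open B" "x0 \<in> A" "(0::complex) \<in> B"
      "A \<times> B \<subseteq> (\<lambda>(x, w). x + w *\<^sub>C h) -` U"
      by (rule open_prod_elim) auto
    obtain \<rho> where \<rho>: "\<rho> > 0" "cball 0 \<rho> \<subseteq> B" using AB open_contains_cball by blast
    define A' where "A' = A \<inter> U"
    have A': "open A'" "x0 \<in> A'" "A' \<subseteq> U" using AB U x0 by (auto simp: A'_def)
    have inU: "x + w *\<^sub>C h \<in> U" if "x \<in> A'" "norm w \<le> \<rho>" for x w
    proof -
      have "(x, w) \<in> A \<times> B" using \<rho>(2) that by (auto simp: A'_def)
      then show ?thesis using AB(5) by auto
    qed
    define I where "I = (\<lambda>x t. integral (cbox 0 1) (\<lambda>\<tau>. u (x + circlepath 0 \<rho> \<tau> *\<^sub>C h) t / (circlepath 0 \<rho> \<tau>)\<^sup>2 *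
        (2 * pi * \<i> * \<rho> * exp (2 * of_real pi * \<i> * of_real \<tau>))))"
    have eq: "D x t h = 1 / (2 * of_real pi * \<i>) * I x t" if x: "x \<in> A'" and t: "t \<in> T" for x t
    proof -
      have der: "((\<lambda>w. u (x + w *\<^sub>C h) t) has_field_derivative D (x + w *\<^sub>C h) t h) (at w)"
        if "norm w \<le> \<rho>" for w
        using inU[OF x that] t by (intro analytic_map_on_line_deriv[OF ana] D)
      have holo: "(\<lambda>w. u (x + w *\<^sub>C h) t) holomorphic_on ball 0 \<rho>"
        unfolding holomorphic_on_open[OF open_ball]
        by (intro ballI exI, rule der) (simp add: less_imp_le)
      have co: "continuous_on (cball 0 \<rho>) (\<lambda>w. u (x + w *\<^sub>C h) t)"
        using der by (intro continuous_at_imp_continuous_on ballI DERIV_isCont) auto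
      have "((\<lambda>w. u (x + w *\<^sub>C h) t) has_field_derivative 1 / (2 * of_real pi * \<i>) *
          contour_integral (circlepath 0 \<rho>) (\<lambda>w. u (x + w *\<^sub>C h) t / (w - 0)\<^sup>2)) (at 0)"
        using \<rho>(1) by (intro Cauchy_derivative_integral_circlepath(2)[OF co holo]) simp
      from DERIV_unique[OF this der[of 0]] \<rho>(1) show ?thesis
        by (simp add: I_def contour_integral_integral vector_derivative_circlepath)
    qed
    have contI: "continuous_on (A' \<times> T) (\<lambda>p. I (fst p) (snd p))"
    proof -
      have *: "continuous_on ((A' \<times> T) \<times> cbox 0 1) (\<lambda>q. u (fst (fst q) + circlepath 0 \<rho> (snd q) *\<^sub>C h) (snd (fst q)))"
      proof -
        let ?q = "\<lambda>q. (fst (fst q) + circlepath 0 \<rho> (snd q) *\<^sub>C h, snd (fst q))"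
        have 1: "continuous_on ((A' \<times> T) \<times> cbox 0 1) ?q"
          unfolding circlepath
          by (intro continuous_intros continuous_on_compose2[OF sc]) auto
        have 2: "?q ` ((A' \<times> T) \<times> cbox 0 1) \<subseteq> U \<times> T"
          using \<rho>(1) by (auto intro!: inU simp: circlepath norm_mult)
        from continuous_on_compose2[OF cont 1 2] show ?thesis by (simp add: case_prod_beta)
      qed
      have "continuous_on ((A' \<times> T) \<times> cbox 0 1) (\<lambda>(p, \<tau>). u (fst p + circlepath 0 \<rho> \<tau> *\<^sub>C h) (snd p) / (circlepath 0 \<rho> \<tau>)\<^sup>2 *
         (2 * pi * \<i> * \<rho> * exp (2 * of_real pi * \<i> * of_real \<tau>)))"
        unfolding case_prod_beta
        using \<rho>(1) by (intro continuous_intros *) (auto simp: circlepath intro!: continuous_intros)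
      from integral_continuous_on_param[OF this] show ?thesis
        by (simp add: I_def case_prod_beta)
    qed
    have "continuous_on (A' \<times> T) (\<lambda>(x, t). D x t h)"
      using continuous_on_mult_left[OF contI, of "1 / (2 * of_real pi * \<i>)"] eq
      by (subst continuous_on_cong[OF refl, where g="\<lambda>p. 1 / (2 * of_real pi * \<i>) * I (fst p) (snd p)"]) auto
    then have "continuous (at (x0, t0) within A' \<times> T) (\<lambda>(x, t). D x t h)"
      using A' t0 by (auto simp: continuous_on_eq_continuous_within)
    moreover have "at (x0, t0) within A' \<times> T = at (x0, t0) within U \<times> T"
      by (rule at_within_nhd[of _ "A' \<times> UNIV"]) (use A' in \<open>auto intro!: open_Times\<close>)
    ultimately show ?thesis by simp
  qed
  then show ?thesis by (auto simp: continuous_on_eq_continuous_within)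
qed

text \<open>
  Differentiation under the integral sign asks for a jointly continuous derivative. For analytic
  integrands this comes for free from the joint continuity of \<open>u\<close>.
\<close>
lemma analytic_map_on_integral:
  fixes u :: "'a::{complex_vector,euclidean_space} \<Rightarrow> real \<Rightarrow> complex"
  assumes U: "open U" and cont: "continuous_on (U \<times> cbox a b) (\<lambda>(x, t). u x t)"
    and ana: "\<And>t. t \<in> cbox a b \<Longrightarrow> (\<lambda>x. u x t) analytic_map_on U"
  shows "(\<lambda>x. integral (cbox a b) (u x)) analytic_map_on U"
proof -
  define D where "D = (\<lambda>x t. frechet_derivative (\<lambda>x. u x t) (at x))"
  have D: "((\<lambda>x. u x t) has_derivative D x t) (at x)" "D x t (c *\<^sub>C h) = c *\<^sub>C D x t h"
    if "x \<in> U" "t \<in> cbox a b" for x t c h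
    using analytic_map_on_frechet_derivative[OF ana] that unfolding D_def by blast+
  define B where "B = (\<lambda>x t. Blinfun (D x t))"
  have B: "blinfun_apply (B x t) = D x t" if "x \<in> U" "t \<in> cbox a b" for x t
    unfolding B_def using D(1)[OF that] by (intro bounded_linear_Blinfun_apply) (auto simp: has_derivative_def)
  have contB: "continuous_on (U \<times> cbox a b) (\<lambda>(x, t). B x t)"
  proof (rule continuous_on_blinfun_componentwise)
    fix i :: 'a
    have "continuous_on (U \<times> cbox a b) (\<lambda>(x, t). D x t i)"
      by (rule continuous_on_directional_derivative[OF U cont ana D(1)])
    then show "continuous_on (U \<times> cbox a b) (\<lambda>p. blinfun_apply (case p of (x, t) \<Rightarrow> B x t) i)"
      by (rule continuous_on_eq) (auto simp: B)
  qed
  have slice: "continuous_on (cbox a b) (\<lambda>t. v x t)"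
    if "x \<in> U" "continuous_on (U \<times> cbox a b) (\<lambda>(x, t). v x t)" for x and v :: "'a \<Rightarrow> real \<Rightarrow> 'c::real_normed_vector"
  proof -
    have "continuous_on (cbox a b) (\<lambda>t. (x, t))" by (intro continuous_intros)
    from continuous_on_compose2[OF that(2) this] that(1) show ?thesis by fastforce
  qed
  show ?thesis
  proof (rule analytic_map_onI[where D="\<lambda>x h. blinfun_apply (integral (cbox a b) (B x)) h"])
    fix x assume x: "x \<in> U"
    obtain e where e: "e > 0" "ball x e \<subseteq> U" using U x open_contains_ball by blast
    have "((\<lambda>x. integral (cbox a b) (u x)) has_derivative integral (cbox a b) (B x)) (at x within ball x e)"
    proof (rule leibniz_rule)
      show "((\<lambda>x. u x t) has_derivative blinfun_apply (B y t)) (at y within ball x e)"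
        if "y \<in> ball x e" "t \<in> cbox a b" for y t
      proof -
        have "y \<in> U" using that e(2) by blast
        then show ?thesis using D(1) that(2) by (simp add: B has_derivative_at_withinI)
      qed
      show "u y integrable_on cbox a b" if "y \<in> ball x e" for y
        using e(2) that by (intro integrable_continuous slice[OF _ cont]) auto
      show "continuous_on (ball x e \<times> cbox a b) (\<lambda>(x, t). B x t)"
        using e(2) by (intro continuous_on_subset[OF contB]) auto
    qed (use e in auto)
    then show "((\<lambda>x. integral (cbox a b) (u x)) has_derivative blinfun_apply (integral (cbox a b) (B x))) (at x)"
      using e(1) by (simp add: at_within_open[of x "ball x e"])
    have int: "B x integrable_on cbox a b"
      by (intro integrable_continuous slice[OF x] contB)
    have app: "blinfun_apply (integral (cbox a b) (B x)) h = integral (cbox a b) (\<lambda>t. D x t h)" for h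
    proof -
      have "blinfun_apply (integral (cbox a b) (B x)) h = integral (cbox a b) ((\<lambda>f. blinfun_apply f h) \<circ> B x)"
        by (rule integral_linear[OF int, symmetric]) (intro bounded_linear_intros bounded_linear_ident)
      also have "\<dots> = integral (cbox a b) (\<lambda>t. D x t h)"
        using B[OF x] by (intro integral_cong) auto
      finally show ?thesis .
    qed
    show "blinfun_apply (integral (cbox a b) (B x)) (c *\<^sub>C h) = c *\<^sub>C blinfun_apply (integral (cbox a b) (B x)) h" for c h
    proof -
      have "integral (cbox a b) (\<lambda>t. D x t (c *\<^sub>C h)) = integral (cbox a b) (\<lambda>t. c * D x t h)"
        using D(2)[OF x] by (intro integral_cong) (simp add: scaleC_complex_def)
      then show ?thesis unfolding app scaleC_complex_def by simp
    qed
  qed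
qed

section \<open>Division by a coordinate\<close>

text \<open>
  The quotient \<open>f (s, p) / s\<close> with its removable singularity filled in, for \<open>f\<close> vanishing on \<open>s = 0\<close>.
\<close>
definition first_quotient :: "(complex \<times> 'e \<Rightarrow> complex) \<Rightarrow> complex \<times> 'e \<Rightarrow> complex"
  where "first_quotient f = (\<lambda>(s, p). if s = 0 then deriv (\<lambda>s. f (s, p)) 0 else f (s, p) / s)"

text \<open>
  The removable singularity along \<open>s = 0\<close>: on each slice the quotient is holomorphic, hence equal to
  its Cauchy integral over a circle. There the quotient depends analytically on the parameter as
  the circle avoids \<open>s = 0\<close>.
\<close>
lemma analytic_map_on_first_quotient:
  fixes f :: "complex \<times> 'e::{complex_vector,euclidean_space} \<Rightarrow> complex"
  assumes f: "f analytic_map_on ball 0 \<delta> \<times> V" and V: "open V" and zero: "\<And>p. p \<in> V \<Longrightarrow> f (0, p) = 0"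
  shows "first_quotient f analytic_map_on ball 0 \<delta> \<times> V"
proof (rule analytic_map_on_local)
  fix x0 :: "complex \<times> 'e" assume x0: "x0 \<in> ball 0 \<delta> \<times> V"
  then have "norm (fst x0) < \<delta>" by auto
  then obtain \<rho> where \<rho>: "norm (fst x0) < \<rho>" "\<rho> < \<delta>" using dense by blast
  then have \<rho>0: "\<rho> > 0" using norm_ge_zero[of "fst x0"] by linarith
  define U where "U = ball (0::complex) \<rho> \<times> V"
  define \<gamma> where "\<gamma> = circlepath 0 \<rho>"
  have \<gamma>: "norm (\<gamma> t) = \<rho>" for t using \<rho>0 by (simp add: \<gamma>_def circlepath norm_mult)
  have eq: "integral (cbox 0 1) (\<lambda>t. f (\<gamma> t, snd x) / (\<gamma> t - fst x)) = first_quotient f x" if x: "x \<in> U" for x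
  proof -
    obtain s p where xsp: "x = (s, p)" by (cases x)
    have p: "p \<in> V" and s: "norm s < \<rho>" using x by (auto simp: xsp U_def)
    have "(\<lambda>s. f (s, p)) analytic_map_on ball 0 \<delta>"
      using p by (intro analytic_map_on_compose[OF f] analytic_map_intros) auto
    then have "(\<lambda>s. f (s, p)) holomorphic_on ball 0 \<delta>"
      by (rule analytic_map_on_imp_holomorphic) simp
    from pole_lemma_open[OF this, of 0]
    have holo: "(\<lambda>s. first_quotient f (s, p)) holomorphic_on ball 0 \<delta>"
      by (simp add: first_quotient_def zero[OF p] cong: if_cong)
    have "((\<lambda>w. first_quotient f (w, p) / (w - s)) has_contour_integral
        2 * of_real pi * \<i> * first_quotient f (s, p)) (circlepath 0 \<rho>)"
      using \<rho>(2) s by (intro Cauchy_integral_circlepath_simple holomorphic_on_subset[OF holo]) auto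
    from contour_integral_unique[OF this, symmetric]
    have "2 * of_real pi * \<i> * first_quotient f (s, p) =
        integral {0..1} (\<lambda>t. first_quotient f (\<gamma> t, p) / (\<gamma> t - s) * vector_derivative \<gamma> (at t))"
      unfolding \<gamma>_def by (rule trans) (rule contour_integral_integral)
    also have "\<dots> = integral {0..1} (\<lambda>t. (2 * of_real pi * \<i>) * (f (\<gamma> t, p) / (\<gamma> t - s)))"
    proof (rule integral_cong)
      fix t
      have "\<gamma> t \<noteq> 0" using \<gamma>[of t] \<rho>0 by auto
      moreover have "vector_derivative \<gamma> (at t) = 2 * of_real pi * \<i> * \<gamma> t"
        by (simp add: \<gamma>_def vector_derivative_circlepath) (simp add: circlepath)
      ultimately show "first_quotient f (\<gamma> t, p) / (\<gamma> t - s) * vector_derivative \<gamma> (at t) =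
          (2 * of_real pi * \<i>) * (f (\<gamma> t, p) / (\<gamma> t - s))"
        by (simp add: first_quotient_def)
    qed
    also have "\<dots> = (2 * of_real pi * \<i>) * integral {0..1} (\<lambda>t. f (\<gamma> t, p) / (\<gamma> t - s))"
      by (rule integral_mult_right)
    finally show ?thesis by (simp add: xsp)
  qed
  have cont\<gamma>: "continuous_on S \<gamma>" for S unfolding \<gamma>_def circlepath by (intro continuous_intros)
  have "(\<lambda>x. integral (cbox 0 1) (\<lambda>t. f (\<gamma> t, snd x) / (\<gamma> t - fst x))) analytic_map_on U"
  proof (rule analytic_map_on_integral)
    show "open U" using V by (auto simp: U_def intro: open_Times)
    have ne: "\<gamma> t - fst x \<noteq> 0" if "x \<in> U" for x t using \<gamma>[of t] that by (auto simp: U_def)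
    have in_dom: "(\<gamma> t, snd x) \<in> ball 0 \<delta> \<times> V" if "x \<in> U" for x t
      using \<gamma>[of t] \<rho> that by (auto simp: U_def)
    show "continuous_on (U \<times> cbox 0 1) (\<lambda>(x, t). f (\<gamma> t, snd x) / (\<gamma> t - fst x))"
      unfolding case_prod_beta
      by (intro continuous_intros continuous_on_compose2[OF analytic_map_on_continuous[OF f]]
          continuous_on_compose2[OF cont\<gamma>[of UNIV]])
        (use ne in_dom in auto)
    show "(\<lambda>x. f (\<gamma> t, snd x) / (\<gamma> t - fst x)) analytic_map_on U" for t
      using ne in_dom by (intro analytic_map_intros analytic_map_on_compose[OF f]) auto
  qed
  then have "first_quotient f analytic_map_on U"
    by (rule analytic_map_on_cong) (use eq V in \<open>auto simp: U_def intro: open_Times\<close>)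
  moreover have "x0 \<in> U" using x0 \<rho> by (auto simp: U_def)
  ultimately show "\<exists>U. x0 \<in> U \<and> first_quotient f analytic_map_on U" by blast
qed

lemma first_quotient_mult:
  "f (0, p) = 0 \<Longrightarrow> f (s, p) = s * first_quotient f (s, p)"
  by (simp add: first_quotient_def)

text \<open>
  The singular blow-up is harmless because of this lemma: a bound by \<open>norm s ^ k\<close> on every slice
  \<open>p = const\<close>, however non-uniform in \<open>p\<close>, already produces an analytic cofactor of \<open>s ^ k\<close>. One
  factor \<open>s\<close> is split off at a time, the bound forcing each successive quotient to vanish on \<open>s = 0\<close>.
\<close>
lemma analytic_map_on_divide_order:
  fixes f :: "complex \<times> 'e::{complex_vector,euclidean_space} \<Rightarrow> complex"
  assumes "f analytic_map_on ball 0 \<delta> \<times> V" "open V" "\<delta> > 0"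
    and "\<And>p. p \<in> V \<Longrightarrow> \<exists>C. \<forall>\<^sub>F s in at 0. norm (f (s, p)) \<le> C * norm s ^ k"
  shows "\<exists>h. h analytic_map_on ball 0 \<delta> \<times> V \<and> (\<forall>s\<in>ball 0 \<delta>. \<forall>p\<in>V. f (s, p) = s ^ k * h (s, p))"
  using assms(1,4)
proof (induction k arbitrary: f)
  case 0
  then show ?case by (intro exI[of _ f]) auto
next
  case (Suc k)
  have zero: "f (0, p) = 0" if p: "p \<in> V" for p
  proof -
    obtain C where C: "\<forall>\<^sub>F s in at 0. norm (f (s, p)) \<le> C * norm s ^ Suc k" using Suc.prems(2)[OF p] by blast
    have "((\<lambda>s::complex. C * norm s ^ Suc k) \<longlongrightarrow> C * norm (0::complex) ^ Suc k) (at 0)"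
      by (intro tendsto_intros)
    then have lim0: "((\<lambda>s. f (s, p)) \<longlongrightarrow> 0) (at 0)"
      by (intro Lim_null_comparison[OF C]) simp
    have "isCont f (0, p)"
      using \<open>\<delta> > 0\<close> p by (intro analytic_map_on_isCont[OF Suc.prems(1)]) simp
    then have "((\<lambda>s. f (s, p)) \<longlongrightarrow> f (0, p)) (at 0)"
      by (rule isCont_tendsto_compose) (intro tendsto_intros)
    from LIM_unique[OF this lim0] show ?thesis .
  qed
  have "\<exists>C. \<forall>\<^sub>F s in at 0. norm (first_quotient f (s, p)) \<le> C * norm s ^ k" if "p \<in> V" for p
  proof -
    obtain C where "\<forall>\<^sub>F s in at 0. norm (f (s, p)) \<le> C * norm s ^ Suc k" using Suc.prems(2)[OF \<open>p \<in> V\<close>] by blast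
    moreover have "\<forall>\<^sub>F s in at (0::complex). s \<noteq> 0" by (simp add: eventually_at_filter)
    ultimately have "\<forall>\<^sub>F s in at 0. norm (first_quotient f (s, p)) \<le> C * norm s ^ k"
      by eventually_elim (simp add: first_quotient_def norm_divide field_simps)
    then show ?thesis by blast
  qed
  with Suc.IH[OF analytic_map_on_first_quotient[OF Suc.prems(1) assms(2) zero]]
  obtain h where h: "h analytic_map_on ball 0 \<delta> \<times> V"
      "\<And>s p. s \<in> ball 0 \<delta> \<Longrightarrow> p \<in> V \<Longrightarrow> first_quotient f (s, p) = s ^ k * h (s, p)"
    by blast
  show ?case
    using h(2) first_quotient_mult[of f] zero by (intro exI[of _ h] conjI h(1)) (auto simp: mult.assoc)
qed

section \<open>Sums of power series are analytic\<close>

lemma analytic_map_on_uniform_limit: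
  fixes f :: "nat \<Rightarrow> complex ^ 'n::finite \<Rightarrow> complex"
  assumes U: "open U" and ana: "\<And>n. f n analytic_map_on U" and lim: "uniform_limit U f g sequentially"
  shows "g analytic_map_on U"
proof -
  define G where "G x h = deriv (\<lambda>w. g (x + w *\<^sub>C h)) 0" for x h
  define D where "D n x = frechet_derivative (f n) (at x)" for n x
  have D: "(f n has_derivative D n x) (at x)" "D n x (c *\<^sub>C h) = c *\<^sub>C D n x h" if "x \<in> U" for n x c h
    using analytic_map_on_frechet_derivative[OF ana that] by (simp_all add: D_def)
  have "\<exists>D. (g has_derivative D) (at x0) \<and> (\<forall>c h. D (c *\<^sub>C h) = c *\<^sub>C D h)" if x0: "x0 \<in> U" for x0
  proof -
    obtain e' where e': "e' > 0" "ball x0 e' \<subseteq> U" using U x0 open_contains_ball by blast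
    define e where "e = e' / 2"
    have e: "e > 0" "ball x0 (2 * e) \<subseteq> U" using e' by (auto simp: e_def)
    \<comment> \<open>Cauchy's estimate on complex lines turns uniform convergence into convergence of derivatives.\<close>
    have est: "norm (D n x h - G x h) \<le> 2 * \<epsilon> / e * norm h"
      if x: "x \<in> ball x0 e" and close: "\<And>y. y \<in> U \<Longrightarrow> norm (f n y - g y) \<le> \<epsilon>" for n x h \<epsilon>
    proof (cases "h = 0")
      case True
      have xU: "x \<in> U" using x e by auto
      have "D n x 0 = 0"
        using D(1)[of x n] xU linear_0[OF bounded_linear.linear[OF has_derivative_bounded_linear]] by blast
      with True show ?thesis by (simp add: G_def)
    next
      case False
      define \<rho> where "\<rho> = e / (2 * norm h)"
      have \<rho>: "\<rho> > 0" "\<rho> * norm h < e" using False e by (auto simp: \<rho>_def)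
      have inU: "x + w *\<^sub>C h \<in> U" if "norm w \<le> \<rho>" for w
      proof -
        have "norm (w *\<^sub>C h) < e"
          using mult_right_mono[OF that, of "norm h"] \<rho>(2) by (simp add: norm_scaleC_vec)
        then have "dist x0 (x + w *\<^sub>C h) < 2 * e"
          using x dist_triangle[of x0 "x + w *\<^sub>C h" x] by (simp add: dist_norm)
        then show ?thesis using e(2) by auto
      qed
      have der: "((\<lambda>w. f m (x + w *\<^sub>C h)) has_field_derivative D m (x + w *\<^sub>C h) h) (at w)"
        if "norm w \<le> \<rho>" for w m
        using inU[OF that] by (intro analytic_map_on_line_deriv[OF ana] D)
      have holo: "(\<lambda>w. f m (x + w *\<^sub>C h)) holomorphic_on ball 0 \<rho>" for m
        unfolding holomorphic_on_open[OF open_ball]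
        by (intro ballI exI, rule der) (simp add: less_imp_le)
      have co: "continuous_on (cball 0 \<rho>) (\<lambda>w. f m (x + w *\<^sub>C h))" for m
        using der by (intro continuous_at_imp_continuous_on ballI DERIV_isCont) auto
      have "uniform_limit (cball 0 \<rho>) (\<lambda>m w. f m (x + w *\<^sub>C h)) (\<lambda>w. g (x + w *\<^sub>C h)) sequentially"
      proof (rule uniform_limitI)
        fix \<eta> :: real assume "\<eta> > 0"
        from uniform_limitD[OF lim this]
        show "\<forall>\<^sub>F m in sequentially. \<forall>w\<in>cball 0 \<rho>. dist (f m (x + w *\<^sub>C h)) (g (x + w *\<^sub>C h)) < \<eta>"
          by eventually_elim (use inU in auto)
      qed
      then have gco: "continuous_on (cball 0 \<rho>) (\<lambda>w. g (x + w *\<^sub>C h))"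
        and gholo: "(\<lambda>w. g (x + w *\<^sub>C h)) holomorphic_on ball 0 \<rho>"
        using holomorphic_uniform_limit[of 0 \<rho> "\<lambda>m w. f m (x + w *\<^sub>C h)" sequentially] co holo
        by (metis (no_types, lifting) eventually_sequentiallyI sequentially_bot)+
      have gder: "((\<lambda>w. g (x + w *\<^sub>C h)) has_field_derivative G x h) (at 0)"
        unfolding G_def using holomorphic_derivI[OF gholo open_ball] \<rho>(1) by simp
      have "norm ((deriv ^^ 1) (\<lambda>w. f n (x + w *\<^sub>C h) - g (x + w *\<^sub>C h)) 0) \<le> fact 1 * \<epsilon> / \<rho> ^ 1"
      proof (rule Cauchy_inequality[OF _ _ \<rho>(1)])
        fix w :: complex assume "norm (0 - w) = \<rho>"
        then show "norm (f n (x + w *\<^sub>C h) - g (x + w *\<^sub>C h)) \<le> \<epsilon>" by (intro close inU) simp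
      qed (intro holomorphic_intros continuous_intros holo gholo co gco)+
      moreover have "deriv (\<lambda>w. f n (x + w *\<^sub>C h) - g (x + w *\<^sub>C h)) 0 = D n x h - G x h"
        using DERIV_diff[OF der[of 0 n] gder] \<rho>(1) by (auto intro: DERIV_imp_deriv)
      ultimately show ?thesis by (simp add: \<rho>_def ac_simps)
    qed
    have "\<exists>g'. \<forall>x\<in>ball x0 e. (\<lambda>n. f n x) \<longlonglongrightarrow> g' x \<and> (g' has_derivative G x) (at x within ball x0 e)"
    proof (rule has_derivative_sequence[OF convex_ball])
      show "(f n has_derivative D n x) (at x within ball x0 e)" if "x \<in> ball x0 e" for n x
        using that e by (intro has_derivative_at_withinI[OF D(1)]) auto
      show "(\<lambda>n. f n x0) \<longlonglongrightarrow> g x0" using tendsto_uniform_limitI[OF lim x0] .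
      show "\<forall>\<^sub>F n in sequentially. \<forall>x\<in>ball x0 e. \<forall>h. norm (D n x h - G x h) \<le> \<epsilon> * norm h" if "\<epsilon> > 0" for \<epsilon>
      proof -
        from that e have "\<epsilon> * e / 2 > 0" by simp
        from uniform_limitD[OF lim this] show ?thesis
        proof eventually_elim
          case (elim n)
          show ?case
          proof (intro ballI allI)
            fix x h assume "x \<in> ball x0 e"
            from est[OF this, of n "\<epsilon> * e / 2" h] elim e
            show "norm (D n x h - G x h) \<le> \<epsilon> * norm h"
              by (simp add: dist_norm less_imp_le)
          qed
        qed
      qed
    qed (use e in simp)
    then obtain g' where g': "\<And>x. x \<in> ball x0 e \<Longrightarrow> (\<lambda>n. f n x) \<longlonglongrightarrow> g' x"
        "\<And>x. x \<in> ball x0 e \<Longrightarrow> (g' has_derivative G x) (at x within ball x0 e)" by blast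
    have "g' x = g x" if x: "x \<in> ball x0 e" for x
    proof -
      have "x \<in> U" using x e by auto
      from tendsto_uniform_limitI[OF lim this] g'(1)[OF x] show ?thesis by (rule LIMSEQ_unique[symmetric])
    qed
    moreover have "(g' has_derivative G x0) (at x0)"
      using g'(2)[of x0] e by (simp add: at_within_open[of x0 "ball x0 e"])
    ultimately have g: "(g has_derivative G x0) (at x0)"
      using e by (auto intro: has_derivative_transform_within_open[of g' _ x0 UNIV "ball x0 e"])
    have limD: "(\<lambda>n. D n x0 h) \<longlonglongrightarrow> G x0 h" for h
    proof (rule tendstoI)
      fix \<eta> :: real assume \<eta>: "\<eta> > 0"
      define \<epsilon> where "\<epsilon> = \<eta> * e / (2 * (norm h + 1))"
      have "\<epsilon> > 0" using \<eta> e by (simp add: \<epsilon>_def add_nonneg_pos)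
      from uniform_limitD[OF lim this] show "\<forall>\<^sub>F n in sequentially. dist (D n x0 h) (G x0 h) < \<eta>"
      proof eventually_elim
        case (elim n)
        have "norm (D n x0 h - G x0 h) \<le> 2 * \<epsilon> / e * norm h"
          using e elim by (intro est) (auto simp: dist_norm less_imp_le)
        also have "\<dots> = \<eta> * (norm h / (norm h + 1))"
        proof -
          have "norm h + 1 \<noteq> 0" using norm_ge_zero[of h] by linarith
          with e show ?thesis unfolding \<epsilon>_def by (simp add: divide_simps)
        qed
        also have "\<dots> < \<eta> * 1" using \<eta> by (intro mult_strict_left_mono) (auto simp: add_nonneg_pos)
        finally show ?case by (simp add: dist_norm)
      qed
    qed
    have "G x0 (c *\<^sub>C h) = c *\<^sub>C G x0 h" for c h
    proof -
      have "(\<lambda>n. c * D n x0 h) \<longlonglongrightarrow> c * G x0 h" by (intro tendsto_intros limD)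
      moreover have "(\<lambda>n. c * D n x0 h) \<longlonglongrightarrow> G x0 (c *\<^sub>C h)"
        using limD[of "c *\<^sub>C h"] D(2)[OF x0] by (simp add: scaleC_complex_def)
      ultimately show ?thesis using LIMSEQ_unique by (simp add: scaleC_complex_def)
    qed
    with g show ?thesis by blast
  qed
  then show ?thesis by (simp add: analytic_map_on_def)
qed

text \<open>
  On the polydisc of radius \<open>t\<close> every term of the power series is dominated by its value at the
  point \<open>(t, ..., t)\<close>, where the series converges absolutely. After an enumeration of the
  multi-indices the Weierstrass test makes the partial sums converge uniformly.
\<close>
lemma real_analytic_near_0_imp_analytic_map_on:
  fixes F :: "complex ^ 'n::finite \<Rightarrow> complex"
  assumes "real_analytic_near_0 F"
  obtains r where "r > 0" "F analytic_map_on ball 0 r"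
proof -
  obtain r c where r: "r > 0" and F: "\<And>v. norm v < r \<Longrightarrow>
      ((\<lambda>\<alpha>. complex_of_real (c \<alpha>) * (\<Prod>i\<in>UNIV. (v $ i) ^ \<alpha> i)) has_sum F v) UNIV"
    using assms unfolding real_analytic_near_0_def by blast
  define mon where "mon \<alpha> v = complex_of_real (c \<alpha>) * (\<Prod>i\<in>UNIV. (v $ i) ^ \<alpha> i)" for \<alpha> and v :: "complex ^ 'n"
  have F': "((\<lambda>\<alpha>. mon \<alpha> v) has_sum F v) UNIV" if "norm v < r" for v
    using F[OF that] by (simp only: mon_def)
  define a where "a n v = (if n \<in> range (to_nat :: ('n \<Rightarrow> nat) \<Rightarrow> nat) then mon (from_nat n) v else 0)" for n v
  have reindex: "((\<lambda>\<alpha>. mon \<alpha> v) has_sum S) UNIV \<longleftrightarrow> ((\<lambda>n. a n v) has_sum S) UNIV" for v S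
  proof -
    have "((\<lambda>\<alpha>. mon \<alpha> v) has_sum S) UNIV \<longleftrightarrow> ((\<lambda>n. a n v) \<circ> (to_nat :: ('n \<Rightarrow> nat) \<Rightarrow> nat) has_sum S) UNIV"
      by (intro has_sum_cong) (simp add: a_def)
    also have "\<dots> \<longleftrightarrow> ((\<lambda>n. a n v) has_sum S) (range (to_nat :: ('n \<Rightarrow> nat) \<Rightarrow> nat))"
      by (rule has_sum_reindex[symmetric]) simp
    also have "\<dots> \<longleftrightarrow> ((\<lambda>n. a n v) has_sum S) UNIV"
      by (rule has_sum_cong_neutral) (auto simp: a_def)
    finally show ?thesis .
  qed
  have sums: "(\<lambda>n. a n v) sums F v" if "norm v < r" for v
    using F'[OF that] reindex[of v "F v"] by (auto intro: has_sum_imp_sums)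
  define t where "t = r / (2 * CARD('n))"
  have t: "t > 0" using r by (simp add: t_def)
  define v0 :: "complex ^ 'n" where "v0 = (\<chi> i. of_real t)"
  have "norm v0 \<le> (\<Sum>i\<in>UNIV. norm (v0 $ i))" 
    unfolding norm_vec_def by (rule L2_set_le_sum) simp
  also have "\<dots> = CARD('n) * t" using t by (simp add: v0_def)
  also have "\<dots> = r / 2" by (simp add: t_def)
  finally have "norm v0 < r" using r by linarith
  then have "(\<lambda>n. a n v0) summable_on UNIV"
    using F'[of v0] reindex[of v0 "F v0"] by (auto simp: summable_on_def)
  then have summ: "summable (\<lambda>n. norm (a n v0))"
    by (simp add: summable_on_iff_abs_summable_on_complex summable_on_imp_summable)
  have comp: "norm (v $ i) \<le> t" if "v \<in> ball 0 t" for v :: "complex ^ 'n" and i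
    using Finite_Cartesian_Product.norm_nth_le[of v i] that by simp
  have bound: "norm (a n v) \<le> norm (a n v0)" if "v \<in> ball 0 t" for n v
    using comp[OF that] t
    by (auto simp: a_def mon_def v0_def norm_mult prod_norm[symmetric] norm_power intro!: mult_left_mono prod_mono power_mono)
  have ulim: "uniform_limit (ball 0 t) (\<lambda>n v. \<Sum>i<n. a i v) (\<lambda>v. \<Sum>i. a i v) sequentially"
    by (rule Weierstrass_m_test[OF bound summ])
  have partial: "(\<lambda>v. \<Sum>i<n. a i v) analytic_map_on ball 0 t" for n
  proof -
    have "(\<lambda>v. mon \<alpha> v) analytic_map_on ball 0 t" for \<alpha>
      unfolding mon_def by (intro analytic_map_intros)
    then have "(\<lambda>v. a i v) analytic_map_on ball 0 t" for i
      unfolding a_def by (cases "i \<in> range (to_nat :: ('n \<Rightarrow> nat) \<Rightarrow> nat)")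
        (simp_all add: analytic_map_on_const)
    then show ?thesis by (intro analytic_map_intros)
  qed
  have "(\<lambda>v. \<Sum>i. a i v) analytic_map_on ball 0 t"
    by (rule analytic_map_on_uniform_limit[OF open_ball partial ulim])
  then have "(\<lambda>v. \<Sum>i. a i v) analytic_map_on ball 0 (min r t)"
    by (rule analytic_map_on_subset) auto
  then have "F analytic_map_on ball 0 (min r t)"
    by (rule analytic_map_on_cong) (use sums in \<open>auto simp: sums_iff\<close>)
  then show ?thesis using r t by (intro that[of "min r t"]) auto
qed

section \<open>Local inversion\<close>

lemma analytic_map_on_imp_C1:
  fixes f :: "'a::{complex_vector,euclidean_space} \<Rightarrow> complex ^ 'm::finite"
  assumes "open U" "f analytic_map_on U"
  shows "continuous_on U (\<lambda>x. frechet_derivative f (at x) h)"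
proof -
  have "continuous_on U (\<lambda>x. \<chi> j. frechet_derivative f (at x) h $ j)"
  proof (rule continuous_on_vec_lambda)
    fix j
    have ana: "(\<lambda>x. f x $ j) analytic_map_on U" by (intro analytic_map_intros assms)
    have "continuous_on (U \<times> {0::real}) (\<lambda>(x, t). frechet_derivative f (at x) h $ j)"
    proof (rule continuous_on_directional_derivative[OF assms(1), where u="\<lambda>x t. f x $ j" and D="\<lambda>x t h. frechet_derivative f (at x) h $ j"])
      show "continuous_on (U \<times> {0::real}) (\<lambda>(x, t). f x $ j)"
        unfolding case_prod_beta
        by (intro continuous_on_compose2[OF analytic_map_on_continuous[OF ana] continuous_on_fst]) auto
      show "((\<lambda>x. f x $ j) has_derivative (\<lambda>h. frechet_derivative f (at x) h $ j)) (at x)" if "x \<in> U" for x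
        by (rule bounded_linear.has_derivative[OF bounded_linear_vec_nth])
          (rule analytic_map_on_frechet_derivative(1)[OF assms(2) that])
    qed (rule ana)
    moreover have "continuous_on U (\<lambda>x. (x, 0::real))" by (intro continuous_intros)
    ultimately have "continuous_on U (\<lambda>x. case (x, 0::real) of (x, t) \<Rightarrow> frechet_derivative f (at x) h $ j)"
      by (rule continuous_on_compose2) auto
    then show "continuous_on U (\<lambda>x. frechet_derivative f (at x) h $ j)" by simp
  qed
  then show ?thesis by simp
qed

lemma inv_scaleC_commute:
  assumes "bij k" "\<And>c h. k (c *\<^sub>C h) = c *\<^sub>C k h"
  shows "inv k (c *\<^sub>C v) = c *\<^sub>C inv k v"
proof -
  have "k (c *\<^sub>C inv k v) = c *\<^sub>C v"
    using assms by (simp add: bij_is_surj surj_f_inv_f)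
  then show ?thesis using assms(1) by (metis bij_inv_eq_iff)
qed

text \<open>
  The inverse function theorem concerns maps of a space to itself, while source and target are
  different types here. It is applied to \<open>f\<close> followed by the inverse of its derivative at \<open>p\<close>. The
  local inverse is analytic as its derivatives are inverses of complex linear maps.
\<close>
lemma local_biholomorphism_at_inj_derivative:
  fixes f :: "'a::{complex_vector,euclidean_space} \<Rightarrow> complex ^ 'm::finite"
  assumes U: "open U" "p \<in> U" and f: "f analytic_map_on U"
    and D: "(f has_derivative D) (at p)" and inj: "inj D" and dim: "DIM('a) = DIM(complex ^ 'm)"
  shows "local_biholomorphism_at f p"
proof -
  have linD: "linear D" using D has_derivative_linear by blast
  have surj: "surj D"
  proof -
    have "dim (range D) = DIM(complex ^ 'm)"
      using dim_image_eq[OF linD, of UNIV] inj dim by (simp add: span_UNIV)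
    then have "span (range D) = UNIV" by (rule iffD1[OF dim_eq_full])
    then show ?thesis using linear_subspace_image[OF linD subspace_UNIV] span_eq_iff by metis
  qed
  have bijD: "bij D" using inj surj by (simp add: bij_def)
  define L where "L = inv D"
  have LD: "L (D h) = h" and DL: "D (L v) = v" for h v
    using inj surj by (simp_all add: L_def surj_f_inv_f)
  have linL: "linear L"
    using linear_injective_left_inverse[OF linD inj] DL LD
    by (metis (no_types, lifting) LD comp_apply ext id_apply surj surjD)
  have bL: "bounded_linear L" and bD: "bounded_linear D"
    using linL linD by (simp_all add: linear_conv_bounded_linear)
  have LC: "L (c *\<^sub>C v) = c *\<^sub>C L v" for c v
    unfolding L_def by (rule inv_scaleC_commute[OF bijD]) (rule analytic_map_on_has_derivative_scaleC[OF f U(2) D])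
  define E where "E x = frechet_derivative f (at x)" for x
  have E: "(f has_derivative E x) (at x)" "E x (c *\<^sub>C h) = c *\<^sub>C E x h" if "x \<in> U" for x c h
    using analytic_map_on_frechet_derivative[OF f that] by (simp_all add: E_def)
  have Ep: "E p = D" using E(1)[OF U(2)] D has_derivative_unique by blast
  define \<phi> where "\<phi> x = L (f x)" for x
  define \<phi>' where "\<phi>' x = Blinfun (\<lambda>h. L (E x h))" for x
  have der: "(\<phi> has_derivative (\<lambda>h. L (E x h))) (at x)" if "x \<in> U" for x
    unfolding \<phi>_def by (intro bounded_linear.has_derivative[OF bL] E that)
  have \<phi>': "blinfun_apply (\<phi>' x) = (\<lambda>h. L (E x h))" if "x \<in> U" for x
    unfolding \<phi>'_def using der[OF that] by (intro bounded_linear_Blinfun_apply) (auto simp: has_derivative_def)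
  have "continuous_on U \<phi>'"
  proof (rule continuous_on_blinfun_componentwise)
    fix i :: 'a
    have "continuous_on U (\<lambda>x. L (E x i))"
      unfolding E_def
      by (intro continuous_on_compose2[OF linear_continuous_on[OF bL, of UNIV] analytic_map_on_imp_C1] U f) auto
    then show "continuous_on U (\<lambda>x. blinfun_apply (\<phi>' x) i)"
      by (rule continuous_on_eq) (simp add: \<phi>')
  qed
  moreover have "(\<phi> has_derivative blinfun_apply (\<phi>' x)) (at x)" if "x \<in> U" for x
    using der[OF that] \<phi>'[OF that] by simp
  moreover have "id_blinfun o\<^sub>L \<phi>' p = id_blinfun"
    by (rule blinfun_eqI) (simp add: \<phi>'[OF U(2)] Ep LD)
  ultimately obtain U' V g g' where g: "open U'" "U' \<subseteq> U" "p \<in> U'" "open V" "homeomorphism U' V \<phi> g"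
      "\<And>y. y \<in> V \<Longrightarrow> (g has_derivative g' y) (at y)"
      "\<And>y. y \<in> V \<Longrightarrow> g' y = inv (blinfun_apply (\<phi>' (g y)))"
      "\<And>y. y \<in> V \<Longrightarrow> bij (blinfun_apply (\<phi>' (g y)))"
    using inverse_function_theorem[OF U(1) _ _ U(2), of \<phi> \<phi>' id_blinfun] by metis
  have gU: "g y \<in> U'" "\<phi> (g y) = y" if "y \<in> V" for y
    using g(5) that by (auto simp: homeomorphism_def)
  have \<phi>V: "\<phi> x \<in> V" "g (\<phi> x) = x" if "x \<in> U'" for x
    using g(5) that by (auto simp: homeomorphism_def)
  have f_eq: "f x = D (\<phi> x)" for x by (simp add: \<phi>_def DL)
  have image: "f ` U' = L -` V"
  proof (intro equalityI subsetI)
    show "v \<in> L -` V" if "v \<in> f ` U'" for v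
      using that \<phi>V(1) by (auto simp: f_eq LD)
    show "v \<in> f ` U'" if "v \<in> L -` V" for v
      using that gU[of "L v"] by (auto simp: f_eq DL intro!: image_eqI[of _ _ "g (L v)"])
  qed
  have op: "open (f ` U')"
    unfolding image by (intro open_vimage g linear_continuous_on bL)
  have injf: "inj_on f U'"
    using \<phi>V(2) by (intro inj_on_inverseI[where g="\<lambda>v. g (L v)"]) (simp add: f_eq LD)
  have inv_eq: "g (L v) = inv_into U' f v" if "v \<in> f ` U'" for v
  proof -
    have "L v \<in> V" using that by (simp add: image)
    from gU[OF this] injf show ?thesis by (intro inv_into_f_eq[symmetric]) (auto simp: f_eq DL)
  qed
  have "(\<lambda>v. g (L v)) analytic_map_on f ` U'"
  proof (rule analytic_map_onI[where D="\<lambda>v h. g' (L v) (L h)"])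
    fix v assume "v \<in> f ` U'"
    then have v: "L v \<in> V" by (simp add: image)
    show "((\<lambda>v. g (L v)) has_derivative (\<lambda>h. g' (L v) (L h))) (at v)"
      by (rule has_derivative_compose[OF bounded_linear_imp_has_derivative[OF bL] g(6)[OF v]])
    have "g (L v) \<in> U" using gU(1)[OF v] g(2) by blast
    then have "blinfun_apply (\<phi>' (g (L v))) (c *\<^sub>C h) = c *\<^sub>C blinfun_apply (\<phi>' (g (L v))) h" for c h
      by (simp add: \<phi>' E(2) LC)
    from inv_scaleC_commute[OF g(8)[OF v] this]
    show "g' (L v) (L (c *\<^sub>C h)) = c *\<^sub>C g' (L v) (L h)" for c h
      by (simp add: g(7)[OF v] LC)
  qed
  then have "inv_into U' f analytic_map_on f ` U'"
    by (rule analytic_map_on_cong[OF _ op inv_eq])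
  then show ?thesis
    unfolding local_biholomorphism_at_def
    using g(1,3) op injf analytic_map_on_subset[OF f g(2)] by blast
qed

lemma pullback_field_eqI:
  assumes "(\<Psi> has_derivative D) (at p)" "inj D" "D v = X (\<Psi> p)"
  shows "pullback_field \<Psi> X p = v"
  using frechet_derivative_at[OF assms(1)] assms(2,3)
  by (metis inv_f_f pullback_field_def)

section \<open>Averaging of periodic functions\<close>

definition strip :: "real \<Rightarrow> complex set"
  where "strip \<zeta> = {\<theta>. \<bar>Im \<theta>\<bar> < \<zeta>}"

lemma strip_eq: "strip \<zeta> = {z. Im z < \<zeta>} \<inter> {z. Im z > - \<zeta>}"
  by (auto simp: strip_def)

lemma open_strip: "open (strip \<zeta>)"
  unfolding strip_eq by (intro open_Int open_halfspace_Im_lt open_halfspace_Im_gt)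

lemma convex_strip: "convex (strip \<zeta>)"
  unfolding strip_eq by (intro convex_Int convex_halfspace_Im_lt convex_halfspace_Im_gt)

text \<open>
  A primitive of a periodic function changes by a constant over one period. Subtracting the linear
  function with the same increments, whose slope is the mean value, makes the primitive periodic.
\<close>
lemma periodic_primitive_minus_mean:
  assumes f: "f holomorphic_on strip \<zeta>"
    and per: "\<And>\<theta>. \<theta> \<in> strip \<zeta> \<Longrightarrow> f (\<theta> + 2 * of_real pi) = f \<theta>"
  obtains c K where "K holomorphic_on strip \<zeta>"
    and "\<And>\<theta>. \<theta> \<in> strip \<zeta> \<Longrightarrow> K (\<theta> + 2 * of_real pi) = K \<theta>"
    and "\<And>\<theta>. \<theta> \<in> strip \<zeta> \<Longrightarrow> (K has_field_derivative f \<theta> - c) (at \<theta>)"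
proof -
  have shift: "\<theta> + 2 * of_real pi \<in> strip \<zeta>" if "\<theta> \<in> strip \<zeta>" for \<theta>
    using that by (simp add: strip_def)
  obtain P where "\<And>\<theta>. \<theta> \<in> strip \<zeta> \<Longrightarrow> (P has_field_derivative f \<theta>) (at \<theta> within strip \<zeta>)"
    using holomorphic_convex_primitive'[OF convex_strip open_strip f] by blast
  then have P: "(P has_field_derivative f \<theta>) (at \<theta>)" if "\<theta> \<in> strip \<zeta>" for \<theta>
    using that by (simp add: at_within_open[OF _ open_strip])
  have "\<exists>d. \<forall>\<theta>\<in>strip \<zeta>. P (\<theta> + 2 * of_real pi) - P \<theta> = d"
  proof (rule has_field_derivative_zero_constant[OF convex_strip])
    fix \<theta> assume th: "\<theta> \<in> strip \<zeta>"
    have "((\<lambda>\<theta>. P (\<theta> + 2 * of_real pi)) has_field_derivative f (\<theta> + 2 * of_real pi)) (at \<theta>)"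
      using P[OF shift[OF th]] by (simp add: DERIV_shift)
    then have "((\<lambda>\<theta>. P (\<theta> + 2 * of_real pi) - P \<theta>) has_field_derivative f (\<theta> + 2 * of_real pi) - f \<theta>) (at \<theta>)"
      by (intro DERIV_diff P th)
    then show "((\<lambda>\<theta>. P (\<theta> + 2 * of_real pi) - P \<theta>) has_field_derivative 0) (at \<theta> within strip \<zeta>)"
      using per[OF th] by (simp add: has_field_derivative_at_within)
  qed
  then obtain d where d: "\<And>\<theta>. \<theta> \<in> strip \<zeta> \<Longrightarrow> P (\<theta> + 2 * of_real pi) - P \<theta> = d" by blast
  define c where "c = d / (2 * of_real pi)"
  have der: "((\<lambda>\<theta>. P \<theta> - c * \<theta>) has_field_derivative f \<theta> - c) (at \<theta>)" if "\<theta> \<in> strip \<zeta>" for \<theta>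
    by (rule derivative_eq_intros P that refl | simp)+
  show ?thesis
  proof (rule that[of "\<lambda>\<theta>. P \<theta> - c * \<theta>" c])
    show "(\<lambda>\<theta>. P \<theta> - c * \<theta>) holomorphic_on strip \<zeta>"
      unfolding holomorphic_on_open[OF open_strip] using der by blast
    show "P (\<theta> + 2 * of_real pi) - c * (\<theta> + 2 * of_real pi) = P \<theta> - c * \<theta>" if "\<theta> \<in> strip \<zeta>" for \<theta>
      using d[OF that] by (simp add: c_def field_simps)
  qed (rule der)
qed

section \<open>Scaling of functions vanishing to finite order\<close>

text \<open>
  How the higher order terms of the two systems enter the blown-up coordinates: the phase space
  variable is \<open>s\<close> times a bounded vector \<open>w\<close>, and \<open>F\<close> contributes \<open>s ^ k\<close> times an analytic function
  of both. The bound on that function holds because it is analytic on a slightly larger domain.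
\<close>
lemma analytic_scaling_quotient:
  fixes F :: "complex ^ 'm::finite \<Rightarrow> complex"
  assumes "real_analytic_near_0 F" "vanishes_to_order k F" "R > 0"
  obtains \<delta> \<Phi> M where "\<delta> > 0" "\<Phi> analytic_map_on ball 0 \<delta> \<times> ball 0 R"
    and "\<And>s w. s \<in> ball 0 \<delta> \<Longrightarrow> w \<in> ball 0 R \<Longrightarrow> F (s *\<^sub>C w) = s ^ k * \<Phi> (s, w)"
    and "\<And>s w. s \<in> ball 0 \<delta> \<Longrightarrow> w \<in> ball 0 R \<Longrightarrow> norm (\<Phi> (s, w)) \<le> M"
proof -
  obtain r where r: "r > 0" "F analytic_map_on ball 0 r"
    using real_analytic_near_0_imp_analytic_map_on[OF assms(1)] by blast
  define R' where "R' = R + 1"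
  have R': "R' > 0" using assms(3) by (simp add: R'_def)
  define \<delta> where "\<delta> = r / R'"
  have \<delta>: "\<delta> > 0" using r R' by (simp add: \<delta>_def)
  have in_ball: "s *\<^sub>C w \<in> ball 0 r" if "s \<in> ball 0 \<delta>" "w \<in> ball 0 R'" for s and w :: "complex ^ 'm"
  proof -
    have "norm s * norm w < \<delta> * R'"
      using that \<delta> R' by (intro mult_strict_mono) auto
    then show ?thesis using R' by (simp add: norm_scaleC_vec \<delta>_def)
  qed
  have ana: "(\<lambda>p. F (fst p *\<^sub>C snd p)) analytic_map_on ball 0 \<delta> \<times> ball 0 R'"
    using in_ball by (intro analytic_map_on_compose[OF r(2)] analytic_map_intros) auto
  have order: "\<exists>C. \<forall>\<^sub>F s in at 0. norm (F (fst (s, w) *\<^sub>C snd (s, w))) \<le> C * norm s ^ k" for w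
  proof -
    from assms(2)[unfolded vanishes_to_order_def] obtain C where C: "\<forall>\<^sub>F v in nhds 0. norm (F v) \<le> C * norm v ^ k"
      by (auto elim!: landau_o.bigE)
    have "((\<lambda>s. s *\<^sub>C w) \<longlongrightarrow> 0 *\<^sub>C w) (at 0)"
      using bounded_linear_scaleC_left linear_continuous_at isCont_def by blast
    then have "((\<lambda>s. s *\<^sub>C w) \<longlongrightarrow> 0) (at 0)" by simp
    with C have "\<forall>\<^sub>F s in at 0. norm (F (s *\<^sub>C w)) \<le> C * norm (s *\<^sub>C w) ^ k"
      by (auto simp: filterlim_iff)
    then have "\<forall>\<^sub>F s in at 0. norm (F (s *\<^sub>C w)) \<le> (C * norm w ^ k) * norm s ^ k"
      by eventually_elim (simp add: norm_scaleC_vec power_mult_distrib ac_simps)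
    then show ?thesis by auto
  qed
  obtain \<Phi> where \<Phi>: "\<Phi> analytic_map_on ball 0 \<delta> \<times> ball 0 R'"
      "\<forall>s\<in>ball 0 \<delta>. \<forall>w\<in>ball 0 R'. F (fst (s, w) *\<^sub>C snd (s, w)) = s ^ k * \<Phi> (s, w)"
    using analytic_map_on_divide_order[OF ana open_ball \<delta> order] by blast
  let ?K = "cball (0::complex) (\<delta> / 2) \<times> cball (0 :: complex ^ 'm) R"
  have "?K \<subseteq> ball 0 \<delta> \<times> ball 0 R'" using \<delta> by (auto simp: R'_def)
  then have "compact (\<Phi> ` ?K)"
    by (intro compact_continuous_image compact_Times compact_cball
        continuous_on_subset[OF analytic_map_on_continuous[OF \<Phi>(1)]])
  then obtain M where M: "\<And>q. q \<in> ?K \<Longrightarrow> norm (\<Phi> q) \<le> M"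
    using compact_imp_bounded bounded_iff by (metis imageI)
  show ?thesis
  proof (rule that[of "\<delta> / 2" \<Phi> M])
    show "\<Phi> analytic_map_on ball 0 (\<delta> / 2) \<times> ball 0 R"
      using \<delta> by (intro analytic_map_on_subset[OF \<Phi>(1)]) (auto simp: R'_def)
    show "F (s *\<^sub>C w) = s ^ k * \<Phi> (s, w)" if "s \<in> ball 0 (\<delta> / 2)" "w \<in> ball 0 R" for s w
      using that \<delta> \<Phi>(2) by (auto simp: R'_def)
    show "norm (\<Phi> (s, w)) \<le> M" if "s \<in> ball 0 (\<delta> / 2)" "w \<in> ball 0 R" for s w
      using that by (intro M) auto
  qed (use \<delta> in simp)
qed

section \<open>Functions on the blown-up phase space\<close>

lemma BBT_eq: "BBT \<kappa> \<zeta> = ball 0 \<kappa> \<times> (ball 0 \<kappa> \<times> strip \<zeta>)"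
  by (simp add: BBT_def strip_def)

lemma open_BBT: "open (BBT \<kappa> \<zeta>)"
  unfolding BBT_eq by (intro open_Times open_ball open_strip)

lemma analytic_on_BBTI:
  assumes "f analytic_map_on BBT \<kappa> \<zeta>"
    and "\<And>x y \<theta>. (x, y, \<theta>) \<in> BBT \<kappa> \<zeta> \<Longrightarrow> f (x, y, \<theta> + 2 * complex_of_real pi) = f (x, y, \<theta>)"
  shows "analytic_on_BBT \<kappa> \<zeta> f"
  using assms by (auto simp: analytic_on_BBT_def)

lemma analytic_on_BBTD:
  assumes "analytic_on_BBT \<kappa> \<zeta> f"
  shows "f analytic_map_on BBT \<kappa> \<zeta>"
    and "(x, y, \<theta>) \<in> BBT \<kappa> \<zeta> \<Longrightarrow> f (x, y, \<theta> + 2 * complex_of_real pi) = f (x, y, \<theta>)"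
  using assms by (auto simp: analytic_on_BBT_def)

lemma analytic_on_BBT_Taylor1:
  fixes f :: "complex \<times> (complex ^ 'n::finite) \<times> complex \<Rightarrow> complex"
  assumes f: "analytic_on_BBT \<kappa> \<zeta> f" and "\<kappa> > 0"
  obtains h where "analytic_on_BBT \<kappa> \<zeta> h"
    and "\<And>x y \<theta>. (x, y, \<theta>) \<in> BBT \<kappa> \<zeta> \<Longrightarrow> f (x, y, \<theta>) = f (0, y, \<theta>) + x * h (x, y, \<theta>)"
proof -
  define f0 where "f0 p = f p - f (0, snd p)" for p
  have in_dom: "(0, snd p) \<in> BBT \<kappa> \<zeta>" if "p \<in> BBT \<kappa> \<zeta>" for p :: "complex \<times> (complex ^ 'n) \<times> complex"
    using that \<open>\<kappa> > 0\<close> by (auto simp: BBT_eq)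
  have "f0 analytic_map_on BBT \<kappa> \<zeta>"
    unfolding f0_def
    by (intro analytic_map_intros analytic_map_on_compose[OF analytic_on_BBTD(1)[OF f]])
      (use analytic_on_BBTD(1)[OF f] in_dom in auto)
  then have ana: "first_quotient f0 analytic_map_on BBT \<kappa> \<zeta>"
    unfolding BBT_eq
    by (rule analytic_map_on_first_quotient) (auto simp: f0_def intro: open_Times open_strip)
  have per: "first_quotient f0 (x, y, \<theta> + 2 * complex_of_real pi) = first_quotient f0 (x, y, \<theta>)"
    if dom: "(x, y, \<theta>) \<in> BBT \<kappa> \<zeta>" for x y \<theta>
  proof -
    have eq: "f0 (s, y, \<theta> + 2 * complex_of_real pi) = f0 (s, y, \<theta>)" if "s \<in> ball 0 \<kappa>" for s
    proof -
      have "(s, y, \<theta>) \<in> BBT \<kappa> \<zeta>" "(0, y, \<theta>) \<in> BBT \<kappa> \<zeta>"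
        using dom that \<open>\<kappa> > 0\<close> by (auto simp: BBT_eq)
      then show ?thesis by (simp add: f0_def analytic_on_BBTD(2)[OF f])
    qed
    have "\<forall>\<^sub>F s in nhds 0. s \<in> ball (0::complex) \<kappa>"
      using \<open>\<kappa> > 0\<close> by (intro eventually_nhds_in_open) auto
    then have "\<forall>\<^sub>F s in nhds 0. f0 (s, y, \<theta> + 2 * complex_of_real pi) = f0 (s, y, \<theta>)"
      by eventually_elim (rule eq)
    then have "deriv (\<lambda>s. f0 (s, y, \<theta> + 2 * complex_of_real pi)) 0 = deriv (\<lambda>s. f0 (s, y, \<theta>)) 0"
      by (intro deriv_cong_ev) auto
    moreover have "f0 (x, y, \<theta> + 2 * complex_of_real pi) = f0 (x, y, \<theta>)"
      using dom by (intro eq) (auto simp: BBT_eq)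
    ultimately show ?thesis by (simp add: first_quotient_def)
  qed
  show ?thesis
  proof (rule that[of "first_quotient f0"])
    show "analytic_on_BBT \<kappa> \<zeta> (first_quotient f0)" by (rule analytic_on_BBTI[OF ana per])
    show "f (x, y, \<theta>) = f (0, y, \<theta>) + x * first_quotient f0 (x, y, \<theta>)" for x y \<theta>
      using first_quotient_mult[of f0 "(y, \<theta>)" x] by (simp add: f0_def diff_eq_eq add.commute)
  qed
qed

text \<open>
  In a smaller strip one period of \<open>K\<close> takes its values on a compact rectangle. This makes the
  estimates below uniform in the unbounded variable \<open>\<theta>\<close>.
\<close>
lemma periodic_imp_bounded:
  fixes K :: "complex \<Rightarrow> 'b::real_normed_vector"
  assumes cont: "continuous_on (strip \<zeta>) K"
    and per: "\<And>\<theta>. \<theta> \<in> strip \<zeta> \<Longrightarrow> K (\<theta> + 2 * of_real pi) = K \<theta>" and "\<zeta>' < \<zeta>"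
  obtains M where "M \<ge> 0" "\<And>\<theta>. \<theta> \<in> strip \<zeta>' \<Longrightarrow> norm (K \<theta>) \<le> M"
proof -
  have per_nat: "K (\<theta> + of_nat n * (2 * of_real pi)) = K \<theta>" if "\<theta> \<in> strip \<zeta>" for \<theta> n
  proof (induction n)
    case (Suc n)
    have "\<theta> + of_nat n * (2 * of_real pi) \<in> strip \<zeta>" using that by (simp add: strip_def)
    from per[OF this] Suc show ?case by (simp add: algebra_simps)
  qed simp
  have per_int: "K (\<theta> + of_int n * (2 * of_real pi)) = K \<theta>" if "\<theta> \<in> strip \<zeta>" for \<theta> n
  proof (cases n rule: int_cases2)
    case (nonneg m)
    then show ?thesis using per_nat[OF that, of m] by simp
  next
    case (nonpos m)
    have "\<theta> + of_int n * (2 * of_real pi) \<in> strip \<zeta>" using that by (simp add: strip_def)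
    from per_nat[OF this, of m] nonpos show ?thesis by simp
  qed
  define Q where "Q = cbox (Complex 0 (-\<zeta>')) (Complex (2 * pi) \<zeta>')"
  have Q: "\<theta> \<in> Q \<longleftrightarrow> 0 \<le> Re \<theta> \<and> Re \<theta> \<le> 2 * pi \<and> \<bar>Im \<theta>\<bar> \<le> \<zeta>'" for \<theta>
    by (auto simp: Q_def in_cbox_complex_iff)
  have "Q \<subseteq> strip \<zeta>" using \<open>\<zeta>' < \<zeta>\<close> by (auto simp: Q strip_def)
  then have "compact (K ` Q)"
    using cont by (intro compact_continuous_image) (auto simp: Q_def intro: continuous_on_subset)
  then obtain M where M: "\<And>\<theta>. \<theta> \<in> Q \<Longrightarrow> norm (K \<theta>) \<le> M"
    using compact_imp_bounded bounded_iff by (metis imageI)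
  have "norm (K \<theta>) \<le> max M 0" if "\<theta> \<in> strip \<zeta>'" for \<theta>
  proof -
    define n where "n = \<lfloor>Re \<theta> / (2 * pi)\<rfloor>"
    define \<theta>0 where "\<theta>0 = \<theta> - of_int n * (2 * of_real pi)"
    have "of_int n \<le> Re \<theta> / (2 * pi)" "Re \<theta> / (2 * pi) < of_int n + 1"
      by (simp_all add: n_def)
    then have "\<theta>0 \<in> Q"
      using that by (simp add: \<theta>0_def Q strip_def field_simps)
    moreover have "K \<theta> = K \<theta>0"
      using per_int[of \<theta>0 n] \<open>\<theta>0 \<in> Q\<close> \<open>Q \<subseteq> strip \<zeta>\<close> by (auto simp: \<theta>0_def)
    ultimately show ?thesis using M[of \<theta>0] by simp
  qed
  then show ?thesis by (intro that[of "max M 0"]) auto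
qed

section \<open>Charts of blowup type\<close>

text \<open>
  A change of coordinates of blowup type into an arbitrary vector field \<open>V\<close>, up to the factor \<open>g\<close>.
  The pullback is expressed by pushing \<open>V\<close> forward with an injective derivative, because in this form
  charts compose by the chain rule.
\<close>
definition blowup_chart ::
  "real \<Rightarrow> real \<Rightarrow> (complex ^ 'm) set \<Rightarrow> (complex ^ 'm \<Rightarrow> complex ^ 'm) \<Rightarrow>
   (complex \<times> (complex ^ 'n) \<times> complex \<Rightarrow> complex ^ 'm) \<Rightarrow>
   (complex \<times> (complex ^ 'n) \<times> complex \<Rightarrow> complex) \<Rightarrow>
   (complex \<times> (complex ^ 'n) \<times> complex \<Rightarrow> complex \<times> (complex ^ 'n) \<times> complex) \<Rightarrow> bool"
  where "blowup_chart \<kappa> \<zeta> W X \<Psi> g V \<longleftrightarrow>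
    analytic_on_BBT \<kappa> \<zeta> \<Psi> \<and> \<Psi> ` BBT \<kappa> \<zeta> \<subseteq> W \<and>
    (\<forall>y \<theta>. (0, y, \<theta>) \<in> BBT \<kappa> \<zeta> \<longrightarrow> \<Psi> (0, y, \<theta>) = 0) \<and>
    analytic_on_BBT \<kappa> \<zeta> g \<and> (\<forall>p \<in> BBT \<kappa> \<zeta>. g p \<noteq> 0) \<and>
    (\<forall>p \<in> BBT \<kappa> \<zeta>. fst p \<noteq> 0 \<longrightarrow>
       (\<exists>D. (\<Psi> has_derivative D) (at p) \<and> inj D \<and> D (g p *\<^sub>C V p) = X (\<Psi> p)))"

lemma blowup_to_NFI:
  fixes \<Psi> :: "complex \<times> (complex ^ 'n::finite) \<times> complex \<Rightarrow> complex ^ 'm::finite"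
  assumes chart: "blowup_chart \<kappa> \<zeta> W X \<Psi> g (NF F0 l F1 G1)" and pos: "\<kappa> > 0" "\<zeta> > 0" "\<And>j. l $ j > 0"
    and ana: "analytic_on_BBT \<kappa> \<zeta> F1" "analytic_on_BBT \<kappa> \<zeta> G1" and dim: "CARD('m) = CARD('n) + 2"
  shows "blowup_to_NF TYPE('n) W X"
proof -
  note chart' = chart[unfolded blowup_chart_def]
  have "local_biholomorphism_at \<Psi> p \<and> pullback_field \<Psi> X p = g p *\<^sub>C NF F0 l F1 G1 p"
    if p: "p \<in> BBT \<kappa> \<zeta>" "fst p \<noteq> 0" for p
  proof -
    obtain D where D: "(\<Psi> has_derivative D) (at p)" "inj D" "D (g p *\<^sub>C NF F0 l F1 G1 p) = X (\<Psi> p)"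
      using chart' p by blast
    have "\<Psi> analytic_map_on BBT \<kappa> \<zeta>" using chart' by (blast intro: analytic_on_BBTD)
    with D(1,2) p(1) dim have "local_biholomorphism_at \<Psi> p"
      by (intro local_biholomorphism_at_inj_derivative[OF open_BBT]) auto
    moreover have "pullback_field \<Psi> X p = g p *\<^sub>C NF F0 l F1 G1 p"
      by (rule pullback_field_eqI) (rule D)+
    ultimately show ?thesis by blast
  qed
  then show ?thesis
    unfolding blowup_to_NF_def using chart' pos ana
    by (intro exI[of _ \<kappa>] conjI exI[of _ \<zeta>] exI[of _ \<Psi>] exI[of _ g] exI[of _ F0] exI[of _ l] exI[of _ F1] exI[of _ G1])
      auto
qed

section \<open>Removing the angle from the leading terms\<close>

definition cdot :: "complex ^ 'n \<Rightarrow> complex ^ 'n \<Rightarrow> complex"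
  where "cdot k v = (\<Sum>j\<in>UNIV. k $ j * v $ j)"

lemma bounded_linear_cdot: "bounded_linear (cdot k :: complex ^ 'n::finite \<Rightarrow> complex)"
proof -
  have "bounded_linear (\<lambda>v. \<Sum>j\<in>UNIV. k $ j * v $ j)"
    by (intro bounded_linear_sum bounded_linear_compose[OF bounded_linear_mult_right] bounded_linear_vec_nth)
  then show ?thesis by (simp add: cdot_def[abs_def])
qed

lemma norm_cdot_le: "norm (cdot k v) \<le> (\<Sum>j\<in>UNIV. norm (k $ j)) * norm v"
  unfolding cdot_def sum_distrib_right
  by (intro order_trans[OF norm_sum] sum_mono)
    (simp add: norm_mult mult_left_mono Finite_Cartesian_Product.norm_nth_le)

lemma analytic_map_on_cdot [analytic_map_intros]:
  "f analytic_map_on S \<Longrightarrow> (\<lambda>p. cdot k (f p)) analytic_map_on S"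
  unfolding cdot_def by (intro analytic_map_intros)

text \<open>
  The intermediate form that the polar charts lead to. It differs from the normal form in
  two respects: the \<open>s ^ 3\<close> term of the first component depends on \<open>z\<close> (linearly) and on the angle,
  and the second component has a forcing term \<open>s * g \<theta>\<close>.
\<close>
definition averaged_form ::
  "complex ^ 'n \<Rightarrow> (complex \<Rightarrow> complex) \<Rightarrow> (complex \<Rightarrow> complex ^ 'n) \<Rightarrow>
   (complex \<times> (complex ^ 'n) \<times> complex \<Rightarrow> complex) \<Rightarrow>
   (complex \<times> (complex ^ 'n) \<times> complex \<Rightarrow> complex ^ 'n) \<Rightarrow> real ^ 'n \<Rightarrow>
   complex \<times> (complex ^ 'n) \<times> complex \<Rightarrow> complex \<times> (complex ^ 'n) \<times> complex"
  where "averaged_form m f g A B l = (\<lambda>(s, z, \<theta>).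
    (s\<^sup>2 * (1 + s * (cdot m z + f \<theta>) + s\<^sup>2 * A (s, z, \<theta>)),
     \<chi> j. s * (- of_real (l $ j) * z $ j + g \<theta> $ j + s * B (s, z, \<theta>) $ j),
     1))"

lemma diag_matrix_mult: "diag_matrix l *v y = (\<chi> j. of_real (l $ j) * y $ j)"
  by (simp add: diag_matrix_def matrix_vector_mult_def vec_eq_iff if_distrib[of "\<lambda>c. c * _"] cong: if_cong)

text \<open>
  The equation for \<open>Xd\<close>, the time derivative of \<open>X\<close>, that results from differentiating
  \<open>s = X * S = X * (1 + X * kY + X ^ 2 * K1)\<close>. Here \<open>kY\<close>, \<open>kK2\<close>, \<open>kg\<close>, \<open>kB\<close> are the products of the
  vector \<open>k\<close> with \<open>Y\<close>, \<open>K2\<close>, \<open>g\<close>, \<open>B\<close>. The choice \<open>k $ j = - m $ j / l $ j\<close> turns the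
  contribution of \<open>- l $ j * z $ j\<close> into \<open>mz\<close>, which cancels the linear term, and the derivative \<open>f - F0\<close> of \<open>K1\<close> cancels the
  angular part of \<open>f\<close>. The remainder of order \<open>X ^ 4\<close> is \<open>E\<close>. Solving for \<open>Xd\<close> divides
  by \<open>\<Delta>\<close>, which is close to 1.
\<close>
lemma radial_identity:
  fixes X T kY K1 kK2 mz f F0 kg kB A S \<Delta> E F1 Xd :: complex
  assumes "S = 1 + X * T" "T = kY + X * K1" "\<Delta> = 1 + 2 * X * kY + 3 * X\<^sup>2 * K1 - X\<^sup>2 * kK2" "\<Delta> \<noteq> 0"
    and "E = T\<^sup>2 + (S\<^sup>2 + S) * T * mz + (S\<^sup>2 + S + 1) * T * f - T * kg + S ^ 4 * A - S\<^sup>2 * kB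
        - F0 * (2 * T + X * (K1 - kK2)) - (K1 - kK2)"
    and "F1 = E / \<Delta>" and "Xd = X\<^sup>2 * (1 + X * F0 + X\<^sup>2 * F1)"
  shows "Xd * (1 + 2 * X * kY + 3 * X\<^sup>2 * K1)
      + X\<^sup>2 * (X * S * (mz + kg + X * S * kB) - Xd * kK2 - X * kg) + X ^ 3 * (f - F0)
      = (X * S)\<^sup>2 * (1 + X * S * (mz + f) + (X * S)\<^sup>2 * A)"
proof -
  have "\<Delta> * F1 = E" using assms(4,6) by simp
  then have "Xd * \<Delta> = X\<^sup>2 * ((1 + X * F0) * \<Delta> + X\<^sup>2 * E)"
    unfolding assms(7) by (simp add: algebra_simps)
  moreover have "Xd * (1 + 2 * X * kY + 3 * X\<^sup>2 * K1)
      + X\<^sup>2 * (X * S * (mz + kg + X * S * kB) - Xd * kK2 - X * kg) + X ^ 3 * (f - F0)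
      = Xd * \<Delta> + X\<^sup>2 * (X * S * (mz + kg + X * S * kB) - X * kg) + X ^ 3 * (f - F0)"
    unfolding assms(3) by algebra
  moreover have "X\<^sup>2 * ((1 + X * F0) * \<Delta> + X\<^sup>2 * E) + X\<^sup>2 * (X * S * (mz + kg + X * S * kB) - X * kg) + X ^ 3 * (f - F0)
      = (X * S)\<^sup>2 * (1 + X * S * (mz + f) + (X * S)\<^sup>2 * A)"
    unfolding assms(5,3,1) assms(2) by algebra
  ultimately show ?thesis by simp
qed

text \<open>
  One component of the second equation, from differentiating \<open>z = Y + X * K2\<close>: the derivative
  \<open>g\<close> of \<open>K2\<close> cancels the forcing term.
\<close>
lemma transversal_identity:
  fixes X T S l Y K2 g B Xd :: complex
  assumes "S = 1 + X * T" "Xd = X\<^sup>2 * P"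
    and "G = - l * T * Y - S * l * K2 + T * g + S\<^sup>2 * B - P * K2"
  shows "X * (- l * Y + X * G) + Xd * K2 + X * g = X * S * (- l * (Y + X * K2) + g + X * S * B)"
  unfolding assms by algebra

definition averaging_map ::
  "complex ^ 'n \<Rightarrow> (complex \<Rightarrow> complex) \<Rightarrow> (complex \<Rightarrow> complex ^ 'n) \<Rightarrow>
   complex \<times> (complex ^ 'n) \<times> complex \<Rightarrow> complex \<times> (complex ^ 'n) \<times> complex"
  where "averaging_map k K1 K2 = (\<lambda>p.
    (fst p * (1 + fst p * (cdot k (fst (snd p)) + fst p * K1 (snd (snd p)))),
     \<chi> j. fst (snd p) $ j + fst p * K2 (snd (snd p)) $ j,
     snd (snd p)))"

lemma averaging_map_has_derivative:
  fixes y :: "complex ^ 'n::finite"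
  assumes "(K1 has_field_derivative a) (at \<theta>)"
    and "\<And>j. ((\<lambda>\<theta>. K2 \<theta> $ j) has_field_derivative b $ j) (at \<theta>)"
  shows "(averaging_map k K1 K2 has_derivative (\<lambda>h.
      (fst h * (1 + 2 * x * cdot k y + 3 * x\<^sup>2 * K1 \<theta>) + x\<^sup>2 * cdot k (fst (snd h)) + x ^ 3 * a * snd (snd h),
       \<chi> j. fst (snd h) $ j + fst h * K2 \<theta> $ j + x * b $ j * snd (snd h),
       snd (snd h)))) (at (x, y, \<theta>))"
proof -
  have 1: "((\<lambda>p :: complex \<times> (complex ^ 'n) \<times> complex. cdot k (fst (snd p))) has_derivative (\<lambda>h. cdot k (fst (snd h)))) (at (x, y, \<theta>))"
    by (rule bounded_linear.has_derivative[OF bounded_linear_cdot])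
      (rule derivative_eq_intros refl)+
  have th: "((\<lambda>p :: complex \<times> (complex ^ 'n) \<times> complex. snd (snd p)) has_derivative (\<lambda>h. snd (snd h))) (at (x, y, \<theta>))"
    by (rule derivative_eq_intros refl)+
  have 2: "((\<lambda>p :: complex \<times> (complex ^ 'n) \<times> complex. K1 (snd (snd p))) has_derivative (\<lambda>h. snd (snd h) * a)) (at (x, y, \<theta>))"
    using has_derivative_compose[OF th, of K1 "(*) a"] assms(1)
    by (simp add: has_field_derivative_def mult.commute)
  have 3: "((\<lambda>p :: complex \<times> (complex ^ 'n) \<times> complex. K2 (snd (snd p)) $ j) has_derivative (\<lambda>h. snd (snd h) * b $ j)) (at (x, y, \<theta>))" for j
    using has_derivative_compose[OF th, of "\<lambda>\<theta>. K2 \<theta> $ j" "(*) (b $ j)"] assms(2)[of j]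
    by (simp add: has_field_derivative_def mult.commute)
  have 4: "((\<lambda>p :: complex \<times> (complex ^ 'n) \<times> complex. fst (snd p) $ j) has_derivative (\<lambda>h. fst (snd h) $ j)) (at (x, y, \<theta>))" for j
    by (rule bounded_linear.has_derivative[OF bounded_linear_vec_nth])
      (rule derivative_eq_intros refl)+
  show ?thesis
    unfolding averaging_map_def
  proof (intro has_derivative_Pair has_derivative_vec th)
    show "((\<lambda>p. fst p * (1 + fst p * (cdot k (fst (snd p)) + fst p * K1 (snd (snd p))))) has_derivative
      (\<lambda>h. fst h * (1 + 2 * x * cdot k y + 3 * x\<^sup>2 * K1 \<theta>) + x\<^sup>2 * cdot k (fst (snd h)) + x ^ 3 * a * snd (snd h))) (at (x, y, \<theta>))"
      by (rule derivative_eq_intros 1 2 refl)+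
        (simp add: fun_eq_iff algebra_simps power2_eq_square power3_eq_cube)
    show "((\<lambda>p. fst (snd p) $ j + fst p * K2 (snd (snd p)) $ j) has_derivative
      (\<lambda>h. fst (snd h) $ j + fst h * K2 \<theta> $ j + x * b $ j * snd (snd h))) (at (x, y, \<theta>))" for j
      by (rule derivative_eq_intros 3 4 refl)+
        (simp add: fun_eq_iff algebra_simps)
  qed
qed

lemma analytic_map_on_averaging_map:
  assumes "K1 holomorphic_on strip \<zeta>" "\<And>j. (\<lambda>\<theta>. K2 \<theta> $ j) holomorphic_on strip \<zeta>"
  shows "averaging_map k K1 K2 analytic_map_on BBT \<kappa> \<zeta>"
  unfolding averaging_map_def
  by (intro analytic_map_intros
      analytic_map_on_holomorphic_compose[OF assms(1) open_strip]
      analytic_map_on_holomorphic_compose[OF assms(2) open_strip])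
    (auto simp: BBT_eq)

text \<open>
  Averaging. The assumptions on \<open>K2\<close> say that every component of \<open>g\<close> has mean value zero. In the
  first component only the oscillating part \<open>f - F0\<close> has a periodic primitive \<open>K1\<close>, and the
  mean value \<open>F0\<close> of \<open>f\<close> becomes the constant of the normal form.
\<close>
theorem blowup_to_NF_of_averaged_form:
  fixes \<Psi> :: "complex \<times> (complex ^ 'n::finite) \<times> complex \<Rightarrow> complex ^ 'm::finite"
  assumes chart: "blowup_chart \<kappa> \<zeta> W X \<Psi> G (averaged_form m f g A B l)"
    and pos: "\<kappa> > 0" "\<zeta> > 0" "\<And>j. l $ j > 0"
    and f: "f holomorphic_on strip \<zeta>" "\<And>\<theta>. \<theta> \<in> strip \<zeta> \<Longrightarrow> f (\<theta> + 2 * of_real pi) = f \<theta>"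
    and gper: "\<And>\<theta>. \<theta> \<in> strip \<zeta> \<Longrightarrow> g (\<theta> + 2 * of_real pi) = g \<theta>"
    and ghol: "\<And>j. (\<lambda>\<theta>. g \<theta> $ j) holomorphic_on strip \<zeta>"
    and K2hol: "\<And>j. (\<lambda>\<theta>. K2 \<theta> $ j) holomorphic_on strip \<zeta>"
    and K2per: "\<And>\<theta>. \<theta> \<in> strip \<zeta> \<Longrightarrow> K2 (\<theta> + 2 * of_real pi) = K2 \<theta>"
    and K2der: "\<And>j \<theta>. \<theta> \<in> strip \<zeta> \<Longrightarrow> ((\<lambda>\<theta>. K2 \<theta> $ j) has_field_derivative g \<theta> $ j) (at \<theta>)"
    and AB: "analytic_on_BBT \<kappa> \<zeta> A" "analytic_on_BBT \<kappa> \<zeta> B" and dim: "CARD('m) = CARD('n) + 2"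
  shows "blowup_to_NF TYPE('n) W X"
proof -
  note chart' = chart[unfolded blowup_chart_def]
  obtain F0 K1 where K1: "K1 holomorphic_on strip \<zeta>"
      "\<And>\<theta>. \<theta> \<in> strip \<zeta> \<Longrightarrow> K1 (\<theta> + 2 * of_real pi) = K1 \<theta>"
      "\<And>\<theta>. \<theta> \<in> strip \<zeta> \<Longrightarrow> (K1 has_field_derivative f \<theta> - F0) (at \<theta>)"
    by (rule periodic_primitive_minus_mean[where f=f and \<zeta>=\<zeta>, OF f]) (assumption | (rule that; assumption))+
  define k :: "complex ^ 'n" where "k = (\<chi> j. - m $ j / of_real (l $ j))"
  have kl: "k $ j * of_real (l $ j) = - m $ j" for j
    using pos(3)[of j] by (simp add: k_def)
  define \<zeta>' where "\<zeta>' = \<zeta> / 2"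
  have \<zeta>': "0 < \<zeta>'" "\<zeta>' < \<zeta>" using pos(2) by (auto simp: \<zeta>'_def)
  obtain M1 where M1: "M1 \<ge> 0" "\<And>\<theta>. \<theta> \<in> strip \<zeta>' \<Longrightarrow> norm (K1 \<theta>) \<le> M1"
    by (rule periodic_imp_bounded[where K=K1, OF holomorphic_on_imp_continuous_on[OF K1(1)] K1(2) \<zeta>'(2)])
      (assumption | (rule that; assumption))+
  have "continuous_on (strip \<zeta>) (\<lambda>\<theta>. \<chi> j. K2 \<theta> $ j)"
    by (intro continuous_on_vec_lambda holomorphic_on_imp_continuous_on K2hol)
  then have K2cont: "continuous_on (strip \<zeta>) K2" by simp
  obtain M2 where M2: "M2 \<ge> 0" "\<And>\<theta>. \<theta> \<in> strip \<zeta>' \<Longrightarrow> norm (K2 \<theta>) \<le> M2"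
    by (rule periodic_imp_bounded[where K=K2, OF K2cont K2per \<zeta>'(2)])
      (assumption | (rule that; assumption))+
  define N where "N = (\<Sum>j\<in>UNIV. norm (k $ j))"
  have N: "N \<ge> 0" "norm (cdot k v) \<le> N * norm v" for v
    by (simp_all add: N_def sum_nonneg norm_cdot_le)
  \<comment> \<open>\<open>Q\<close> dominates every quantity that the new variable \<open>X\<close> multiplies in \<open>S\<close>, \<open>\<Delta>\<close> and \<open>\<Lambda>\<close>.\<close>
  define Q where "Q = 1 + 2 * N + 3 * M1 + M2 + N * M2"
  have NM: "N * M2 \<ge> 0" using N(1) M2(1) by simp
  have Q: "Q \<ge> 1" using N(1) M1(1) M2(1) NM unfolding Q_def by linarith
  define \<kappa>' where "\<kappa>' = min \<kappa> 1 / (2 * Q)"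
  have \<kappa>': "\<kappa>' > 0" "\<kappa>' * Q \<le> \<kappa> / 2" "\<kappa>' * Q \<le> 1 / 2"
    using Q pos(1) by (auto simp: \<kappa>'_def min_def)
  have "\<kappa>' * 1 \<le> \<kappa>' * Q" using Q \<kappa>'(1) by (intro mult_left_mono) auto
  then have \<kappa>'_le: "\<kappa>' \<le> \<kappa>" "\<kappa>' \<le> 1" using \<kappa>' pos(1) by linarith+

  \<comment> \<open>\<open>\<Delta>\<close> is the determinant of the derivative of \<open>\<Lambda>\<close>.\<close>
  define \<Lambda> where "\<Lambda> = averaging_map k K1 K2"
  define T where "T p = cdot k (fst (snd p)) + fst p * K1 (snd (snd p))" for p :: "complex \<times> (complex ^ 'n) \<times> complex"
  define S where "S p = 1 + fst p * T p" for p
  define \<Delta> where "\<Delta> p = 1 + 2 * fst p * cdot k (fst (snd p)) + 3 * (fst p)\<^sup>2 * K1 (snd (snd p))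
      - (fst p)\<^sup>2 * cdot k (K2 (snd (snd p)))" for p :: "complex \<times> (complex ^ 'n) \<times> complex"
  have \<Lambda>_eq: "\<Lambda> (x, y, \<theta>) = (x * S (x, y, \<theta>), \<chi> j. y $ j + x * K2 \<theta> $ j, \<theta>)" for x y \<theta>
    by (simp add: \<Lambda>_def averaging_map_def S_def T_def)
  have bounds: "\<Lambda> (x, y, \<theta>) \<in> BBT \<kappa> \<zeta>" "\<Delta> (x, y, \<theta>) \<noteq> 0" "S (x, y, \<theta>) \<noteq> 0" "\<theta> \<in> strip \<zeta>"
    if dom: "(x, y, \<theta>) \<in> BBT \<kappa>' \<zeta>'" for x y \<theta>
  proof -
    have x: "norm x < \<kappa>'" and y: "norm y < \<kappa>'" and th: "\<theta> \<in> strip \<zeta>'" using dom by (auto simp: BBT_eq)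
    then show th': "\<theta> \<in> strip \<zeta>" using \<zeta>' by (auto simp: strip_def)
    have x1: "norm x \<le> 1" and y1: "norm y \<le> 1" using x y \<kappa>'_le by auto
    have ky: "norm (cdot k y) \<le> N"
      using N(2)[of y] mult_left_mono[OF y1 N(1)] by simp
    have K1b: "norm (K1 \<theta>) \<le> M1" using M1(2)[OF th] .
    have K2b: "norm (K2 \<theta>) \<le> M2" using M2(2)[OF th] .
    have kK2: "norm (cdot k (K2 \<theta>)) \<le> N * M2"
      using N(2)[of "K2 \<theta>"] mult_left_mono[OF K2b N(1)] by simp
    have xc: "norm (x * c) \<le> b" if "norm c \<le> b" for c b
      using mult_mono[OF x1 that] by (simp add: norm_mult)
    have T_le: "norm (T (x, y, \<theta>)) \<le> N + M1"
      using norm_triangle_mono[OF ky xc[OF K1b]] by (simp add: T_def)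
    have small: "norm (x * c) \<le> \<kappa>' * Q" if "norm c \<le> Q" for c
      using mult_mono[of "norm x" \<kappa>' "norm c" Q] x that \<kappa>'(1) by (simp add: norm_mult)
    have "norm (T (x, y, \<theta>)) \<le> Q" using T_le N(1) M1(1) M2(1) NM unfolding Q_def by linarith
    from small[OF this] \<kappa>'(3) have S1: "norm (S (x, y, \<theta>) - 1) \<le> 1 / 2" by (simp add: S_def)
    then show "S (x, y, \<theta>) \<noteq> 0" by auto
    have "norm (S (x, y, \<theta>)) \<le> 1 + (N + M1)"
      using norm_triangle_mono[OF order_refl[of "norm (1::complex)"] xc[OF T_le]] by (simp add: S_def)
    then have "norm (S (x, y, \<theta>)) \<le> Q" using N(1) M1(1) M2(1) NM unfolding Q_def by linarith
    from small[OF this] \<kappa>'(2) pos(1) have xS: "norm (x * S (x, y, \<theta>)) < \<kappa>" by simp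
    have "norm (y + x *\<^sub>C K2 \<theta>) \<le> \<kappa>' + \<kappa>' * M2"
      using y x K2b \<kappa>'(1)
      by (intro norm_triangle_mono) (auto simp: norm_scaleC_vec intro!: mult_mono)
    also have "\<dots> = \<kappa>' * (1 + M2)" by (simp add: algebra_simps)
    also have "\<dots> \<le> \<kappa>' * Q" using \<kappa>'(1) N(1) M1(1) M2(1) NM unfolding Q_def by (intro mult_left_mono) linarith+
    finally have "norm (y + x *\<^sub>C K2 \<theta>) < \<kappa>" using \<kappa>'(2) pos(1) by simp
    moreover have "(\<chi> j. y $ j + x * K2 \<theta> $ j) = y + x *\<^sub>C K2 \<theta>"
      by (simp add: vec_eq_iff scaleC_vec_def scaleC_complex_def)
    ultimately show "\<Lambda> (x, y, \<theta>) \<in> BBT \<kappa> \<zeta>" using xS th' by (simp add: \<Lambda>_eq BBT_eq)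
    have "norm (2 * cdot k y + x * (3 * K1 \<theta> - cdot k (K2 \<theta>))) \<le> 2 * N + (3 * M1 + N * M2)"
      using ky K1b kK2
      by (intro norm_triangle_mono xc order_trans[OF norm_triangle_ineq4] add_mono) (auto simp: norm_mult)
    then have "norm (2 * cdot k y + x * (3 * K1 \<theta> - cdot k (K2 \<theta>))) \<le> Q" using M2(1) unfolding Q_def by linarith
    from small[OF this] \<kappa>'(3) have "norm (\<Delta> (x, y, \<theta>) - 1) \<le> 1 / 2"
      by (simp add: \<Delta>_def algebra_simps power2_eq_square)
    then show "\<Delta> (x, y, \<theta>) \<noteq> 0" by auto
  qed
  have \<Lambda>_in: "\<Lambda> p \<in> BBT \<kappa> \<zeta>" if "p \<in> BBT \<kappa>' \<zeta>'" for p
    using that bounds(1) by (cases p) auto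
  have sub: "strip \<zeta>' \<subseteq> strip \<zeta>" using \<zeta>' by (auto simp: strip_def)
  have \<Lambda>_ana: "\<Lambda> analytic_map_on BBT \<kappa>' \<zeta>'"
    unfolding \<Lambda>_def
    by (intro analytic_map_on_averaging_map holomorphic_on_subset[OF K1(1) sub] holomorphic_on_subset[OF K2hol sub])
  have \<Lambda>_shift: "\<Lambda> (x, y, \<theta> + 2 * of_real pi) = (fst (\<Lambda> (x, y, \<theta>)), fst (snd (\<Lambda> (x, y, \<theta>))), snd (snd (\<Lambda> (x, y, \<theta>))) + 2 * of_real pi)"
    if "(x, y, \<theta>) \<in> BBT \<kappa>' \<zeta>'" for x y \<theta>
    using K1(2) K2per bounds(4)[OF that] by (simp add: \<Lambda>_def averaging_map_def)
  have comp_BBT: "analytic_on_BBT \<kappa>' \<zeta>' (\<lambda>p. q (\<Lambda> p))" if q: "analytic_on_BBT \<kappa> \<zeta> q"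
    for q :: "_ \<Rightarrow> 'b::{complex_vector,real_normed_vector}"
  proof (rule analytic_on_BBTI)
    show "(\<lambda>p. q (\<Lambda> p)) analytic_map_on BBT \<kappa>' \<zeta>'"
      using \<Lambda>_in by (intro analytic_map_on_compose[OF analytic_on_BBTD(1)[OF q] \<Lambda>_ana]) auto
    show "q (\<Lambda> (x, y, \<theta> + 2 * complex_of_real pi)) = q (\<Lambda> (x, y, \<theta>))"
      if "(x, y, \<theta>) \<in> BBT \<kappa>' \<zeta>'" for x y \<theta>
      using \<Lambda>_shift[OF that] analytic_on_BBTD(2)[OF q, of "fst (\<Lambda> (x, y, \<theta>))" "fst (snd (\<Lambda> (x, y, \<theta>)))" "snd (snd (\<Lambda> (x, y, \<theta>)))"]
        bounds(1)[OF that] by simp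
  qed

  define E where "E p = (T p)\<^sup>2 + ((S p)\<^sup>2 + S p) * T p * cdot m (fst (snd (\<Lambda> p)))
      + ((S p)\<^sup>2 + S p + 1) * T p * f (snd (snd p)) - T p * cdot k (g (snd (snd p)))
      + S p ^ 4 * A (\<Lambda> p) - (S p)\<^sup>2 * cdot k (B (\<Lambda> p))
      - F0 * (2 * T p + fst p * (K1 (snd (snd p)) - cdot k (K2 (snd (snd p)))))
      - (K1 (snd (snd p)) - cdot k (K2 (snd (snd p))))" for p
  define F1 where "F1 p = E p / \<Delta> p" for p
  define P where "P p = 1 + fst p * F0 + (fst p)\<^sup>2 * F1 p" for p
  define G1 where "G1 p = (\<chi> j. - of_real (l $ j) * T p * fst (snd p) $ j
      - S p * of_real (l $ j) * K2 (snd (snd p)) $ j + T p * g (snd (snd p)) $ j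
      + (S p)\<^sup>2 * B (\<Lambda> p) $ j - P p * K2 (snd (snd p)) $ j)" for p

  have hol: "(\<lambda>p. h (snd (snd p))) analytic_map_on BBT \<kappa>' \<zeta>'" if "h holomorphic_on strip \<zeta>" for h
    using \<zeta>' by (intro analytic_map_on_holomorphic_compose[OF that open_strip] analytic_map_intros)
      (auto simp: BBT_eq strip_def)
  have holv: "(\<lambda>p. h (snd (snd p))) analytic_map_on BBT \<kappa>' \<zeta>'" if "\<And>j. (\<lambda>\<theta>. h \<theta> $ j) holomorphic_on strip \<zeta>"
    for h :: "complex \<Rightarrow> complex ^ 'n"
    by (rule analytic_map_on_componentwise) (rule hol[OF that])
  note ana = hol[OF K1(1)] hol[OF f(1)] holv[OF ghol] holv[OF K2hol] hol[OF ghol] hol[OF K2hol]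
    \<Lambda>_ana analytic_on_BBTD(1)[OF comp_BBT[OF AB(1)]] analytic_on_BBTD(1)[OF comp_BBT[OF AB(2)]]
  have T_ana: "T analytic_map_on BBT \<kappa>' \<zeta>'" unfolding T_def by (intro analytic_map_intros ana)
  have S_ana: "S analytic_map_on BBT \<kappa>' \<zeta>'" unfolding S_def by (intro analytic_map_intros T_ana)
  have \<Delta>_ana: "\<Delta> analytic_map_on BBT \<kappa>' \<zeta>'" unfolding \<Delta>_def by (intro analytic_map_intros ana)
  have E_ana: "E analytic_map_on BBT \<kappa>' \<zeta>'" unfolding E_def by (intro analytic_map_intros ana T_ana S_ana)
  have F1_ana: "F1 analytic_map_on BBT \<kappa>' \<zeta>'"
    unfolding F1_def using bounds(2) by (intro analytic_map_intros E_ana \<Delta>_ana) auto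
  have P_ana: "P analytic_map_on BBT \<kappa>' \<zeta>'" unfolding P_def by (intro analytic_map_intros F1_ana)
  have G1_ana: "G1 analytic_map_on BBT \<kappa>' \<zeta>'"
    unfolding G1_def by (intro analytic_map_intros ana T_ana S_ana P_ana)
  have F1_per: "F1 (x, y, \<theta> + 2 * complex_of_real pi) = F1 (x, y, \<theta>)"
    and G1_per: "G1 (x, y, \<theta> + 2 * complex_of_real pi) = G1 (x, y, \<theta>)"
    if dom: "(x, y, \<theta>) \<in> BBT \<kappa>' \<zeta>'" for x y \<theta>
  proof -
    note th = bounds(4)[OF dom]
    note per = K1(2)[OF th] f(2)[OF th] gper[OF th] K2per[OF th]
      analytic_on_BBTD(2)[OF comp_BBT[OF AB(1)] dom] analytic_on_BBTD(2)[OF comp_BBT[OF AB(2)] dom]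
    have T_per: "T (x, y, \<theta> + 2 * complex_of_real pi) = T (x, y, \<theta>)" by (simp add: T_def per)
    have S_per: "S (x, y, \<theta> + 2 * complex_of_real pi) = S (x, y, \<theta>)" by (simp add: S_def T_per)
    have z_per: "fst (snd (\<Lambda> (x, y, \<theta> + 2 * complex_of_real pi))) = fst (snd (\<Lambda> (x, y, \<theta>)))"
      by (simp add: \<Lambda>_shift[OF dom])
    show F1_per: "F1 (x, y, \<theta> + 2 * complex_of_real pi) = F1 (x, y, \<theta>)"
      by (simp add: F1_def E_def \<Delta>_def per T_per S_per z_per)
    then show "G1 (x, y, \<theta> + 2 * complex_of_real pi) = G1 (x, y, \<theta>)"
      by (simp add: G1_def P_def per T_per S_per)
  qed
  have F1_BBT: "analytic_on_BBT \<kappa>' \<zeta>' F1" and G1_BBT: "analytic_on_BBT \<kappa>' \<zeta>' G1"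
    by (intro analytic_on_BBTI F1_ana G1_ana F1_per G1_per; assumption)+

  have main: "\<exists>D. ((\<lambda>p. \<Psi> (\<Lambda> p)) has_derivative D) (at (x, y, \<theta>)) \<and> inj D \<and>
      D (G (\<Lambda> (x, y, \<theta>)) *\<^sub>C NF F0 l F1 G1 (x, y, \<theta>)) = X (\<Psi> (\<Lambda> (x, y, \<theta>)))"
    if dom: "(x, y, \<theta>) \<in> BBT \<kappa>' \<zeta>'" and x: "x \<noteq> 0" for x y \<theta>
  proof -
    let ?p = "(x, y, \<theta>)"
    define D\<Lambda> where "D\<Lambda> = (\<lambda>h :: complex \<times> (complex ^ 'n) \<times> complex.
        (fst h * (1 + 2 * x * cdot k y + 3 * x\<^sup>2 * K1 \<theta>) + x\<^sup>2 * cdot k (fst (snd h)) + x ^ 3 * (f \<theta> - F0) * snd (snd h),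
         \<chi> j. fst (snd h) $ j + fst h * K2 \<theta> $ j + x * g \<theta> $ j * snd (snd h),
         snd (snd h)))"
    note th = bounds(4)[OF dom]
    have D\<Lambda>: "(\<Lambda> has_derivative D\<Lambda>) (at ?p)"
      unfolding \<Lambda>_def D\<Lambda>_def by (rule averaging_map_has_derivative[OF K1(3)[OF th] K2der[OF th]])
    have "fst (\<Lambda> ?p) \<noteq> 0" using x bounds(3)[OF dom] by (simp add: \<Lambda>_eq)
    then obtain D where D: "(\<Psi> has_derivative D) (at (\<Lambda> ?p))" "inj D"
        "D (G (\<Lambda> ?p) *\<^sub>C averaged_form m f g A B l (\<Lambda> ?p)) = X (\<Psi> (\<Lambda> ?p))"
      using chart' bounds(1)[OF dom] by blast
    have lin: "linear D\<Lambda>" using D\<Lambda> has_derivative_linear by blast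
    have inj: "inj D\<Lambda>"
      unfolding linear_injective_0[OF lin]
    proof (intro allI impI)
      fix h assume h0: "D\<Lambda> h = 0"
      obtain hx hy ht where h: "h = (hx, hy, ht)" by (cases h) auto
      have ht: "ht = 0" using h0 by (simp add: D\<Lambda>_def h zero_prod_def)
      have hy: "hy = - hx *\<^sub>C K2 \<theta>"
        using h0 by (simp add: D\<Lambda>_def h ht zero_prod_def vec_eq_iff scaleC_vec_def scaleC_complex_def eq_neg_iff_add_eq_0)
      have "cdot k hy = - hx * cdot k (K2 \<theta>)"
        by (simp add: hy cdot_def scaleC_vec_def scaleC_complex_def sum_distrib_left sum_negf[symmetric] ac_simps)
      then have "hx * \<Delta> ?p = 0"
        using h0 by (simp add: D\<Lambda>_def h ht zero_prod_def \<Delta>_def algebra_simps)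
      then have "hx = 0" using bounds(2)[OF dom] by simp
      then show "h = 0" by (simp add: h ht hy zero_prod_def)
    qed
    define z where "z = (\<chi> j. y $ j + x * K2 \<theta> $ j)"
    let ?S = "S ?p"
    have push: "D\<Lambda> (NF F0 l F1 G1 ?p) = averaged_form m f g A B l (\<Lambda> ?p)"
    proof -
      define Xd where "Xd = x\<^sup>2 * P ?p"
      define Yd where "Yd = (\<chi> j. x * (- of_real (l $ j) * y $ j + x * G1 ?p $ j))"
      have NF_eq: "NF F0 l F1 G1 ?p = (Xd, Yd, 1)"
        by (simp add: NF_def Xd_def Yd_def P_def diag_matrix_mult vec_eq_iff algebra_simps)
      have Yd: "Yd $ j + Xd * K2 \<theta> $ j + x * g \<theta> $ j
          = x * ?S * (- of_real (l $ j) * z $ j + g \<theta> $ j + x * ?S * B (\<Lambda> ?p) $ j)" for j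
      proof -
        have "x * (- of_real (l $ j) * y $ j + x * G1 ?p $ j) + Xd * K2 \<theta> $ j + x * g \<theta> $ j
            = x * ?S * (- of_real (l $ j) * (y $ j + x * K2 \<theta> $ j) + g \<theta> $ j + x * ?S * B (\<Lambda> ?p) $ j)"
          by (rule transversal_identity[where T="T ?p" and P="P ?p"]) (simp_all add: S_def Xd_def G1_def)
        then show ?thesis by (simp add: Yd_def z_def)
      qed
      have kYd: "cdot k Yd = x * ?S * (cdot m z + cdot k (g \<theta>) + x * ?S * cdot k (B (\<Lambda> ?p)))
          - Xd * cdot k (K2 \<theta>) - x * cdot k (g \<theta>)"
      proof -
        have "k $ j * Yd $ j = x * ?S * (m $ j * z $ j + k $ j * g \<theta> $ j + x * ?S * (k $ j * B (\<Lambda> ?p) $ j))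
            - Xd * (k $ j * K2 \<theta> $ j) - x * (k $ j * g \<theta> $ j)" for j
        proof -
          have Yd_j: "Yd $ j = x * ?S * (- of_real (l $ j) * z $ j + g \<theta> $ j + x * ?S * B (\<Lambda> ?p) $ j)
              - Xd * K2 \<theta> $ j - x * g \<theta> $ j"
            using Yd[of j] by (simp add: eq_diff_eq ac_simps)
          have "k $ j * Yd $ j = x * ?S * (- (k $ j * of_real (l $ j)) * z $ j + k $ j * g \<theta> $ j + x * ?S * (k $ j * B (\<Lambda> ?p) $ j))
              - Xd * (k $ j * K2 \<theta> $ j) - x * (k $ j * g \<theta> $ j)"
            unfolding Yd_j by (simp add: algebra_simps)
          then show ?thesis by (simp add: kl)
        qed
        then show ?thesis
          by (simp add: cdot_def sum.distrib sum_subtractf flip: sum_distrib_left)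
      qed
      have "Xd * (1 + 2 * x * cdot k y + 3 * x\<^sup>2 * K1 \<theta>)
          + x\<^sup>2 * (x * ?S * (cdot m z + cdot k (g \<theta>) + x * ?S * cdot k (B (\<Lambda> ?p)))
              - Xd * cdot k (K2 \<theta>) - x * cdot k (g \<theta>)) + x ^ 3 * (f \<theta> - F0)
          = (x * ?S)\<^sup>2 * (1 + x * ?S * (cdot m z + f \<theta>) + (x * ?S)\<^sup>2 * A (\<Lambda> ?p))"
        by (rule radial_identity[where T="T ?p" and \<Delta>="\<Delta> ?p" and E="E ?p" and ?F1.0="F1 ?p"])
          (use bounds(2)[OF dom] in \<open>simp_all add: S_def T_def \<Delta>_def F1_def Xd_def P_def E_def \<Lambda>_eq z_def\<close>)
      then have 1: "Xd * (1 + 2 * x * cdot k y + 3 * x\<^sup>2 * K1 \<theta>) + x\<^sup>2 * cdot k Yd + x ^ 3 * (f \<theta> - F0)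
          = (x * ?S)\<^sup>2 * (1 + x * ?S * (cdot m z + f \<theta>) + (x * ?S)\<^sup>2 * A (\<Lambda> ?p))"
        by (simp add: kYd)
      have \<Lambda>p: "\<Lambda> ?p = (x * ?S, z, \<theta>)" by (simp add: \<Lambda>_eq z_def)
      show ?thesis
        unfolding NF_eq D\<Lambda>_def averaged_form_def using 1 Yd
        by (simp add: \<Lambda>p vec_eq_iff)
    qed
    have scale: "D\<Lambda> (c *\<^sub>C h) = c *\<^sub>C D\<Lambda> h" for c h
      by (rule analytic_map_on_has_derivative_scaleC[OF \<Lambda>_ana dom D\<Lambda>])
    show ?thesis
    proof (intro exI[of _ "\<lambda>h. D (D\<Lambda> h)"] conjI)
      show "((\<lambda>p. \<Psi> (\<Lambda> p)) has_derivative (\<lambda>h. D (D\<Lambda> h))) (at ?p)"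
        by (rule has_derivative_compose[OF D\<Lambda> D(1)])
      show "inj (\<lambda>h. D (D\<Lambda> h))" using inj_compose[OF D(2) inj] by (simp add: comp_def)
      show "D (D\<Lambda> (G (\<Lambda> ?p) *\<^sub>C NF F0 l F1 G1 ?p)) = X (\<Psi> (\<Lambda> ?p))"
        by (simp add: scale push D(3))
    qed
  qed
  have "blowup_chart \<kappa>' \<zeta>' W X (\<lambda>p. \<Psi> (\<Lambda> p)) (\<lambda>p. G (\<Lambda> p)) (NF F0 l F1 G1)"
    unfolding blowup_chart_def
  proof (intro conjI)
    show "analytic_on_BBT \<kappa>' \<zeta>' (\<lambda>p. \<Psi> (\<Lambda> p))" "analytic_on_BBT \<kappa>' \<zeta>' (\<lambda>p. G (\<Lambda> p))"
      using chart' by (blast intro: comp_BBT)+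
    show "(\<lambda>p. \<Psi> (\<Lambda> p)) ` BBT \<kappa>' \<zeta>' \<subseteq> W" using chart' \<Lambda>_in by blast
    show "\<forall>y \<theta>. (0, y, \<theta>) \<in> BBT \<kappa>' \<zeta>' \<longrightarrow> \<Psi> (\<Lambda> (0, y, \<theta>)) = 0"
    proof (intro allI impI)
      fix y :: "complex ^ 'n" and \<theta> assume "(0, y, \<theta>) \<in> BBT \<kappa>' \<zeta>'"
      from bounds(1)[OF this] chart' show "\<Psi> (\<Lambda> (0, y, \<theta>)) = 0" by (simp add: \<Lambda>_eq)
    qed
    show "\<forall>p\<in>BBT \<kappa>' \<zeta>'. G (\<Lambda> p) \<noteq> 0" using chart' \<Lambda>_in by blast
    show "\<forall>p\<in>BBT \<kappa>' \<zeta>'. fst p \<noteq> 0 \<longrightarrow> (\<exists>D. ((\<lambda>p. \<Psi> (\<Lambda> p)) has_derivative D) (at p) \<and> inj D \<and>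
        D (G (\<Lambda> p) *\<^sub>C NF F0 l F1 G1 p) = X (\<Psi> (\<Lambda> p)))"
      using main by auto
  qed
  from blowup_to_NFI[OF this \<kappa>'(1) \<zeta>'(1) pos(3) F1_BBT G1_BBT dim] show ?thesis .
qed

section \<open>Trigonometric functions and explicit vectors\<close>

lemma has_derivative_chain_field:
  assumes "(f has_field_derivative d) (at (g x))" "(g has_derivative g') (at x)"
  shows "((\<lambda>x. f (g x)) has_derivative (\<lambda>h. d * g' h)) (at x)"
  using has_derivative_compose[OF assms(2)] assms(1) by (simp add: has_field_derivative_def)

lemma cos_sin_shift:
  fixes \<theta> :: complex
  shows "cos (\<theta> + 2 * of_real pi) = cos \<theta>" "sin (\<theta> + 2 * of_real pi) = sin \<theta>"
proof -
  have "cos (2 * complex_of_real pi) = 1" "sin (2 * complex_of_real pi) = 0"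
    using cos_of_real[of "2 * pi", where 'a=complex] sin_of_real[of "2 * pi", where 'a=complex] by simp_all
  then show "cos (\<theta> + 2 * of_real pi) = cos \<theta>" "sin (\<theta> + 2 * of_real pi) = sin \<theta>"
    by (simp_all add: cos_add sin_add)
qed

lemma cos_sin_bounded_on_strip:
  obtains M where "M \<ge> 0" "\<And>\<theta>. \<theta> \<in> strip \<zeta> \<Longrightarrow> norm (cos \<theta>) \<le> M" "\<And>\<theta>. \<theta> \<in> strip \<zeta> \<Longrightarrow> norm (sin \<theta>) \<le> M"
proof -
  obtain M1 where "M1 \<ge> 0" "\<And>\<theta>. \<theta> \<in> strip \<zeta> \<Longrightarrow> norm (cos \<theta>) \<le> M1"
    by (rule periodic_imp_bounded[where \<zeta>="\<zeta> + 1" and \<zeta>'=\<zeta> and K=cos])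
      (auto intro!: continuous_intros simp: cos_sin_shift)
  moreover obtain M2 where "M2 \<ge> 0" "\<And>\<theta>. \<theta> \<in> strip \<zeta> \<Longrightarrow> norm (sin \<theta>) \<le> M2"
    by (rule periodic_imp_bounded[where \<zeta>="\<zeta> + 1" and \<zeta>'=\<zeta> and K=sin])
      (auto intro!: continuous_intros simp: cos_sin_shift)
  ultimately show ?thesis by (intro that[of "max M1 M2"]) (auto simp: le_max_iff_disj)
qed

lemma has_derivative_vector_3:
  assumes "(f1 has_derivative d1) F" "(f2 has_derivative d2) F" "(f3 has_derivative d3) F"
  shows "((\<lambda>p. vector [f1 p, f2 p, f3 p] :: complex ^ 3) has_derivative (\<lambda>h. vector [d1 h, d2 h, d3 h])) F"
proof -
  have "((\<lambda>p. \<chi> i. (vector [f1 p, f2 p, f3 p] :: complex ^ 3) $ i) has_derivative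
      (\<lambda>h. \<chi> i. (vector [d1 h, d2 h, d3 h] :: complex ^ 3) $ i)) F"
  proof (rule has_derivative_vec)
    fix i :: 3
    show "((\<lambda>p. (vector [f1 p, f2 p, f3 p] :: complex ^ 3) $ i) has_derivative
        (\<lambda>h. (vector [d1 h, d2 h, d3 h] :: complex ^ 3) $ i)) F"
      using exhaust_3[of i] assms by auto
  qed
  then show ?thesis by simp
qed

lemma vector_4 [simp]:
  "(vector [x, y, z, w] :: ('a::zero) ^ 4) $ 1 = x"
  "(vector [x, y, z, w] :: ('a::zero) ^ 4) $ 2 = y"
  "(vector [x, y, z, w] :: ('a::zero) ^ 4) $ 3 = z"
  "(vector [x, y, z, w] :: ('a::zero) ^ 4) $ 4 = w"
  unfolding vector_def by simp_all

lemma has_derivative_vector_4: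
  assumes "(f1 has_derivative d1) F" "(f2 has_derivative d2) F" "(f3 has_derivative d3) F" "(f4 has_derivative d4) F"
  shows "((\<lambda>p. vector [f1 p, f2 p, f3 p, f4 p] :: complex ^ 4) has_derivative (\<lambda>h. vector [d1 h, d2 h, d3 h, d4 h])) F"
proof -
  have "((\<lambda>p. \<chi> i. (vector [f1 p, f2 p, f3 p, f4 p] :: complex ^ 4) $ i) has_derivative
      (\<lambda>h. \<chi> i. (vector [d1 h, d2 h, d3 h, d4 h] :: complex ^ 4) $ i)) F"
  proof (rule has_derivative_vec)
    fix i :: 4
    show "((\<lambda>p. (vector [f1 p, f2 p, f3 p, f4 p] :: complex ^ 4) $ i) has_derivative
        (\<lambda>h. (vector [d1 h, d2 h, d3 h, d4 h] :: complex ^ 4) $ i)) F"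
      using exhaust_4[of i] assms by auto
  qed
  then show ?thesis by simp
qed

lemma analytic_map_on_vector_3 [analytic_map_intros]:
  assumes "f1 analytic_map_on S" "f2 analytic_map_on S" "f3 analytic_map_on S"
  shows "(\<lambda>p. vector [f1 p, f2 p, f3 p] :: complex ^ 3) analytic_map_on S"
proof (rule analytic_map_on_componentwise)
  fix i :: 3
  show "(\<lambda>p. (vector [f1 p, f2 p, f3 p] :: complex ^ 3) $ i) analytic_map_on S"
    using exhaust_3[of i] assms by auto
qed

lemma analytic_map_on_vector_4 [analytic_map_intros]:
  assumes "f1 analytic_map_on S" "f2 analytic_map_on S" "f3 analytic_map_on S" "f4 analytic_map_on S"
  shows "(\<lambda>p. vector [f1 p, f2 p, f3 p, f4 p] :: complex ^ 4) analytic_map_on S"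
proof (rule analytic_map_on_componentwise)
  fix i :: 4
  show "(\<lambda>p. (vector [f1 p, f2 p, f3 p, f4 p] :: complex ^ 4) $ i) analytic_map_on S"
    using exhaust_4[of i] assms by auto
qed

lemma norm_vector_3_le: "norm (vector [x, y, z] :: complex ^ 3) \<le> norm x + norm y + norm z"
proof -
  have "norm (vector [x, y, z] :: complex ^ 3) \<le> (\<Sum>i\<in>UNIV. norm ((vector [x, y, z] :: complex ^ 3) $ i))"
    unfolding norm_vec_def by (rule L2_set_le_sum) simp
  then show ?thesis by (simp add: sum_3)
qed

lemma norm_vector_4_le: "norm (vector [x, y, z, w] :: complex ^ 4) \<le> norm x + norm y + norm z + norm w"
proof -
  have "norm (vector [x, y, z, w] :: complex ^ 4) \<le> (\<Sum>i\<in>UNIV. norm ((vector [x, y, z, w] :: complex ^ 4) $ i))"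
    unfolding norm_vec_def by (rule L2_set_le_sum) simp
  then show ?thesis by (simp add: sum_4)
qed

section \<open>The zero-Hopf system\<close>

text \<open>
  The pushforward of the blown-up vector field \<open>(hs, hz, ht)\<close> under the polar chart
  \<open>(s, z, \<theta>) \<mapsto> s * \<sigma> * (\<xi>, cos \<theta>, sin \<theta>)\<close> with \<open>\<xi> = \<xi>0 + s * e\<close>. The values \<open>F\<close>, \<open>G\<close>, \<open>H\<close> are
  the higher order terms after division by \<open>s ^ 3\<close>. \<open>N\<close> is the radial and \<open>C\<close>, up to the factor
  \<open>\<tau>\<close>, the angular component of \<open>(G, H)\<close>. The equation for \<open>\<xi>0\<close> removes the \<open>s\<close>-term of \<open>\<xi>'\<close>.
\<close>
lemma zero_hopf_identity:
  fixes sn cs \<sigma> \<tau> b a \<xi>0 \<xi> s e N C F G H l :: complex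
  assumes "sn\<^sup>2 + cs\<^sup>2 = 1" "\<sigma> * \<tau> = 1" "\<tau> = b * \<xi>0" "(1 + b) * \<xi>0\<^sup>2 = - a" "\<xi> = \<xi>0 + s * e"
    and "N = cs * G + sn * H" "C = \<tau> * (cs * H - sn * G)" "l = 2 * (1 + b) * \<sigma> * \<xi>0 + 1"
    and "hs = s\<^sup>2 * (1 + s * (b * \<sigma> * e + \<tau> * N))"
    and "hz = s * (- l * e + \<tau> * (F - \<xi> * N) + s * (- \<sigma> * (1 + b) * e\<^sup>2 - (b * \<sigma> * e + \<tau> * N) * e))"
    and "ht = 1 + s\<^sup>2 * C"
  shows "\<sigma> * (\<xi> + s * e) * hs + \<sigma> * s\<^sup>2 * hz = - (s * (\<sigma> * \<xi>))\<^sup>2 - a * ((s * (\<sigma> * cs))\<^sup>2 + (s * (\<sigma> * sn))\<^sup>2) + s ^ 3 * F"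
    and "\<sigma> * (cs * hs - s * sn * ht) = b * (s * (\<sigma> * \<xi>)) * (s * (\<sigma> * cs)) - s * (\<sigma> * sn) + s ^ 3 * G"
    and "\<sigma> * (sn * hs + s * cs * ht) = b * (s * (\<sigma> * \<xi>)) * (s * (\<sigma> * sn)) + s * (\<sigma> * cs) + s ^ 3 * H"
proof -
  have st: "b * \<sigma> * \<xi>0 = 1" using assms(2,3) by (simp add: ac_simps)
  show "\<sigma> * (\<xi> + s * e) * hs + \<sigma> * s\<^sup>2 * hz = - (s * (\<sigma> * \<xi>))\<^sup>2 - a * ((s * (\<sigma> * cs))\<^sup>2 + (s * (\<sigma> * sn))\<^sup>2) + s ^ 3 * F"
    using assms(1,2,4) st unfolding assms(5,8,9,10) by algebra
  show "\<sigma> * (cs * hs - s * sn * ht) = b * (s * (\<sigma> * \<xi>)) * (s * (\<sigma> * cs)) - s * (\<sigma> * sn) + s ^ 3 * G"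
    using assms(1,2) st unfolding assms(5,6,7,9,11) by algebra
  show "\<sigma> * (sn * hs + s * cs * ht) = b * (s * (\<sigma> * \<xi>)) * (s * (\<sigma> * sn)) + s * (\<sigma> * cs) + s ^ 3 * H"
    using assms(1,2) st unfolding assms(5,6,7,9,11) by algebra
qed

text \<open>
  With \<open>x = r * \<xi>\<close>, \<open>y = r * cos \<theta>\<close>, \<open>z = r * sin \<theta>\<close> the quadratic terms give
  \<open>r' = b * \<xi> * r ^ 2\<close> and \<open>\<xi>' = - r * ((1 + b) * \<xi> ^ 2 + a)\<close>. The chart is centered at a zero
  \<open>\<xi>0\<close> of the last bracket, with \<open>r = \<sigma> * s\<close> normalized such that \<open>s' = s ^ 2\<close> to leading order. The
  linearization in \<open>\<xi> - \<xi>0\<close> has the rate \<open>2 * (1 + b) / b\<close> in units of \<open>s\<close>, and the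
  division of \<open>\<xi> - \<xi>0\<close> by \<open>s\<close> adds 1 to it.
\<close>
theorem zero_hopf_blowup_to_NF:
  fixes a b :: real and F G H :: "complex ^ 3 \<Rightarrow> complex"
  assumes a: "a \<noteq> 0" and b: "b \<notin> {-1..0}" and W: "open W" "0 \<in> W"
    and ana: "real_analytic_near_0 F" "real_analytic_near_0 G" "real_analytic_near_0 H"
    and van: "vanishes_to_order 3 F" "vanishes_to_order 3 G" "vanishes_to_order 3 H"
  shows "blowup_to_NF TYPE(1) W (zero_hopf a b F G H)"
proof -
  define B :: complex where "B = of_real b"
  have B: "B \<noteq> 0" "1 + B \<noteq> 0"
  proof -
    show "B \<noteq> 0" using b by (auto simp: B_def)
    have "complex_of_real (1 + b) \<noteq> 0" using b by (simp only: of_real_eq_0_iff) auto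
    then show "1 + B \<noteq> 0" by (simp add: B_def)
  qed
  define \<xi>0 where "\<xi>0 = csqrt (- of_real a / (1 + B))"
  have \<xi>0_sq: "(1 + B) * \<xi>0\<^sup>2 = - of_real a" using B by (simp add: \<xi>0_def)
  then have \<xi>0: "\<xi>0 \<noteq> 0" using a by auto
  define \<tau> where "\<tau> = B * \<xi>0"
  define \<sigma> where "\<sigma> = 1 / \<tau>"
  have \<tau>: "\<tau> \<noteq> 0" using B \<xi>0 by (simp add: \<tau>_def)
  have \<sigma>\<tau>: "\<sigma> * \<tau> = 1" and \<sigma>: "\<sigma> \<noteq> 0" using \<tau> by (simp_all add: \<sigma>_def)
  define l where "l = 2 * ((1 + b) / b) + 1"
  have l: "l > 0"
  proof -
    have "(1 + b) / b > 0" using b by (auto simp: divide_simps not_le)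
    then show ?thesis unfolding l_def by linarith
  qed
  have l_eq: "of_real l = 2 * (1 + B) * \<sigma> * \<xi>0 + 1"
    using B \<xi>0 by (simp add: l_def \<sigma>_def \<tau>_def B_def divide_simps)

  obtain Bc where Bc: "Bc \<ge> 0" "\<And>\<theta>. \<theta> \<in> strip 1 \<Longrightarrow> norm (cos \<theta>) \<le> Bc" "\<And>\<theta>. \<theta> \<in> strip 1 \<Longrightarrow> norm (sin \<theta>) \<le> Bc"
    by (rule cos_sin_bounded_on_strip[of 1]) (rule that; assumption)
  define R where "R = norm \<sigma> * (norm \<xi>0 + 1) + 2 * (norm \<sigma> * Bc) + 1"
  have R: "R > 0" using Bc(1) by (simp add: R_def add_nonneg_pos)
  obtain \<delta>F \<Phi>F MF where \<Phi>F: "\<delta>F > 0" "\<Phi>F analytic_map_on ball 0 \<delta>F \<times> ball 0 R"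
      "\<And>s w. s \<in> ball 0 \<delta>F \<Longrightarrow> w \<in> ball 0 R \<Longrightarrow> F (s *\<^sub>C w) = s ^ 3 * \<Phi>F (s, w)"
      "\<And>s w. s \<in> ball 0 \<delta>F \<Longrightarrow> w \<in> ball 0 R \<Longrightarrow> norm (\<Phi>F (s, w)) \<le> MF"
    by (rule analytic_scaling_quotient[OF ana(1) van(1) R]) (rule that; assumption)
  obtain \<delta>G \<Phi>G MG where \<Phi>G: "\<delta>G > 0" "\<Phi>G analytic_map_on ball 0 \<delta>G \<times> ball 0 R"
      "\<And>s w. s \<in> ball 0 \<delta>G \<Longrightarrow> w \<in> ball 0 R \<Longrightarrow> G (s *\<^sub>C w) = s ^ 3 * \<Phi>G (s, w)"
      "\<And>s w. s \<in> ball 0 \<delta>G \<Longrightarrow> w \<in> ball 0 R \<Longrightarrow> norm (\<Phi>G (s, w)) \<le> MG"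
    by (rule analytic_scaling_quotient[OF ana(2) van(2) R]) (rule that; assumption)
  obtain \<delta>H \<Phi>H MH where \<Phi>H: "\<delta>H > 0" "\<Phi>H analytic_map_on ball 0 \<delta>H \<times> ball 0 R"
      "\<And>s w. s \<in> ball 0 \<delta>H \<Longrightarrow> w \<in> ball 0 R \<Longrightarrow> H (s *\<^sub>C w) = s ^ 3 * \<Phi>H (s, w)"
      "\<And>s w. s \<in> ball 0 \<delta>H \<Longrightarrow> w \<in> ball 0 R \<Longrightarrow> norm (\<Phi>H (s, w)) \<le> MH"
    by (rule analytic_scaling_quotient[OF ana(3) van(3) R]) (rule that; assumption)

  define w0 where "w0 \<theta> = (vector [\<sigma> * \<xi>0, \<sigma> * cos \<theta>, \<sigma> * sin \<theta>] :: complex ^ 3)" for \<theta>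
  have trig_le: "norm (\<sigma> * cos \<theta>) \<le> norm \<sigma> * Bc" "norm (\<sigma> * sin \<theta>) \<le> norm \<sigma> * Bc" if "\<theta> \<in> strip 1" for \<theta>
    using Bc(2,3)[OF that] by (auto simp: norm_mult intro: mult_left_mono)
  have w_ball: "vector [\<sigma> * (\<xi>0 + \<epsilon>), \<sigma> * cos \<theta>, \<sigma> * sin \<theta>] \<in> ball (0 :: complex ^ 3) R"
    if "norm \<epsilon> \<le> 1" "\<theta> \<in> strip 1" for \<epsilon> \<theta>
  proof -
    have "norm (\<sigma> * (\<xi>0 + \<epsilon>)) \<le> norm \<sigma> * (norm \<xi>0 + 1)"
      using norm_triangle_mono[OF order_refl that(1)] by (auto simp: norm_mult intro: mult_left_mono)
    then have "norm (vector [\<sigma> * (\<xi>0 + \<epsilon>), \<sigma> * cos \<theta>, \<sigma> * sin \<theta>] :: complex ^ 3) < R"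
      using norm_vector_3_le[of "\<sigma> * (\<xi>0 + \<epsilon>)" "\<sigma> * cos \<theta>" "\<sigma> * sin \<theta>"] trig_le[OF that(2)]
      unfolding R_def by linarith
    then show ?thesis by simp
  qed
  have w0_ball: "w0 \<theta> \<in> ball 0 R" if "\<theta> \<in> strip 1" for \<theta>
    using w_ball[of 0 \<theta>] that by (simp add: w0_def)
  have w0_hol: "(\<lambda>\<theta>. \<Phi> (0, w0 \<theta>)) holomorphic_on strip 1"
    if "\<delta> > 0" "\<Phi> analytic_map_on ball 0 \<delta> \<times> ball 0 R" for \<delta> and \<Phi> :: "complex \<times> (complex ^ 3) \<Rightarrow> complex"
  proof (rule analytic_map_on_imp_holomorphic[OF _ open_strip])
    show "(\<lambda>\<theta>. \<Phi> (0, w0 \<theta>)) analytic_map_on strip 1"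
      using that(1) w0_ball unfolding w0_def
      by (intro analytic_map_on_compose[OF that(2)] analytic_map_intros) auto
  qed
  have w0_shift: "w0 (\<theta> + 2 * of_real pi) = w0 \<theta>" for \<theta> by (simp add: w0_def cos_sin_shift)
  \<comment> \<open>The cubic terms restricted to the center of the chart, in radial and transversal direction.\<close>
  define N0 where "N0 \<theta> = cos \<theta> * \<Phi>G (0, w0 \<theta>) + sin \<theta> * \<Phi>H (0, w0 \<theta>)" for \<theta>
  have N0_hol: "N0 holomorphic_on strip 1"
    unfolding N0_def by (intro holomorphic_intros w0_hol[OF \<Phi>G(1,2)] w0_hol[OF \<Phi>H(1,2)])
  have N0_shift: "N0 (\<theta> + 2 * of_real pi) = N0 \<theta>" for \<theta> by (simp add: N0_def w0_shift cos_sin_shift)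
  define g0 where "g0 \<theta> = \<tau> * (\<Phi>F (0, w0 \<theta>) - \<xi>0 * N0 \<theta>)" for \<theta>
  have g0_hol: "g0 holomorphic_on strip 1"
    unfolding g0_def by (intro holomorphic_intros w0_hol[OF \<Phi>F(1,2)] N0_hol)
  have g0_shift: "g0 (\<theta> + 2 * of_real pi) = g0 \<theta>" for \<theta> by (simp add: g0_def w0_shift N0_shift)
  obtain K c0 where K: "K holomorphic_on strip 1"
      "\<And>\<theta>. \<theta> \<in> strip 1 \<Longrightarrow> K (\<theta> + 2 * of_real pi) = K \<theta>"
      "\<And>\<theta>. \<theta> \<in> strip 1 \<Longrightarrow> (K has_field_derivative g0 \<theta> - c0) (at \<theta>)"
    by (rule periodic_primitive_minus_mean[OF g0_hol g0_shift]) (assumption | (rule that; assumption))+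
  \<comment> \<open>A shift of the chart by \<open>c\<close> changes the forcing term by \<open>- l * c\<close>, which removes its mean value.\<close>
  define c where "c = c0 / of_real l"
  have c: "of_real l * c = c0" using l by (simp add: c_def)

  obtain r0 where r0: "r0 > 0" "ball 0 r0 \<subseteq> W" using W open_contains_ball by blast
  define M where "M = norm \<tau> * (Bc * \<bar>MH\<bar> + Bc * \<bar>MG\<bar>)"
  have M: "M \<ge> 0" using Bc(1) by (simp add: M_def)
  define Bounds where "Bounds = {1, \<delta>F, \<delta>G, \<delta>H, 1 / (norm c + 1), r0 / R, 1 / (2 * (M + 1))}"
  define \<kappa> where "\<kappa> = Min Bounds"
  have \<kappa>: "\<kappa> > 0"
    using \<Phi>F(1) \<Phi>G(1) \<Phi>H(1) r0(1) R M by (simp add: \<kappa>_def Bounds_def add_nonneg_pos)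
  have \<kappa>_Min: "\<kappa> \<le> t" if "t \<in> Bounds" for t
    unfolding \<kappa>_def using that by (intro Min_le) (simp add: Bounds_def)
  have \<kappa>_le: "\<kappa> \<le> 1" "\<kappa> \<le> \<delta>F" "\<kappa> \<le> \<delta>G" "\<kappa> \<le> \<delta>H"
    by (rule \<kappa>_Min; simp add: Bounds_def)+
  have "\<kappa> \<le> 1 / (norm c + 1)" "\<kappa> \<le> r0 / R" "\<kappa> \<le> 1 / (2 * (M + 1))"
    by (rule \<kappa>_Min; simp add: Bounds_def)+
  then have \<kappa>_mult: "\<kappa> * (norm c + 1) \<le> 1" "\<kappa> * R \<le> r0" "\<kappa> * (M + 1) \<le> 1 / 2"
  proof -
    have "norm c + 1 > 0" using norm_ge_zero[of c] by linarith
    then show "\<kappa> * (norm c + 1) \<le> 1" using \<open>\<kappa> \<le> 1 / (norm c + 1)\<close> by (simp only: pos_le_divide_eq)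
    show "\<kappa> * R \<le> r0" using \<open>\<kappa> \<le> r0 / R\<close> R by (simp only: pos_le_divide_eq)
    show "\<kappa> * (M + 1) \<le> 1 / 2" using \<open>\<kappa> \<le> 1 / (2 * (M + 1))\<close> M by (simp add: field_simps)
  qed

  define e where "e p = c + fst (snd p) $ 1" for p :: "complex \<times> (complex ^ 1) \<times> complex"
  define \<xi> where "\<xi> p = \<xi>0 + fst p * e p" for p
  define w where "w p = (vector [\<sigma> * \<xi> p, \<sigma> * cos (snd (snd p)), \<sigma> * sin (snd (snd p))] :: complex ^ 3)" for p
  define \<Psi> where "\<Psi> p = fst p *\<^sub>C w p" for p
  have dom: "norm s < \<kappa>" "norm (s * e (s, z, \<theta>)) \<le> 1" "\<theta> \<in> strip 1" "w (s, z, \<theta>) \<in> ball 0 R"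
      "s \<in> ball 0 \<delta>F" "s \<in> ball 0 \<delta>G" "s \<in> ball 0 \<delta>H"
    if p: "(s, z, \<theta>) \<in> BBT \<kappa> 1" for s \<theta> and z :: "complex ^ 1"
  proof -
    show s: "norm s < \<kappa>" and th: "\<theta> \<in> strip 1" using p by (auto simp: BBT_eq)
    then show "s \<in> ball 0 \<delta>F" "s \<in> ball 0 \<delta>G" "s \<in> ball 0 \<delta>H" using \<kappa>_le by auto
    have "norm z < 1" using p \<kappa>_le(1) by (auto simp: BBT_eq)
    then have "norm (z $ 1) \<le> 1" using Finite_Cartesian_Product.norm_nth_le[of z 1] by linarith
    then have "norm (e (s, z, \<theta>)) \<le> norm c + 1"
      unfolding e_def using norm_triangle_ineq[of c "z $ 1"] by simp
    then have "norm (s * e (s, z, \<theta>)) \<le> \<kappa> * (norm c + 1)"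
      unfolding norm_mult using s \<kappa> by (intro mult_mono) auto
    then show e1: "norm (s * e (s, z, \<theta>)) \<le> 1" using \<kappa>_mult(1) by linarith
    show "w (s, z, \<theta>) \<in> ball 0 R"
      using w_ball[OF e1 th] by (simp add: w_def \<xi>_def)
  qed
  have w_ana: "w analytic_map_on BBT \<kappa> 1"
    unfolding w_def \<xi>_def e_def by (intro analytic_map_intros)
  have w_shift: "w (s, z, \<theta> + 2 * of_real pi) = w (s, z, \<theta>)" for s z \<theta>
    by (simp add: w_def \<xi>_def e_def cos_sin_shift)
  have hat: "analytic_on_BBT \<kappa> 1 (\<lambda>p. \<Phi> (fst p, w p))"
    if "\<Phi> analytic_map_on ball 0 \<delta> \<times> ball 0 R" "\<kappa> \<le> \<delta>"
    for \<Phi> :: "complex \<times> (complex ^ 3) \<Rightarrow> complex" and \<delta>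
  proof (rule analytic_on_BBTI)
    show "(\<lambda>p. \<Phi> (fst p, w p)) analytic_map_on BBT \<kappa> 1"
    proof (rule analytic_map_on_compose[OF that(1)])
      show "(\<lambda>p. (fst p, w p)) analytic_map_on BBT \<kappa> 1" by (intro analytic_map_intros w_ana)
      show "(\<lambda>p. (fst p, w p)) ` BBT \<kappa> 1 \<subseteq> ball 0 \<delta> \<times> ball 0 R"
      proof (rule image_subsetI)
        fix p :: "complex \<times> (complex ^ 1) \<times> complex" assume p: "p \<in> BBT \<kappa> 1"
        obtain s z \<theta> where "p = (s, z, \<theta>)" by (cases p)
        with dom(1,4)[of s z \<theta>] p that(2) show "(fst p, w p) \<in> ball 0 \<delta> \<times> ball 0 R" by simp
      qed
    qed
  qed (simp add: w_shift)
  have w_0: "w (0, z, \<theta>) = w0 \<theta>" for z \<theta> by (simp add: w_def \<xi>_def w0_def)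
  define Fh where "Fh p = \<Phi>F (fst p, w p)" for p
  define Gh where "Gh p = \<Phi>G (fst p, w p)" for p
  define Hh where "Hh p = \<Phi>H (fst p, w p)" for p
  have hats: "analytic_on_BBT \<kappa> 1 Fh" "analytic_on_BBT \<kappa> 1 Gh" "analytic_on_BBT \<kappa> 1 Hh"
    unfolding Fh_def Gh_def Hh_def
    by (rule hat[OF \<Phi>F(2) \<kappa>_le(2)] hat[OF \<Phi>G(2) \<kappa>_le(3)] hat[OF \<Phi>H(2) \<kappa>_le(4)])+
  obtain F1 where F1: "analytic_on_BBT \<kappa> 1 F1"
      "\<And>s z \<theta>. (s, z, \<theta>) \<in> BBT \<kappa> 1 \<Longrightarrow> Fh (s, z, \<theta>) = Fh (0, z, \<theta>) + s * F1 (s, z, \<theta>)"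
    by (rule analytic_on_BBT_Taylor1[OF hats(1) \<kappa>]) (rule that; assumption)
  define N where "N p = cos (snd (snd p)) * Gh p + sin (snd (snd p)) * Hh p" for p
  have N_BBT: "analytic_on_BBT \<kappa> 1 N"
    unfolding N_def
    by (intro analytic_on_BBTI analytic_map_intros hats[THEN analytic_on_BBTD(1)])
      (simp add: cos_sin_shift hats[THEN analytic_on_BBTD(2)])
  obtain N1 where N1: "analytic_on_BBT \<kappa> 1 N1"
      "\<And>s z \<theta>. (s, z, \<theta>) \<in> BBT \<kappa> 1 \<Longrightarrow> N (s, z, \<theta>) = N (0, z, \<theta>) + s * N1 (s, z, \<theta>)"
    by (rule analytic_on_BBT_Taylor1[OF N_BBT \<kappa>]) (rule that; assumption)
  define C where "C p = \<tau> * (cos (snd (snd p)) * Hh p - sin (snd (snd p)) * Gh p)" for p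
  \<comment> \<open>\<open>g\<close> is the angular velocity, the factor by which the normal form divides.\<close>
  define g where "g p = 1 + (fst p)\<^sup>2 * C p" for p
  note an = analytic_map_intros hats[THEN analytic_on_BBTD(1)] analytic_on_BBTD(1)[OF F1(1)]
    analytic_on_BBTD(1)[OF N1(1)] analytic_on_BBTD(1)[OF N_BBT]
  note per = cos_sin_shift hats[THEN analytic_on_BBTD(2)] analytic_on_BBTD(2)[OF F1(1)]
    analytic_on_BBTD(2)[OF N1(1)] analytic_on_BBTD(2)[OF N_BBT]
  have C_ana: "C analytic_map_on BBT \<kappa> 1" unfolding C_def by (intro an)
  have g_ana: "g analytic_map_on BBT \<kappa> 1" unfolding g_def by (intro analytic_map_intros C_ana)
  have C_shift: "C (s, z, \<theta> + 2 * of_real pi) = C (s, z, \<theta>)" if "(s, z, \<theta>) \<in> BBT \<kappa> 1" for s z \<theta>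
    by (simp add: C_def per that)
  have g_nz: "g p \<noteq> 0" if "p \<in> BBT \<kappa> 1" for p
  proof -
    obtain s z \<theta> where p: "p = (s, z, \<theta>)" by (cases p)
    note d = dom[OF that[unfolded p]]
    have "norm (Gh p) \<le> \<bar>MG\<bar>" "norm (Hh p) \<le> \<bar>MH\<bar>"
      using \<Phi>G(4)[OF d(6,4)] \<Phi>H(4)[OF d(7,4)] by (auto simp: Gh_def Hh_def p)
    then have "norm (cos \<theta> * Hh p - sin \<theta> * Gh p) \<le> Bc * \<bar>MH\<bar> + Bc * \<bar>MG\<bar>"
      using Bc(2,3)[OF d(3)] Bc(1)
      by (intro order_trans[OF norm_triangle_ineq4] add_mono) (auto simp: norm_mult intro!: mult_mono)
    then have C_le: "norm (C p) \<le> M + 1"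
      using mult_left_mono[of _ _ "norm \<tau>"] by (fastforce simp: C_def M_def p norm_mult)
    have "norm s * norm s \<le> \<kappa> * 1" using d(1) \<kappa> \<kappa>_le(1) by (intro mult_mono) auto
    then have "norm (s\<^sup>2 * C p) \<le> \<kappa> * (M + 1)"
      using C_le \<kappa> unfolding norm_mult norm_power power2_eq_square by (intro mult_mono) auto
    then have "norm (s\<^sup>2 * C p) \<le> 1 / 2" using \<kappa>_mult(3) by linarith
    then have "s\<^sup>2 * C p \<noteq> - 1" by auto
    then show ?thesis by (simp add: g_def p add_eq_0_iff)
  qed
  \<comment> \<open>Coefficients of the blown-up field after division by \<open>g\<close>; \<open>P + s * q\<close> is the \<open>z\<close>-component before it.\<close>
  define f where "f \<theta> = B * \<sigma> * c + \<tau> * N0 \<theta>" for \<theta>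
  define A where "A p = (\<tau> * N1 p - C p * (1 + fst p * (B * \<sigma> * fst (snd p) $ 1 + f (snd (snd p))))) / g p" for p
  define P where "P p = - of_real l * fst (snd p) $ 1 + (g0 (snd (snd p)) - c0)" for p :: "complex \<times> (complex ^ 1) \<times> complex"
  define q where "q p = \<tau> * (F1 p - \<xi>0 * N1 p - e p * N p) - \<sigma> * (1 + B) * (e p)\<^sup>2 - (B * \<sigma> * e p + \<tau> * N p) * e p" for p
  define B1 :: "complex \<times> (complex ^ 1) \<times> complex \<Rightarrow> complex ^ 1"
    where "B1 p = (\<chi> j. (q p - fst p * C p * P p) / g p)" for p
  have hol: "(\<lambda>p. h (snd (snd p))) analytic_map_on BBT \<kappa> 1" if "h holomorphic_on strip 1"
    for h and \<kappa> :: real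
    by (intro analytic_map_on_holomorphic_compose[OF that open_strip] analytic_map_intros) (auto simp: BBT_eq)
  have f_hol: "f holomorphic_on strip 1" unfolding f_def by (intro holomorphic_intros N0_hol)
  have f_shift: "f (\<theta> + 2 * of_real pi) = f \<theta>" for \<theta> by (simp add: f_def N0_shift)
  have A_BBT: "analytic_on_BBT \<kappa> 1 A"
  proof (rule analytic_on_BBTI)
    show "A analytic_map_on BBT \<kappa> 1"
      unfolding A_def using g_nz by (intro an C_ana g_ana hol[OF f_hol]) auto
    show "A (x, y, \<theta> + 2 * complex_of_real pi) = A (x, y, \<theta>)" if "(x, y, \<theta>) \<in> BBT \<kappa> 1" for x y \<theta>
      by (simp add: A_def g_def f_shift C_shift[OF that] per that)
  qed
  have B1_BBT: "analytic_on_BBT \<kappa> 1 B1"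
  proof (rule analytic_on_BBTI)
    show "B1 analytic_map_on BBT \<kappa> 1"
      unfolding B1_def q_def P_def e_def using g_nz by (intro an C_ana g_ana hol[OF g0_hol]) auto
    show "B1 (x, y, \<theta> + 2 * complex_of_real pi) = B1 (x, y, \<theta>)" if "(x, y, \<theta>) \<in> BBT \<kappa> 1" for x y \<theta>
      by (simp add: B1_def q_def P_def g_def e_def g0_shift C_shift[OF that] per that)
  qed

  let ?V = "averaged_form (\<chi> j. B * \<sigma>) f (\<lambda>\<theta>. \<chi> j. g0 \<theta> - c0) A B1 (\<chi> j. l)"
  have main: "\<exists>D. (\<Psi> has_derivative D) (at p) \<and> inj D \<and> D (g p *\<^sub>C ?V p) = zero_hopf a b F G H (\<Psi> p)"
    if p: "p \<in> BBT \<kappa> 1" "fst p \<noteq> 0" for p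
  proof -
    obtain s z \<theta> where psz: "p = (s, z, \<theta>)" by (cases p)
    have s: "s \<noteq> 0" using p(2) by (simp add: psz)
    note pB = p(1)[unfolded psz]
    note d = dom[OF pB]
    define cs where "cs = cos \<theta>"
    define sn where "sn = sin \<theta>"
    have cs_sn: "sn\<^sup>2 + cs\<^sup>2 = 1" by (simp add: cs_def sn_def)
    define D where "D = (\<lambda>h :: complex \<times> (complex ^ 1) \<times> complex. vector
      [\<sigma> * (\<xi> p + s * e p) * fst h + \<sigma> * s\<^sup>2 * fst (snd h) $ 1,
       \<sigma> * (cs * fst h - s * sn * snd (snd h)),
       \<sigma> * (sn * fst h + s * cs * snd (snd h))] :: complex ^ 3)"
    have \<Psi>_eq: "\<Psi> = (\<lambda>p. vector [fst p * (\<sigma> * (\<xi>0 + fst p * (c + fst (snd p) $ 1))),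
        fst p * (\<sigma> * cos (snd (snd p))), fst p * (\<sigma> * sin (snd (snd p)))])"
      by (simp add: fun_eq_iff \<Psi>_def w_def \<xi>_def e_def scaleC_vec_def scaleC_complex_def vec_eq_iff forall_3)
    have D: "(\<Psi> has_derivative D) (at p)"
    proof -
      have th: "((\<lambda>p :: complex \<times> (complex ^ 1) \<times> complex. snd (snd p)) has_derivative (\<lambda>h. snd (snd h))) (at p)"
        by (rule derivative_eq_intros refl)+
      have cos': "((\<lambda>p :: complex \<times> (complex ^ 1) \<times> complex. cos (snd (snd p))) has_derivative (\<lambda>h. - sn * snd (snd h))) (at p)"
        by (rule has_derivative_chain_field[OF _ th]) (simp add: psz sn_def)
      have sin': "((\<lambda>p :: complex \<times> (complex ^ 1) \<times> complex. sin (snd (snd p))) has_derivative (\<lambda>h. cs * snd (snd h))) (at p)"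
        by (rule has_derivative_chain_field[OF _ th]) (simp add: psz cs_def)
      have z': "((\<lambda>p :: complex \<times> (complex ^ 1) \<times> complex. fst (snd p) $ 1) has_derivative (\<lambda>h. fst (snd h) $ 1)) (at p)"
        by (rule bounded_linear.has_derivative[OF bounded_linear_vec_nth]) (rule derivative_eq_intros refl)+
      show ?thesis
        unfolding \<Psi>_eq D_def
      proof (intro has_derivative_vector_3)
        show "((\<lambda>p. fst p * (\<sigma> * (\<xi>0 + fst p * (c + fst (snd p) $ 1)))) has_derivative
          (\<lambda>h. \<sigma> * (\<xi> p + s * e p) * fst h + \<sigma> * s\<^sup>2 * fst (snd h) $ 1)) (at p)"
          by (rule derivative_eq_intros z' refl)+
            (simp add: fun_eq_iff psz \<xi>_def e_def algebra_simps power2_eq_square)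
        show "((\<lambda>p. fst p * (\<sigma> * cos (snd (snd p)))) has_derivative
          (\<lambda>h. \<sigma> * (cs * fst h - s * sn * snd (snd h)))) (at p)"
          by (rule derivative_eq_intros cos' refl)+
            (simp add: fun_eq_iff psz cs_def algebra_simps)
        show "((\<lambda>p. fst p * (\<sigma> * sin (snd (snd p)))) has_derivative
          (\<lambda>h. \<sigma> * (sn * fst h + s * cs * snd (snd h)))) (at p)"
          by (rule derivative_eq_intros sin' refl)+
            (simp add: fun_eq_iff psz sn_def algebra_simps)
      qed
    qed
    have linD: "linear D" using D has_derivative_linear by blast
    have inj: "inj D"
      unfolding linear_injective_0[OF linD]
    proof (intro allI impI)
      fix h assume h0: "D h = 0"
      obtain hs hz ht where h: "h = (hs, hz, ht)" by (cases h) auto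
      have 1: "\<sigma> * (\<xi> p + s * e p) * hs + \<sigma> * s\<^sup>2 * hz $ 1 = 0" "\<sigma> * (cs * hs - s * sn * ht) = 0"
          "\<sigma> * (sn * hs + s * cs * ht) = 0"
        using h0 unfolding D_def h by (simp_all only: vec_eq_iff forall_3 vector_3 zero_index fst_conv snd_conv)
      then have "cs * hs - s * sn * ht = 0" "sn * hs + s * cs * ht = 0" using \<sigma> by simp_all
      with cs_sn have "hs = 0" "s * ht = 0" by algebra+
      with 1(1) s \<sigma> show "h = 0" by (simp add: h zero_prod_def vec_eq_iff)
    qed
    have FGH: "F (\<Psi> p) = s ^ 3 * Fh p" "G (\<Psi> p) = s ^ 3 * Gh p" "H (\<Psi> p) = s ^ 3 * Hh p"
      using \<Phi>F(3)[OF d(5,4)] \<Phi>G(3)[OF d(6,4)] \<Phi>H(3)[OF d(7,4)]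
      by (simp_all add: \<Psi>_def Fh_def Gh_def Hh_def psz)
    have Fh0: "Fh p = \<Phi>F (0, w0 \<theta>) + s * F1 p"
      using F1(2)[OF pB] by (simp add: psz) (simp add: Fh_def w_0)
    have N0: "N p = N0 \<theta> + s * N1 p"
      using N1(2)[OF pB] by (simp add: psz) (simp add: N_def N0_def Gh_def Hh_def w_0)
    define hs where "hs = s\<^sup>2 * (1 + s * (B * \<sigma> * e p + \<tau> * N p))"
    define hz where "hz = s * (- of_real l * e p + \<tau> * (Fh p - \<xi> p * N p)
        + s * (- \<sigma> * (1 + B) * (e p)\<^sup>2 - (B * \<sigma> * e p + \<tau> * N p) * e p))"
    have e_p: "e p = c + z $ 1" by (simp add: e_def psz)
    have gV: "g p *\<^sub>C ?V p = (hs, \<chi> j. hz, 1 + s\<^sup>2 * C p)"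
    proof -
      have gA: "g p * A p = \<tau> * N1 p - C p * (1 + s * (B * \<sigma> * z $ 1 + f \<theta>))"
        using g_nz[OF p(1)] by (simp add: A_def psz)
      have gB: "g p * (B1 p $ j) = q p - s * C p * P p" for j
        using g_nz[OF p(1)] by (simp add: B1_def psz)
      have g: "g p = 1 + s\<^sup>2 * C p" by (simp add: g_def psz)
      have cd: "cdot (\<chi> j. B * \<sigma>) z = B * \<sigma> * z $ 1" by (simp add: cdot_def)
      have "g p * (s\<^sup>2 * (1 + s * (B * \<sigma> * z $ 1 + f \<theta>) + s\<^sup>2 * A p))
          = s\<^sup>2 * (g p * (1 + s * (B * \<sigma> * z $ 1 + f \<theta>)) + s\<^sup>2 * (g p * A p))"
        by (simp add: algebra_simps)
      also have "\<dots> = hs"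
        unfolding gA unfolding g hs_def N0 e_p f_def by algebra
      finally have 1: "g p * (s\<^sup>2 * (1 + s * (B * \<sigma> * z $ 1 + f \<theta>) + s\<^sup>2 * A p)) = hs" .
      have "g p * (s * (- of_real l * z $ 1 + (g0 \<theta> - c0) + s * B1 p $ 1))
          = s * (g p * P p + s * (g p * (B1 p $ 1)))"
        by (simp add: P_def psz algebra_simps)
      also have "\<dots> = s * (P p + s * q p)"
        unfolding gB unfolding g by algebra
      also have "P p = - of_real l * e p + \<tau> * (\<Phi>F (0, w0 \<theta>) - \<xi>0 * N0 \<theta>)"
        using c by (simp add: P_def g0_def psz e_def algebra_simps)
      also have "s * (- of_real l * e p + \<tau> * (\<Phi>F (0, w0 \<theta>) - \<xi>0 * N0 \<theta>) + s * q p) = hz"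
      proof -
        have \<xi>p: "\<xi> p = \<xi>0 + s * e p" by (simp add: \<xi>_def psz)
        show ?thesis unfolding hz_def q_def Fh0 \<xi>p N0 by algebra
      qed
      finally have 2: "g p * (s * (- of_real l * z $ 1 + (g0 \<theta> - c0) + s * B1 p $ 1)) = hz" .
      show ?thesis
        using 1 2 g by (simp add: averaged_form_def psz cd scaleC_prod_def scaleC_complex_def scaleC_vec_def vec_eq_iff)
    qed
    note id = zero_hopf_identity[OF cs_sn \<sigma>\<tau> \<tau>_def \<xi>0_sq, of "\<xi> p" s "e p" "N p" "Gh p" "Hh p" "C p" "of_real l" hs hz "Fh p" "1 + s\<^sup>2 * C p"]
    have prem: "\<xi> p = \<xi>0 + s * e p" "N p = cs * Gh p + sn * Hh p" "C p = \<tau> * (cs * Hh p - sn * Gh p)"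
      by (simp_all add: \<xi>_def N_def C_def psz cs_def sn_def)
    note id = id[OF prem l_eq hs_def hz_def refl]
    have \<Psi>p: "\<Psi> p $ 1 = s * (\<sigma> * \<xi> p)" "\<Psi> p $ 2 = s * (\<sigma> * cs)" "\<Psi> p $ 3 = s * (\<sigma> * sn)"
      by (simp_all add: \<Psi>_def w_def psz scaleC_vec_def scaleC_complex_def cs_def sn_def)
    have "D (g p *\<^sub>C ?V p) = zero_hopf a b F G H (\<Psi> p)"
      unfolding gV zero_hopf_def Let_def FGH \<Psi>p D_def using id
      by (simp add: B_def vec_eq_iff forall_3)
    with D inj show ?thesis by blast
  qed
  have chart: "blowup_chart \<kappa> 1 W (zero_hopf a b F G H) \<Psi> g ?V"
    unfolding blowup_chart_def
  proof (intro conjI)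
    show "analytic_on_BBT \<kappa> 1 \<Psi>"
      unfolding \<Psi>_def by (intro analytic_on_BBTI analytic_map_intros w_ana) (simp add: w_shift)
    show "\<Psi> ` BBT \<kappa> 1 \<subseteq> W"
    proof (rule image_subsetI)
      fix p :: "complex \<times> (complex ^ 1) \<times> complex" assume p: "p \<in> BBT \<kappa> 1"
      obtain s z \<theta> where psz: "p = (s, z, \<theta>)" by (cases p)
      note d = dom[OF p[unfolded psz]]
      have "norm s * norm (w (s, z, \<theta>)) < \<kappa> * R"
        using d(1,4) \<kappa> R by (intro mult_strict_mono) auto
      then have "norm (\<Psi> (s, z, \<theta>)) < r0" using \<kappa>_mult(2) by (simp add: \<Psi>_def norm_scaleC_vec)
      then show "\<Psi> p \<in> W" using r0(2) by (auto simp: psz)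
    qed
    show "\<forall>y \<theta>. (0, y, \<theta>) \<in> BBT \<kappa> 1 \<longrightarrow> \<Psi> (0, y, \<theta>) = 0" by (simp add: \<Psi>_def)
    show "analytic_on_BBT \<kappa> 1 g"
      by (intro analytic_on_BBTI g_ana) (simp add: g_def C_shift)
    show "\<forall>p\<in>BBT \<kappa> 1. g p \<noteq> 0" using g_nz by blast
  qed (use main in blast)
  have g0_per: "(\<chi> j. g0 (\<theta> + 2 * of_real pi) - c0) = ((\<chi> j. g0 \<theta> - c0) :: complex ^ 1)" for \<theta>
    by (simp add: g0_shift)
  show ?thesis
    by (rule blowup_to_NF_of_averaged_form[OF chart \<kappa> zero_less_one, where ?K2.0="\<lambda>\<theta>. \<chi> j. K \<theta>"])
      (simp_all add: l f_hol f_shift g0_shift g0_hol holomorphic_intros K A_BBT B1_BBT)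
qed

section \<open>The resonant Hopf-Hopf system\<close>

text \<open>
  The pushforward of the blown-up vector field \<open>(hs, (h1, h2), ht)\<close> under the chart of the next
  theorem. \<open>F\<close>, \<open>G\<close>, \<open>H\<close>, \<open>J\<close> are the higher order terms after division by \<open>s ^ 5\<close>, and \<open>Fr\<close>,
  \<open>Ft\<close>, \<open>Hr\<close>, \<open>Ht\<close> their components in the frame rotating with \<open>\<theta>\<close>. The equation for \<open>\<tau>\<close> removes
  the leading term of \<open>\<rho>'\<close>.
\<close>
lemma hopf_hopf_identity:
  fixes sn cs \<sigma> \<tau> b c \<beta> \<gamma> \<rho> \<eta> s z1 z2 F G H J Fr Ft Hr Ht C hs h1 h2 ht X Y Z W Om Ga :: complex
  assumes cs_sn: "sn\<^sup>2 + cs\<^sup>2 = 1" and st: "\<sigma> * \<tau> = 1" and b: "2 * \<tau>\<^sup>2 = - b"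
    and \<rho>: "\<rho> = \<tau> + s * z1" and \<eta>: "\<eta> = s * z2"
    and hat: "Fr = cs * F + sn * G" "Ft = cs * G - sn * F" "Hr = cs * H + sn * J" "Ht = cs * J - sn * H"
    and C: "C = \<beta> * \<sigma>\<^sup>2 + \<gamma> * \<sigma> ^ 3 * s * \<eta> + \<sigma> * z2 + s\<^sup>2 * \<tau> * Ft"
    and hs: "hs = s\<^sup>2 * (1 + s * (\<sigma> * z1) + s ^ 3 * \<tau> * Fr)"
    and h1: "h1 = s * (- 5 * z1 + s * (- 3 * \<sigma> * z1\<^sup>2 + \<sigma> * z2\<^sup>2 + c * \<sigma>\<^sup>2 * z2 + \<tau>\<^sup>2 * Hr
        + s\<^sup>2 * \<tau> * Ft * z2 - 2 * \<rho> * s * \<tau> * Fr - s\<^sup>2 * \<tau> * Fr * z1))"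
    and h2: "h2 = s * (- 4 * z2 + s * (- 4 * \<sigma> * z1 * z2 - s * \<tau> * Ft * \<rho> + \<tau>\<^sup>2 * Ht - 3 * s\<^sup>2 * \<tau> * Fr * z2))"
    and ht: "ht = 1 + s\<^sup>2 * C"
    and XYZW: "X = s * (\<sigma> * cs)" "Y = s * (\<sigma> * sn)" "Z = s * (s * \<sigma>\<^sup>2 * (\<rho> * cs - \<eta> * sn))"
      "W = s * (s * \<sigma>\<^sup>2 * (\<rho> * sn + \<eta> * cs))"
    and Om: "Om = \<beta> * (X\<^sup>2 + Y\<^sup>2) + \<gamma> * (W * X - Y * Z)" and Ga: "Ga = - b * (X\<^sup>2 + Y\<^sup>2) + c * (W * X - Y * Z)"
  shows "\<sigma> * (cs * hs - s * sn * ht) = - (1 + Om) * Y + Z + s ^ 5 * F"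
    and "\<sigma> * (sn * hs + s * cs * ht) = (1 + Om) * X + W + s ^ 5 * G"
    and "2 * s * \<sigma>\<^sup>2 * hs * (\<rho> * cs - \<eta> * sn) + s\<^sup>2 * \<sigma>\<^sup>2 * ((s * h1 + z1 * hs) * cs - (s * h2 + z2 * hs) * sn - (\<rho> * sn + \<eta> * cs) * ht)
      = - (1 + Om) * W + Ga * X + s ^ 5 * H"
    and "2 * s * \<sigma>\<^sup>2 * hs * (\<rho> * sn + \<eta> * cs) + s\<^sup>2 * \<sigma>\<^sup>2 * ((s * h1 + z1 * hs) * sn + (s * h2 + z2 * hs) * cs + (\<rho> * cs - \<eta> * sn) * ht)
      = (1 + Om) * Z + Ga * Y + s ^ 5 * J"
proof -
  have r2: "X\<^sup>2 + Y\<^sup>2 = s\<^sup>2 * \<sigma>\<^sup>2" using cs_sn unfolding XYZW by algebra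
  have L: "W * X - Y * Z = s ^ 3 * \<sigma> ^ 3 * \<eta>" using cs_sn unfolding XYZW by algebra
  have ht': "ht = 1 + Om + s * \<sigma> * \<eta> + s ^ 4 * \<tau> * Ft"
    unfolding ht C Om r2 L \<eta> by algebra
  have hs': "hs = s\<^sup>2 * \<sigma> * \<rho> + s ^ 5 * \<tau> * Fr"
    using st unfolding hs \<rho> by algebra
  have d1: "s * h1 + z1 * hs = s * \<sigma> * \<eta>\<^sup>2 + s ^ 4 * \<tau> * Ft * \<eta> - b * s * \<sigma> + c * \<sigma>\<^sup>2 * s\<^sup>2 * \<eta>
      + s ^ 3 * \<tau>\<^sup>2 * Hr - 2 * s * \<sigma> * \<rho>\<^sup>2 - 2 * \<rho> * s ^ 4 * \<tau> * Fr"
    using st b unfolding h1 hs \<rho> \<eta> by algebra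
  have d2: "s * h2 + z2 * hs = - 3 * s * \<sigma> * \<eta> * \<rho> - s ^ 4 * \<tau> * Ft * \<rho> + s ^ 3 * \<tau>\<^sup>2 * Ht - 2 * \<eta> * s ^ 4 * \<tau> * Fr"
    using st unfolding h2 hs \<rho> \<eta> by algebra
  have inv: "cs * Fr - sn * Ft = F" "sn * Fr + cs * Ft = G" "cs * Hr - sn * Ht = H" "sn * Hr + cs * Ht = J"
    using cs_sn unfolding hat by algebra+
  have Ga': "Ga = - b * (s\<^sup>2 * \<sigma>\<^sup>2) + c * (s ^ 3 * \<sigma> ^ 3 * \<eta>)" unfolding Ga r2 L ..
  show "\<sigma> * (cs * hs - s * sn * ht) = - (1 + Om) * Y + Z + s ^ 5 * F"
    using st unfolding hs' ht' XYZW inv(1)[symmetric] by algebra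
  show "\<sigma> * (sn * hs + s * cs * ht) = (1 + Om) * X + W + s ^ 5 * G"
    using st unfolding hs' ht' XYZW inv(2)[symmetric] by algebra
  show "2 * s * \<sigma>\<^sup>2 * hs * (\<rho> * cs - \<eta> * sn) + s\<^sup>2 * \<sigma>\<^sup>2 * ((s * h1 + z1 * hs) * cs - (s * h2 + z2 * hs) * sn - (\<rho> * sn + \<eta> * cs) * ht)
      = - (1 + Om) * W + Ga * X + s ^ 5 * H"
    using st unfolding d1 d2 unfolding hs' ht' Ga' XYZW inv(3)[symmetric] by algebra
  show "2 * s * \<sigma>\<^sup>2 * hs * (\<rho> * sn + \<eta> * cs) + s\<^sup>2 * \<sigma>\<^sup>2 * ((s * h1 + z1 * hs) * sn + (s * h2 + z2 * hs) * cs + (\<rho> * cs - \<eta> * sn) * ht)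
      = (1 + Om) * Z + Ga * Y + s ^ 5 * J"
    using st unfolding d1 d2 unfolding hs' ht' Ga' XYZW inv(4)[symmetric] by algebra
qed

text \<open>
  With \<open>x + iy = r * exp (i\<theta>)\<close> and \<open>z + iw = r ^ 2 * (\<rho> + i\<eta>) * exp (i\<theta>)\<close> the leading terms are
  \<open>r' = \<rho> * r ^ 2\<close>, \<open>\<rho>' = r * (\<eta> ^ 2 - b - 2 * \<rho> ^ 2)\<close>, \<open>\<eta>' = - 3 * r * \<rho> * \<eta>\<close>. The weights come from
  the second derivative \<open>r'' = - b * r ^ 3\<close>. The chart is centered at the equilibrium \<open>\<rho> = \<tau>\<close>, \<open>\<eta> = 0\<close>, where the rates in units
  of \<open>s = \<tau> * r\<close> are 4 and 3, increased by 1 as \<open>\<rho> - \<tau>\<close> and \<open>\<eta>\<close> are divided by \<open>s\<close>. The higher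
  order terms are too small to produce a forcing term.
\<close>
theorem hopf_hopf_blowup_to_NF:
  fixes b c \<beta> \<gamma> :: real and F G H J :: "complex ^ 4 \<Rightarrow> complex"
  assumes b: "b \<noteq> 0" and W: "open W" "0 \<in> W"
    and ana: "real_analytic_near_0 F" "real_analytic_near_0 G" "real_analytic_near_0 H" "real_analytic_near_0 J"
    and van: "vanishes_to_order 5 F" "vanishes_to_order 5 G" "vanishes_to_order 5 H" "vanishes_to_order 5 J"
  shows "blowup_to_NF TYPE(2) W (hopf_hopf b c \<beta> \<gamma> F G H J)"
proof -
  define \<tau> where "\<tau> = csqrt (- of_real b / 2)"
  have \<tau>_sq: "2 * \<tau>\<^sup>2 = - of_real b" by (simp add: \<tau>_def)
  then have \<tau>: "\<tau> \<noteq> 0" using b by auto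
  define \<sigma> where "\<sigma> = 1 / \<tau>"
  have \<sigma>\<tau>: "\<sigma> * \<tau> = 1" and \<sigma>: "\<sigma> \<noteq> 0" using \<tau> by (simp_all add: \<sigma>_def)

  obtain Bc where Bc: "Bc \<ge> 0" "\<And>\<theta>. \<theta> \<in> strip 1 \<Longrightarrow> norm (cos \<theta>) \<le> Bc" "\<And>\<theta>. \<theta> \<in> strip 1 \<Longrightarrow> norm (sin \<theta>) \<le> Bc"
    by (rule cos_sin_bounded_on_strip[of 1]) (rule that; assumption)
  define R where "R = 2 * (norm \<sigma> * Bc) + 2 * ((norm \<sigma>)\<^sup>2 * ((norm \<tau> + 1) * Bc + 1 * Bc)) + 1"
  have R: "R > 0" using Bc(1) by (simp add: R_def add_nonneg_pos)
  obtain \<delta>F \<Phi>F MF where \<Phi>F: "\<delta>F > 0" "\<Phi>F analytic_map_on ball 0 \<delta>F \<times> ball 0 R"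
      "\<And>s w. s \<in> ball 0 \<delta>F \<Longrightarrow> w \<in> ball 0 R \<Longrightarrow> F (s *\<^sub>C w) = s ^ 5 * \<Phi>F (s, w)"
      "\<And>s w. s \<in> ball 0 \<delta>F \<Longrightarrow> w \<in> ball 0 R \<Longrightarrow> norm (\<Phi>F (s, w)) \<le> MF"
    by (rule analytic_scaling_quotient[OF ana(1) van(1) R]) (rule that; assumption)
  obtain \<delta>G \<Phi>G MG where \<Phi>G: "\<delta>G > 0" "\<Phi>G analytic_map_on ball 0 \<delta>G \<times> ball 0 R"
      "\<And>s w. s \<in> ball 0 \<delta>G \<Longrightarrow> w \<in> ball 0 R \<Longrightarrow> G (s *\<^sub>C w) = s ^ 5 * \<Phi>G (s, w)"
      "\<And>s w. s \<in> ball 0 \<delta>G \<Longrightarrow> w \<in> ball 0 R \<Longrightarrow> norm (\<Phi>G (s, w)) \<le> MG"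
    by (rule analytic_scaling_quotient[OF ana(2) van(2) R]) (rule that; assumption)
  obtain \<delta>H \<Phi>H MH where \<Phi>H: "\<delta>H > 0" "\<Phi>H analytic_map_on ball 0 \<delta>H \<times> ball 0 R"
      "\<And>s w. s \<in> ball 0 \<delta>H \<Longrightarrow> w \<in> ball 0 R \<Longrightarrow> H (s *\<^sub>C w) = s ^ 5 * \<Phi>H (s, w)"
      "\<And>s w. s \<in> ball 0 \<delta>H \<Longrightarrow> w \<in> ball 0 R \<Longrightarrow> norm (\<Phi>H (s, w)) \<le> MH"
    by (rule analytic_scaling_quotient[OF ana(3) van(3) R]) (rule that; assumption)
  obtain \<delta>J \<Phi>J MJ where \<Phi>J: "\<delta>J > 0" "\<Phi>J analytic_map_on ball 0 \<delta>J \<times> ball 0 R"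
      "\<And>s w. s \<in> ball 0 \<delta>J \<Longrightarrow> w \<in> ball 0 R \<Longrightarrow> J (s *\<^sub>C w) = s ^ 5 * \<Phi>J (s, w)"
      "\<And>s w. s \<in> ball 0 \<delta>J \<Longrightarrow> w \<in> ball 0 R \<Longrightarrow> norm (\<Phi>J (s, w)) \<le> MJ"
    by (rule analytic_scaling_quotient[OF ana(4) van(4) R]) (rule that; assumption)

  obtain r0 where r0: "r0 > 0" "ball 0 r0 \<subseteq> W" using W open_contains_ball by blast
  define M where "M = norm (of_real \<beta> * \<sigma>\<^sup>2) + norm (of_real \<gamma> * \<sigma> ^ 3) + norm \<sigma> + norm \<tau> * (Bc * \<bar>MG\<bar> + Bc * \<bar>MF\<bar>)"
  have M: "M \<ge> 0" using Bc(1) by (simp add: M_def)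
  define Bounds where "Bounds = {1, \<delta>F, \<delta>G, \<delta>H, \<delta>J, r0 / R, 1 / (2 * (M + 1))}"
  define \<kappa> where "\<kappa> = Min Bounds"
  have \<kappa>: "\<kappa> > 0"
    using \<Phi>F(1) \<Phi>G(1) \<Phi>H(1) \<Phi>J(1) r0(1) R M by (simp add: \<kappa>_def Bounds_def add_nonneg_pos)
  have \<kappa>_Min: "\<kappa> \<le> t" if "t \<in> Bounds" for t
    unfolding \<kappa>_def using that by (intro Min_le) (simp add: Bounds_def)
  have \<kappa>_le: "\<kappa> \<le> 1" "\<kappa> \<le> \<delta>F" "\<kappa> \<le> \<delta>G" "\<kappa> \<le> \<delta>H" "\<kappa> \<le> \<delta>J"
    by (rule \<kappa>_Min; simp add: Bounds_def)+
  have "\<kappa> \<le> r0 / R" "\<kappa> \<le> 1 / (2 * (M + 1))"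
    by (rule \<kappa>_Min; simp add: Bounds_def)+
  then have \<kappa>_mult: "\<kappa> * R \<le> r0" "\<kappa> * (M + 1) \<le> 1 / 2"
  proof -
    show "\<kappa> * R \<le> r0" using \<open>\<kappa> \<le> r0 / R\<close> R by (simp only: pos_le_divide_eq)
    show "\<kappa> * (M + 1) \<le> 1 / 2" using \<open>\<kappa> \<le> 1 / (2 * (M + 1))\<close> M by (simp add: field_simps)
  qed

  define \<rho> where "\<rho> p = \<tau> + fst p * fst (snd p) $ 1" for p :: "complex \<times> (complex ^ 2) \<times> complex"
  define \<eta> where "\<eta> p = fst p * fst (snd p) $ 2" for p :: "complex \<times> (complex ^ 2) \<times> complex"
  define w where "w p = (vector [\<sigma> * cos (snd (snd p)), \<sigma> * sin (snd (snd p)),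
      fst p * \<sigma>\<^sup>2 * (\<rho> p * cos (snd (snd p)) - \<eta> p * sin (snd (snd p))),
      fst p * \<sigma>\<^sup>2 * (\<rho> p * sin (snd (snd p)) + \<eta> p * cos (snd (snd p)))] :: complex ^ 4)" for p
  define \<Psi> where "\<Psi> p = fst p *\<^sub>C w p" for p
  have dom: "norm s < \<kappa>" "norm (z $ 2) \<le> 1" "norm (\<eta> (s, z, \<theta>)) \<le> 1" "\<theta> \<in> strip 1" "w (s, z, \<theta>) \<in> ball 0 R"
      "s \<in> ball 0 \<delta>F" "s \<in> ball 0 \<delta>G" "s \<in> ball 0 \<delta>H" "s \<in> ball 0 \<delta>J"
    if p: "(s, z, \<theta>) \<in> BBT \<kappa> 1" for s \<theta> and z :: "complex ^ 2"
  proof -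
    show s: "norm s < \<kappa>" and th: "\<theta> \<in> strip 1" using p by (auto simp: BBT_eq)
    then show "s \<in> ball 0 \<delta>F" "s \<in> ball 0 \<delta>G" "s \<in> ball 0 \<delta>H" "s \<in> ball 0 \<delta>J" using \<kappa>_le by auto
    have s1: "norm s \<le> 1" using s \<kappa>_le(1) by simp
    have "norm z < 1" using p \<kappa>_le(1) by (auto simp: BBT_eq)
    then have z1: "norm (z $ j) \<le> 1" for j using Finite_Cartesian_Product.norm_nth_le[of z j] by linarith
    then show "norm (z $ 2) \<le> 1" .
    have sz: "norm (s * z $ j) \<le> 1" for j
      using mult_mono[OF s1 z1[of j]] by (simp add: norm_mult)
    from sz[of 2] show l1: "norm (\<eta> (s, z, \<theta>)) \<le> 1" by (simp add: \<eta>_def)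
    have \<rho>1: "norm (\<rho> (s, z, \<theta>)) \<le> norm \<tau> + 1"
      using norm_triangle_mono[OF order_refl sz[of 1]] by (simp add: \<rho>_def)
    note cs = Bc(2)[OF th] and sn = Bc(3)[OF th]
    have prod_le: "norm (\<rho> (s, z, \<theta>) * t) \<le> (norm \<tau> + 1) * Bc" "norm (\<eta> (s, z, \<theta>) * t) \<le> 1 * Bc"
      if "norm t \<le> Bc" for t
      unfolding norm_mult by (rule mult_mono[OF \<rho>1 that] mult_mono[OF l1 that]; simp)+
    have scale: "norm (s * \<sigma>\<^sup>2 * t) \<le> (norm \<sigma>)\<^sup>2 * T" if "norm t \<le> T" for t T
    proof -
      have "norm s * (norm \<sigma>)\<^sup>2 * norm t \<le> 1 * (norm \<sigma>)\<^sup>2 * T"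
        using s1 that by (intro mult_mono) auto
      then show ?thesis by (simp add: norm_mult norm_power)
    qed
    have 3: "norm (s * \<sigma>\<^sup>2 * (\<rho> (s, z, \<theta>) * cos \<theta> - \<eta> (s, z, \<theta>) * sin \<theta>)) \<le> (norm \<sigma>)\<^sup>2 * ((norm \<tau> + 1) * Bc + 1 * Bc)"
      by (intro scale order_trans[OF norm_triangle_ineq4] add_mono prod_le cs sn)
    have 4: "norm (s * \<sigma>\<^sup>2 * (\<rho> (s, z, \<theta>) * sin \<theta> + \<eta> (s, z, \<theta>) * cos \<theta>)) \<le> (norm \<sigma>)\<^sup>2 * ((norm \<tau> + 1) * Bc + 1 * Bc)"
      by (intro scale order_trans[OF norm_triangle_ineq] add_mono prod_le cs sn)
    have 12: "norm (\<sigma> * cos \<theta>) \<le> norm \<sigma> * Bc" "norm (\<sigma> * sin \<theta>) \<le> norm \<sigma> * Bc"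
      using cs sn by (auto simp: norm_mult intro: mult_left_mono)
    have "norm (w (s, z, \<theta>)) \<le> norm (\<sigma> * cos \<theta>) + norm (\<sigma> * sin \<theta>)
        + norm (s * \<sigma>\<^sup>2 * (\<rho> (s, z, \<theta>) * cos \<theta> - \<eta> (s, z, \<theta>) * sin \<theta>))
        + norm (s * \<sigma>\<^sup>2 * (\<rho> (s, z, \<theta>) * sin \<theta> + \<eta> (s, z, \<theta>) * cos \<theta>))"
      unfolding w_def fst_conv snd_conv by (rule norm_vector_4_le)
    then have "norm (w (s, z, \<theta>)) < R" using 3 4 12 unfolding R_def by linarith
    then show "w (s, z, \<theta>) \<in> ball 0 R" by simp
  qed
  have w_ana: "w analytic_map_on BBT \<kappa> 1"
    unfolding w_def \<rho>_def \<eta>_def by (intro analytic_map_intros)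
  have w_shift: "w (s, z, \<theta> + 2 * of_real pi) = w (s, z, \<theta>)" for s z \<theta>
    by (simp add: w_def \<rho>_def \<eta>_def cos_sin_shift)
  have hat: "analytic_on_BBT \<kappa> 1 (\<lambda>p. \<Phi> (fst p, w p))"
    if "\<Phi> analytic_map_on ball 0 \<delta> \<times> ball 0 R" "\<kappa> \<le> \<delta>"
    for \<Phi> :: "complex \<times> (complex ^ 4) \<Rightarrow> complex" and \<delta>
  proof (rule analytic_on_BBTI)
    show "(\<lambda>p. \<Phi> (fst p, w p)) analytic_map_on BBT \<kappa> 1"
    proof (rule analytic_map_on_compose[OF that(1)])
      show "(\<lambda>p. (fst p, w p)) analytic_map_on BBT \<kappa> 1" by (intro analytic_map_intros w_ana)
      show "(\<lambda>p. (fst p, w p)) ` BBT \<kappa> 1 \<subseteq> ball 0 \<delta> \<times> ball 0 R"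
      proof (rule image_subsetI)
        fix p :: "complex \<times> (complex ^ 2) \<times> complex" assume p: "p \<in> BBT \<kappa> 1"
        obtain s z \<theta> where "p = (s, z, \<theta>)" by (cases p)
        with dom(1,5)[of s z \<theta>] p that(2) show "(fst p, w p) \<in> ball 0 \<delta> \<times> ball 0 R" by simp
      qed
    qed
  qed (simp add: w_shift)
  define Fh where "Fh p = \<Phi>F (fst p, w p)" for p
  define Gh where "Gh p = \<Phi>G (fst p, w p)" for p
  define Hh where "Hh p = \<Phi>H (fst p, w p)" for p
  define Jh where "Jh p = \<Phi>J (fst p, w p)" for p
  have hats: "analytic_on_BBT \<kappa> 1 Fh" "analytic_on_BBT \<kappa> 1 Gh" "analytic_on_BBT \<kappa> 1 Hh" "analytic_on_BBT \<kappa> 1 Jh"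
    unfolding Fh_def Gh_def Hh_def Jh_def
    by (rule hat[OF \<Phi>F(2) \<kappa>_le(2)] hat[OF \<Phi>G(2) \<kappa>_le(3)] hat[OF \<Phi>H(2) \<kappa>_le(4)] hat[OF \<Phi>J(2) \<kappa>_le(5)])+
  define Fr where "Fr p = cos (snd (snd p)) * Fh p + sin (snd (snd p)) * Gh p" for p
  define Ft where "Ft p = cos (snd (snd p)) * Gh p - sin (snd (snd p)) * Fh p" for p
  define Hr where "Hr p = cos (snd (snd p)) * Hh p + sin (snd (snd p)) * Jh p" for p
  define Ht where "Ht p = cos (snd (snd p)) * Jh p - sin (snd (snd p)) * Hh p" for p
  define C where "C p = of_real \<beta> * \<sigma>\<^sup>2 + of_real \<gamma> * \<sigma> ^ 3 * fst p * \<eta> p + \<sigma> * fst (snd p) $ 2 + (fst p)\<^sup>2 * \<tau> * Ft p" for p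
  \<comment> \<open>\<open>g\<close> is the angular velocity, the factor by which the normal form divides.\<close>
  define g where "g p = 1 + (fst p)\<^sup>2 * C p" for p
  note an = analytic_map_intros hats[THEN analytic_on_BBTD(1)]
  note per = cos_sin_shift hats[THEN analytic_on_BBTD(2)]
  have polar_ana: "Fr analytic_map_on BBT \<kappa> 1" "Ft analytic_map_on BBT \<kappa> 1" "Hr analytic_map_on BBT \<kappa> 1" "Ht analytic_map_on BBT \<kappa> 1"
    unfolding Fr_def Ft_def Hr_def Ht_def by (intro an)+
  have polar_shift: "Fr (s, z, \<theta> + 2 * of_real pi) = Fr (s, z, \<theta>)" "Ft (s, z, \<theta> + 2 * of_real pi) = Ft (s, z, \<theta>)"
      "Hr (s, z, \<theta> + 2 * of_real pi) = Hr (s, z, \<theta>)" "Ht (s, z, \<theta> + 2 * of_real pi) = Ht (s, z, \<theta>)"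
    if "(s, z, \<theta>) \<in> BBT \<kappa> 1" for s z \<theta>
    by (simp_all add: Fr_def Ft_def Hr_def Ht_def per that)
  have C_ana: "C analytic_map_on BBT \<kappa> 1" unfolding C_def \<eta>_def by (intro an polar_ana)
  have g_ana: "g analytic_map_on BBT \<kappa> 1" unfolding g_def by (intro analytic_map_intros C_ana)
  have C_shift: "C (s, z, \<theta> + 2 * of_real pi) = C (s, z, \<theta>)" if "(s, z, \<theta>) \<in> BBT \<kappa> 1" for s z \<theta>
    by (simp add: C_def \<eta>_def polar_shift that)
  have g_nz: "g p \<noteq> 0" if "p \<in> BBT \<kappa> 1" for p
  proof -
    obtain s z \<theta> where p: "p = (s, z, \<theta>)" by (cases p)
    note d = dom[OF that[unfolded p]]
    have s1: "norm s \<le> 1" using d(1) \<kappa>_le(1) by simp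
    have "norm (Fh p) \<le> \<bar>MF\<bar>" "norm (Gh p) \<le> \<bar>MG\<bar>"
      using \<Phi>F(4)[OF d(6,5)] \<Phi>G(4)[OF d(7,5)] by (auto simp: Fh_def Gh_def p)
    then have Ft_le: "norm (Ft p) \<le> Bc * \<bar>MG\<bar> + Bc * \<bar>MF\<bar>"
      using Bc(2,3)[OF d(4)] Bc(1) unfolding Ft_def
      by (intro order_trans[OF norm_triangle_ineq4] add_mono) (auto simp: norm_mult p intro!: mult_mono)
    have "norm (s * \<eta> p) \<le> 1 * 1"
      unfolding norm_mult using s1 d(3) by (intro mult_mono) (auto simp: p)
    then have 2: "norm (of_real \<gamma> * \<sigma> ^ 3 * s * \<eta> p) \<le> norm (of_real \<gamma> * \<sigma> ^ 3)"
      using mult_left_mono[of "norm (s * \<eta> p)" 1 "norm (of_real \<gamma> * \<sigma> ^ 3)"] by (simp add: norm_mult mult.assoc)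
    have 3: "norm (\<sigma> * z $ 2) \<le> norm \<sigma>"
      using mult_left_mono[OF d(2), of "norm \<sigma>"] by (simp add: norm_mult)
    have "(norm s)\<^sup>2 \<le> 1" using s1 by (simp add: power_le_one)
    then have "(norm s)\<^sup>2 * (norm \<tau> * norm (Ft p)) \<le> 1 * (norm \<tau> * (Bc * \<bar>MG\<bar> + Bc * \<bar>MF\<bar>))"
      using Ft_le by (intro mult_mono) auto
    then have 4: "norm (s\<^sup>2 * \<tau> * Ft p) \<le> norm \<tau> * (Bc * \<bar>MG\<bar> + Bc * \<bar>MF\<bar>)"
      by (simp add: norm_mult norm_power mult.assoc)
    have "norm (C p) \<le> M"
      unfolding C_def M_def using 2 3 4 by (intro norm_triangle_mono order_refl) (simp_all add: p)
    then have C_le: "norm (C p) \<le> M + 1" by simp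
    have "norm s * norm s \<le> \<kappa> * 1" using d(1) \<kappa> \<kappa>_le(1) by (intro mult_mono) auto
    then have "norm (s\<^sup>2 * C p) \<le> \<kappa> * (M + 1)"
      using C_le \<kappa> unfolding norm_mult norm_power power2_eq_square by (intro mult_mono) auto
    then have "norm (s\<^sup>2 * C p) \<le> 1 / 2" using \<kappa>_mult(2) by linarith
    then have "s\<^sup>2 * C p \<noteq> - 1" by auto
    then show ?thesis by (simp add: g_def p add_eq_0_iff)
  qed
  define A where "A p = (fst p * \<tau> * Fr p - C p * (1 + fst p * (\<sigma> * fst (snd p) $ 1))) / g p" for p
  define q1 where "q1 p = - 3 * \<sigma> * (fst (snd p) $ 1)\<^sup>2 + \<sigma> * (fst (snd p) $ 2)\<^sup>2 + of_real c * \<sigma>\<^sup>2 * fst (snd p) $ 2 + \<tau>\<^sup>2 * Hr p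
        + (fst p)\<^sup>2 * \<tau> * Ft p * fst (snd p) $ 2 - 2 * \<rho> p * fst p * \<tau> * Fr p - (fst p)\<^sup>2 * \<tau> * Fr p * fst (snd p) $ 1" for p
  define q2 where "q2 p = - 4 * \<sigma> * fst (snd p) $ 1 * fst (snd p) $ 2 - fst p * \<tau> * Ft p * \<rho> p + \<tau>\<^sup>2 * Ht p
        - 3 * (fst p)\<^sup>2 * \<tau> * Fr p * fst (snd p) $ 2" for p
  define B where "B p = (vector [(q1 p + 5 * fst p * C p * fst (snd p) $ 1) / g p,
        (q2 p + 4 * fst p * C p * fst (snd p) $ 2) / g p] :: complex ^ 2)" for p
  define l :: "real ^ 2" where "l = vector [5, 4]"
  define m :: "complex ^ 2" where "m = vector [\<sigma>, 0]"
  have A_BBT: "analytic_on_BBT \<kappa> 1 A"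
  proof (rule analytic_on_BBTI)
    show "A analytic_map_on BBT \<kappa> 1"
      unfolding A_def using g_nz by (intro an C_ana g_ana polar_ana) auto
    show "A (x, y, \<theta> + 2 * complex_of_real pi) = A (x, y, \<theta>)" if "(x, y, \<theta>) \<in> BBT \<kappa> 1" for x y \<theta>
      by (simp add: A_def g_def C_shift[OF that] polar_shift[OF that])
  qed
  have B_BBT: "analytic_on_BBT \<kappa> 1 B"
  proof (rule analytic_on_BBTI)
    have q_ana: "q1 analytic_map_on BBT \<kappa> 1" "q2 analytic_map_on BBT \<kappa> 1"
      unfolding q1_def q2_def \<rho>_def by (intro an polar_ana)+
    show "B analytic_map_on BBT \<kappa> 1"
    proof (rule analytic_map_on_componentwise)
      fix i :: 2
      have "(\<lambda>p. (q1 p + 5 * fst p * C p * fst (snd p) $ 1) / g p) analytic_map_on BBT \<kappa> 1"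
        "(\<lambda>p. (q2 p + 4 * fst p * C p * fst (snd p) $ 2) / g p) analytic_map_on BBT \<kappa> 1"
        using g_nz by (intro an C_ana g_ana q_ana; blast)+
      then show "(\<lambda>p. B p $ i) analytic_map_on BBT \<kappa> 1"
        using exhaust_2[of i] by (auto simp: B_def)
    qed
    show "B (x, y, \<theta> + 2 * complex_of_real pi) = B (x, y, \<theta>)" if "(x, y, \<theta>) \<in> BBT \<kappa> 1" for x y \<theta>
      by (simp add: B_def q1_def q2_def \<rho>_def g_def C_shift[OF that] polar_shift[OF that])
  qed

  let ?X = "hopf_hopf b c \<beta> \<gamma> F G H J"
  let ?V = "averaged_form m (\<lambda>\<theta>. 0) (\<lambda>\<theta>. 0) A B l"
  have main: "\<exists>D. (\<Psi> has_derivative D) (at p) \<and> inj D \<and> D (g p *\<^sub>C ?V p) = ?X (\<Psi> p)"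
    if p: "p \<in> BBT \<kappa> 1" "fst p \<noteq> 0" for p
  proof -
    obtain s z \<theta> where psz: "p = (s, z, \<theta>)" by (cases p)
    have s: "s \<noteq> 0" using p(2) by (simp add: psz)
    note pB = p(1)[unfolded psz]
    note d = dom[OF pB]
    define cs where "cs = cos \<theta>"
    define sn where "sn = sin \<theta>"
    have cs_sn: "sn\<^sup>2 + cs\<^sup>2 = 1" by (simp add: cs_def sn_def)
    define D where "D = (\<lambda>h :: complex \<times> (complex ^ 2) \<times> complex. vector
      [\<sigma> * (cs * fst h - s * sn * snd (snd h)),
       \<sigma> * (sn * fst h + s * cs * snd (snd h)),
       2 * s * \<sigma>\<^sup>2 * fst h * (\<rho> p * cs - \<eta> p * sn) + s\<^sup>2 * \<sigma>\<^sup>2 * ((s * fst (snd h) $ 1 + z $ 1 * fst h) * cs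
          - (s * fst (snd h) $ 2 + z $ 2 * fst h) * sn - (\<rho> p * sn + \<eta> p * cs) * snd (snd h)),
       2 * s * \<sigma>\<^sup>2 * fst h * (\<rho> p * sn + \<eta> p * cs) + s\<^sup>2 * \<sigma>\<^sup>2 * ((s * fst (snd h) $ 1 + z $ 1 * fst h) * sn
          + (s * fst (snd h) $ 2 + z $ 2 * fst h) * cs + (\<rho> p * cs - \<eta> p * sn) * snd (snd h))] :: complex ^ 4)"
    have \<Psi>_eq: "\<Psi> = (\<lambda>p. vector [fst p * (\<sigma> * cos (snd (snd p))), fst p * (\<sigma> * sin (snd (snd p))),
        fst p * (fst p * \<sigma>\<^sup>2 * (\<rho> p * cos (snd (snd p)) - \<eta> p * sin (snd (snd p)))),
        fst p * (fst p * \<sigma>\<^sup>2 * (\<rho> p * sin (snd (snd p)) + \<eta> p * cos (snd (snd p))))])"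
      by (simp add: fun_eq_iff \<Psi>_def w_def scaleC_vec_def scaleC_complex_def vec_eq_iff forall_4)
    have D: "(\<Psi> has_derivative D) (at p)"
    proof -
      have th: "((\<lambda>p :: complex \<times> (complex ^ 2) \<times> complex. snd (snd p)) has_derivative (\<lambda>h. snd (snd h))) (at p)"
        by (rule derivative_eq_intros refl)+
      have cos': "((\<lambda>p :: complex \<times> (complex ^ 2) \<times> complex. cos (snd (snd p))) has_derivative (\<lambda>h. - sn * snd (snd h))) (at p)"
        by (rule has_derivative_chain_field[OF _ th]) (simp add: psz sn_def)
      have sin': "((\<lambda>p :: complex \<times> (complex ^ 2) \<times> complex. sin (snd (snd p))) has_derivative (\<lambda>h. cs * snd (snd h))) (at p)"
        by (rule has_derivative_chain_field[OF _ th]) (simp add: psz cs_def)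
      have z': "((\<lambda>p :: complex \<times> (complex ^ 2) \<times> complex. fst (snd p) $ j) has_derivative (\<lambda>h. fst (snd h) $ j)) (at p)" for j
        by (rule bounded_linear.has_derivative[OF bounded_linear_vec_nth]) (rule derivative_eq_intros refl)+
      have \<rho>': "(\<rho> has_derivative (\<lambda>h. s * fst (snd h) $ 1 + z $ 1 * fst h)) (at p)"
        unfolding \<rho>_def by (rule derivative_eq_intros z' refl)+ (simp add: fun_eq_iff psz mult.commute)
      have \<eta>': "(\<eta> has_derivative (\<lambda>h. s * fst (snd h) $ 2 + z $ 2 * fst h)) (at p)"
        unfolding \<eta>_def by (rule derivative_eq_intros z' refl)+ (simp add: fun_eq_iff psz mult.commute)
      show ?thesis
        unfolding \<Psi>_eq D_def
      proof (intro has_derivative_vector_4)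
        show "((\<lambda>p. fst p * (\<sigma> * cos (snd (snd p)))) has_derivative
          (\<lambda>h. \<sigma> * (cs * fst h - s * sn * snd (snd h)))) (at p)"
          by (rule derivative_eq_intros cos' refl)+ (simp add: fun_eq_iff psz cs_def algebra_simps)
        show "((\<lambda>p. fst p * (\<sigma> * sin (snd (snd p)))) has_derivative
          (\<lambda>h. \<sigma> * (sn * fst h + s * cs * snd (snd h)))) (at p)"
          by (rule derivative_eq_intros sin' refl)+ (simp add: fun_eq_iff psz sn_def algebra_simps)
        show "((\<lambda>p. fst p * (fst p * \<sigma>\<^sup>2 * (\<rho> p * cos (snd (snd p)) - \<eta> p * sin (snd (snd p))))) has_derivative
          (\<lambda>h. 2 * s * \<sigma>\<^sup>2 * fst h * (\<rho> p * cs - \<eta> p * sn) + s\<^sup>2 * \<sigma>\<^sup>2 * ((s * fst (snd h) $ 1 + z $ 1 * fst h) * cs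
          - (s * fst (snd h) $ 2 + z $ 2 * fst h) * sn - (\<rho> p * sn + \<eta> p * cs) * snd (snd h)))) (at p)"
          by (rule derivative_eq_intros \<rho>' \<eta>' cos' sin' refl)+
            (simp add: fun_eq_iff psz cs_def sn_def algebra_simps power2_eq_square)
        show "((\<lambda>p. fst p * (fst p * \<sigma>\<^sup>2 * (\<rho> p * sin (snd (snd p)) + \<eta> p * cos (snd (snd p))))) has_derivative
          (\<lambda>h. 2 * s * \<sigma>\<^sup>2 * fst h * (\<rho> p * sn + \<eta> p * cs) + s\<^sup>2 * \<sigma>\<^sup>2 * ((s * fst (snd h) $ 1 + z $ 1 * fst h) * sn
          + (s * fst (snd h) $ 2 + z $ 2 * fst h) * cs + (\<rho> p * cs - \<eta> p * sn) * snd (snd h)))) (at p)"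
          by (rule derivative_eq_intros \<rho>' \<eta>' cos' sin' refl)+
            (simp add: fun_eq_iff psz cs_def sn_def algebra_simps power2_eq_square)
      qed
    qed
    have linD: "linear D" using D has_derivative_linear by blast
    have inj: "inj D"
      unfolding linear_injective_0[OF linD]
    proof (intro allI impI)
      fix h assume h0: "D h = 0"
      obtain hs hz ht where h: "h = (hs, hz, ht)" by (cases h) auto
      note eqs = h0[unfolded D_def h vec_eq_iff forall_4 vector_4 zero_index fst_conv snd_conv]
      have "\<sigma> * (cs * hs - s * sn * ht) = 0" "\<sigma> * (sn * hs + s * cs * ht) = 0" using eqs by blast+
      then have "cs * hs - s * sn * ht = 0" "sn * hs + s * cs * ht = 0" using \<sigma> by simp_all
      with cs_sn have "hs = 0" "s * ht = 0" by algebra+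
      then have hs: "hs = 0" and ht: "ht = 0" using s by simp_all
      have "s\<^sup>2 * \<sigma>\<^sup>2 * (s * hz $ 1 * cs - s * hz $ 2 * sn) = 0" "s\<^sup>2 * \<sigma>\<^sup>2 * (s * hz $ 1 * sn + s * hz $ 2 * cs) = 0"
        using eqs unfolding hs ht by simp_all
      then have "hz $ 1 * cs - hz $ 2 * sn = 0" "hz $ 1 * sn + hz $ 2 * cs = 0"
        using s \<sigma> by (simp_all add: mult.assoc flip: right_diff_distrib distrib_left)
      with cs_sn have "hz $ 1 = 0" "hz $ 2 = 0" by algebra+
      then show "h = 0" by (simp add: h hs ht zero_prod_def vec_eq_iff forall_2)
    qed
    have FGHJ: "F (\<Psi> p) = s ^ 5 * Fh p" "G (\<Psi> p) = s ^ 5 * Gh p" "H (\<Psi> p) = s ^ 5 * Hh p" "J (\<Psi> p) = s ^ 5 * Jh p"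
      using \<Phi>F(3)[OF d(6,5)] \<Phi>G(3)[OF d(7,5)] \<Phi>H(3)[OF d(8,5)] \<Phi>J(3)[OF d(9,5)]
      by (simp_all add: \<Psi>_def Fh_def Gh_def Hh_def Jh_def psz)
    define hs where "hs = s\<^sup>2 * (1 + s * (\<sigma> * z $ 1) + s ^ 3 * \<tau> * Fr p)"
    define h1 where "h1 = s * (- 5 * z $ 1 + s * (- 3 * \<sigma> * (z $ 1)\<^sup>2 + \<sigma> * (z $ 2)\<^sup>2 + of_real c * \<sigma>\<^sup>2 * z $ 2 + \<tau>\<^sup>2 * Hr p
        + s\<^sup>2 * \<tau> * Ft p * z $ 2 - 2 * \<rho> p * s * \<tau> * Fr p - s\<^sup>2 * \<tau> * Fr p * z $ 1))"
    define h2 where "h2 = s * (- 4 * z $ 2 + s * (- 4 * \<sigma> * z $ 1 * z $ 2 - s * \<tau> * Ft p * \<rho> p + \<tau>\<^sup>2 * Ht p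
        - 3 * s\<^sup>2 * \<tau> * Fr p * z $ 2))"
    have h1_eq: "h1 = s * (- 5 * z $ 1 + s * q1 p)" and h2_eq: "h2 = s * (- 4 * z $ 2 + s * q2 p)"
      by (simp_all add: h1_def h2_def q1_def q2_def psz)
    have gV: "g p *\<^sub>C ?V p = (hs, vector [h1, h2], 1 + s\<^sup>2 * C p)"
    proof -
      have gA: "g p * A p = s * \<tau> * Fr p - C p * (1 + s * (\<sigma> * z $ 1))"
        using g_nz[OF p(1)] by (simp add: A_def psz)
      have gB: "g p * B p $ 1 = q1 p + 5 * s * C p * z $ 1" "g p * B p $ 2 = q2 p + 4 * s * C p * z $ 2"
        using g_nz[OF p(1)] by (simp_all add: B_def psz)
      have g: "g p = 1 + s\<^sup>2 * C p" by (simp add: g_def psz)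
      have cd: "cdot m z = \<sigma> * z $ 1" by (simp add: cdot_def m_def sum_2)
      have "g p * (s\<^sup>2 * (1 + s * (\<sigma> * z $ 1) + s\<^sup>2 * A p))
          = s\<^sup>2 * (g p * (1 + s * (\<sigma> * z $ 1)) + s\<^sup>2 * (g p * A p))"
        by (simp add: algebra_simps)
      also have "\<dots> = hs"
        unfolding gA unfolding g hs_def by algebra
      finally have 1: "g p * (s\<^sup>2 * (1 + s * (\<sigma> * z $ 1) + s\<^sup>2 * A p)) = hs" .
      have "g p * (s * (- 5 * z $ 1 + s * B p $ 1)) = s * (g p * (- 5 * z $ 1) + s * (g p * B p $ 1))"
        by (simp add: algebra_simps)
      also have "\<dots> = h1" unfolding gB unfolding g h1_eq by algebra
      finally have 2: "g p * (s * (- 5 * z $ 1 + s * B p $ 1)) = h1" .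
      have "g p * (s * (- 4 * z $ 2 + s * B p $ 2)) = s * (g p * (- 4 * z $ 2) + s * (g p * B p $ 2))"
        by (simp add: algebra_simps)
      also have "\<dots> = h2" unfolding gB unfolding g h2_eq by algebra
      finally have 3: "g p * (s * (- 4 * z $ 2 + s * B p $ 2)) = h2" .
      show ?thesis
        using 1 2 3 g by (simp add: averaged_form_def psz cd l_def scaleC_prod_def scaleC_complex_def scaleC_vec_def vec_eq_iff forall_2)
    qed
    have prem: "\<rho> p = \<tau> + s * z $ 1" "\<eta> p = s * z $ 2"
        "Fr p = cs * Fh p + sn * Gh p" "Ft p = cs * Gh p - sn * Fh p" "Hr p = cs * Hh p + sn * Jh p" "Ht p = cs * Jh p - sn * Hh p"
        "C p = of_real \<beta> * \<sigma>\<^sup>2 + of_real \<gamma> * \<sigma> ^ 3 * s * \<eta> p + \<sigma> * z $ 2 + s\<^sup>2 * \<tau> * Ft p"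
      by (simp_all add: \<rho>_def \<eta>_def Fr_def Ft_def Hr_def Ht_def C_def psz cs_def sn_def)
    have \<Psi>p: "\<Psi> p $ 1 = s * (\<sigma> * cs)" "\<Psi> p $ 2 = s * (\<sigma> * sn)"
        "\<Psi> p $ 3 = s * (s * \<sigma>\<^sup>2 * (\<rho> p * cs - \<eta> p * sn))" "\<Psi> p $ 4 = s * (s * \<sigma>\<^sup>2 * (\<rho> p * sn + \<eta> p * cs))"
      by (simp_all add: \<Psi>_eq psz cs_def sn_def)
    note id = hopf_hopf_identity[OF cs_sn \<sigma>\<tau> \<tau>_sq prem hs_def h1_def h2_def refl \<Psi>p refl refl]
    have "D (g p *\<^sub>C ?V p) = ?X (\<Psi> p)"
      unfolding gV hopf_hopf_def Let_def FGHJ D_def using id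
      by (simp only: vec_eq_iff forall_4 vector_4 vector_2 fst_conv snd_conv simp_thms)
    with D inj show ?thesis by blast
  qed
  have chart: "blowup_chart \<kappa> 1 W ?X \<Psi> g ?V"
    unfolding blowup_chart_def
  proof (intro conjI)
    show "analytic_on_BBT \<kappa> 1 \<Psi>"
      unfolding \<Psi>_def by (intro analytic_on_BBTI analytic_map_intros w_ana) (simp add: w_shift)
    show "\<Psi> ` BBT \<kappa> 1 \<subseteq> W"
    proof (rule image_subsetI)
      fix p :: "complex \<times> (complex ^ 2) \<times> complex" assume p: "p \<in> BBT \<kappa> 1"
      obtain s z \<theta> where psz: "p = (s, z, \<theta>)" by (cases p)
      note d = dom[OF p[unfolded psz]]
      have "norm s * norm (w (s, z, \<theta>)) < \<kappa> * R"
        using d(1,5) \<kappa> R by (intro mult_strict_mono) auto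
      then have "norm (\<Psi> (s, z, \<theta>)) < r0" using \<kappa>_mult(1) by (simp add: \<Psi>_def norm_scaleC_vec)
      then show "\<Psi> p \<in> W" using r0(2) by (auto simp: psz)
    qed
    show "\<forall>y \<theta>. (0, y, \<theta>) \<in> BBT \<kappa> 1 \<longrightarrow> \<Psi> (0, y, \<theta>) = 0" by (simp add: \<Psi>_def)
    show "analytic_on_BBT \<kappa> 1 g"
      by (intro analytic_on_BBTI g_ana) (simp add: g_def C_shift)
    show "\<forall>p\<in>BBT \<kappa> 1. g p \<noteq> 0" using g_nz by blast
  qed (use main in blast)
  have l_pos: "l $ j > 0" for j
    using exhaust_2[of j] by (auto simp: l_def)
  show ?thesis
    by (rule blowup_to_NF_of_averaged_form[OF chart \<kappa> zero_less_one, where ?K2.0="\<lambda>\<theta>. 0"])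
      (simp_all add: l_pos A_BBT B_BBT)
qed

section \<open>Both systems\<close>

theorem proposition1p3:
  shows
   "(\<forall>(a::real) (b::real) F G H (W :: (complex^3) set).
       a \<noteq> 0 \<longrightarrow> b \<notin> {-1..0} \<longrightarrow>
       open W \<longrightarrow> 0 \<in> W \<longrightarrow>
       real_analytic_near_0 F \<longrightarrow> real_analytic_near_0 G \<longrightarrow> real_analytic_near_0 H \<longrightarrow>
       vanishes_to_order 3 F \<longrightarrow> vanishes_to_order 3 G \<longrightarrow> vanishes_to_order 3 H \<longrightarrow>
       (\<forall>\<^sub>F v in nhds 0. F (vector [- v$1, - v$3, - v$2]) = F v) \<longrightarrow>
       (\<forall>\<^sub>F v in nhds 0. G (vector [- v$1, - v$3, - v$2]) = H v) \<longrightarrow>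
       blowup_to_NF TYPE(1) W (zero_hopf a b F G H))
    \<and>
    (\<forall>(b::real) (c::real) (\<beta>::real) (\<gamma>::real) F G H J (W :: (complex^4) set).
       b \<noteq> 0 \<longrightarrow>
       open W \<longrightarrow> 0 \<in> W \<longrightarrow>
       real_analytic_near_0 F \<longrightarrow> real_analytic_near_0 G \<longrightarrow>
       real_analytic_near_0 H \<longrightarrow> real_analytic_near_0 J \<longrightarrow>
       vanishes_to_order 5 F \<longrightarrow> vanishes_to_order 5 G \<longrightarrow>
       vanishes_to_order 5 H \<longrightarrow> vanishes_to_order 5 J \<longrightarrow>
       reversible_near_0 (\<lambda>v. vector [v$1, - v$2, - v$3, v$4]) (hopf_hopf b c \<beta> \<gamma> F G H J) \<longrightarrow>
       blowup_to_NF TYPE(2) W (hopf_hopf b c \<beta> \<gamma> F G H J))"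
  by (intro conjI allI impI) (rule zero_hopf_blowup_to_NF hopf_hopf_blowup_to_NF; assumption)+

end
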